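(* Let $m, n$ be positive integers, let $\mathbf{W}^1, \ldots, \mathbf{W}^m$ be standard planar Brownian motions started at the origin and $\mathbf{B}^1, \ldots, \mathbf{B}^n$ standard planar Brownian bridges on $[0,1]$, all $m+n$ processes being independent. Let $\mathsf{L}_{m,n}$ be the perimeter of the convex hull of $$\bigcup_{i=1}^m \{\mathbf{W}^i(t) : t \in [0,1]\} \cup \bigcup_{j=1}^n \{\mathbf{B}^j(t) : t \in [0,1]\}.$$ Then $$\begin{aligned}\mathbb{E}[\mathsf{L}_{m,n}] &= 2m\sqrt{2\pi}\int_0^\infty x e^{-\frac{x^2}{2}} \operatorname{erf}\left(\frac{x}{\sqrt 2}\right)^{m-1}\left(1 - e^{-2x^2}\right)^n dx \\ &\quad + 8n\pi \int_0^\infty x^2 e^{-2x^2}\operatorname{erf}\left(\frac{x}{\sqrt2}\right)^m \left(1 - e^{-2x^2}\right)^{n-1} dx.\end{aligned}$$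
   Context: A standard planar Brownian motion has two independent coordinates, each a standard one-dimensional Brownian motion started at $0$. A standard planar Brownian bridge has two independent coordinates, each a standard one-dimensional Brownian bridge on $[0,1]$ (standard Brownian motion started at $0$ and conditioned to return to $0$ at time $1$). The error function is $\operatorname{erf}(z) = \frac{2}{\sqrt\pi}\int_0^z e^{-u^2}\,du$. The perimeter of a planar convex body is the length of its boundary. *)

theory Defs
  imports "HOL-Probability.Probability"
begin

definition erf :: "real \<Rightarrow> real" where
  "erf z = 2 / sqrt pi * (LBINT u=0..z. exp (- (u\<^sup>2)))"

text \<open>
  All processes have time parameter in \<open>[0,1]\<close>; values at other times are ignored. Processes are
  independent if their trajectories are, as random elements of the product space over \<open>[0,1]\<close>.
\<close>

definition indep_processes ::
  "'a measure \<Rightarrow> ('i \<Rightarrow> real \<Rightarrow> 'a \<Rightarrow> 'b::topological_space) \<Rightarrow> 'i set \<Rightarrow> bool" where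
  "indep_processes M X I \<longleftrightarrow>
     prob_space.indep_vars M (\<lambda>_. PiM {0..1} (\<lambda>_. borel))
       (\<lambda>i \<omega>. \<lambda>t\<in>{0..1}. X i t \<omega>) I"

definition continuous_process ::
  "'a measure \<Rightarrow> (real \<Rightarrow> 'a \<Rightarrow> 'b::topological_space) \<Rightarrow> bool" where
  "continuous_process M X \<longleftrightarrow>
     (\<forall>t\<in>{0..1}. X t \<in> borel_measurable M) \<and>
     (\<forall>\<omega>\<in>space M. continuous_on {0..1} (\<lambda>t. X t \<omega>))"

definition brownian_motion :: "'a measure \<Rightarrow> (real \<Rightarrow> 'a \<Rightarrow> real) \<Rightarrow> bool" where
  "brownian_motion M X \<longleftrightarrow>
     continuous_process M X \<and>
     (AE \<omega> in M. X 0 \<omega> = 0) \<and>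
     (\<forall>s t. 0 \<le> s \<and> s < t \<and> t \<le> 1 \<longrightarrow>
        distributed M lborel (\<lambda>\<omega>. X t \<omega> - X s \<omega>) (normal_density 0 (sqrt (t - s)))) \<and>
     (\<forall>(k::nat) \<tau>. mono_on {..k} \<tau> \<and> \<tau> ` {..k} \<subseteq> {0..1} \<longrightarrow>
        prob_space.indep_vars M (\<lambda>_. borel) (\<lambda>i \<omega>. X (\<tau> (Suc i)) \<omega> - X (\<tau> i) \<omega>) {..<k})"

text \<open>
  For \<open>0 = \<tau> 0 < \<tau> 1 < \<dots> < \<tau> k\<close> and \<open>x 0 = 0\<close>, the value at \<open>(x 1, \<dots>, x k)\<close> of the joint
  density of a standard Brownian motion at the times \<open>\<tau> 1, \<dots>, \<tau> k\<close>.
\<close>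

definition brownian_density :: "(nat \<Rightarrow> real) \<Rightarrow> nat \<Rightarrow> (nat \<Rightarrow> real) \<Rightarrow> real" where
  "brownian_density \<tau> k x =
     (\<Prod>i<k. normal_density 0 (sqrt (\<tau> (Suc i) - \<tau> i)) (x (Suc i) - x i))"

text \<open>
  Brownian motion \<open>W\<close> conditioned on the null event \<open>W 1 = 0\<close>: the finite-dimensional densities
  are the conditional densities given \<open>W 1 = 0\<close>, that is, the joint density of
  \<open>W (\<tau> 1), \<dots>, W (\<tau> k), W 1\<close> at \<open>(x 1, \<dots>, x k, 0)\<close> divided by the density of \<open>W 1\<close> at \<open>0\<close>.
\<close>

definition brownian_bridge :: "'a measure \<Rightarrow> (real \<Rightarrow> 'a \<Rightarrow> real) \<Rightarrow> bool" where
  "brownian_bridge M X \<longleftrightarrow>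
     continuous_process M X \<and>
     (AE \<omega> in M. X 0 \<omega> = 0 \<and> X 1 \<omega> = 0) \<and>
     (\<forall>(k::nat) \<tau>. \<tau> 0 = 0 \<and> \<tau> (Suc k) = 1 \<and> strict_mono_on {..Suc k} \<tau> \<longrightarrow>
        distributed M (PiM {1..k} (\<lambda>_. lborel)) (\<lambda>\<omega>. \<lambda>i\<in>{1..k}. X (\<tau> i) \<omega>)
          (\<lambda>x. ennreal (brownian_density \<tau> (Suc k) (x(0 := 0, Suc k := 0))
                        / normal_density 0 1 0)))"

definition planar_brownian_motion :: "'a measure \<Rightarrow> (real \<Rightarrow> 'a \<Rightarrow> real^2) \<Rightarrow> bool" where
  "planar_brownian_motion M X \<longleftrightarrow>
     (\<forall>c. brownian_motion M (\<lambda>t \<omega>. X t \<omega> $ c)) \<and>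
     indep_processes M (\<lambda>c t \<omega>. X t \<omega> $ c) UNIV"

definition planar_brownian_bridge :: "'a measure \<Rightarrow> (real \<Rightarrow> 'a \<Rightarrow> real^2) \<Rightarrow> bool" where
  "planar_brownian_bridge M X \<longleftrightarrow>
     (\<forall>c. brownian_bridge M (\<lambda>t \<omega>. X t \<omega> $ c)) \<and>
     indep_processes M (\<lambda>c t \<omega>. X t \<omega> $ c) UNIV"

definition curve_length :: "(real \<Rightarrow> 'a::metric_space) \<Rightarrow> ennreal" where
  "curve_length g =
     (SUP ts \<in> {ts. sorted ts \<and> set ts \<subseteq> {0..1}}.
        \<Sum>i < length ts - 1. ennreal (dist (g (ts ! i)) (g (ts ! Suc i))))"

text \<open>
  The boundary of a convex body \<open>K\<close> with nonempty interior is a simple closed rectifiable curve,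
  whose length does not depend on the parametrization. If the interior is empty, no such
  curve exists and the value is unspecified.
\<close>

definition perimeter :: "(real^2) set \<Rightarrow> real" where
  "perimeter K =
     (THE l. 0 \<le> l \<and>
        (\<exists>g. simple_path g \<and> pathfinish g = pathstart g \<and> path_image g = frontier K \<and>
             curve_length g = ennreal l))"

end

theory Submission
  imports Defs "HOL-Complex_Analysis.Contour_Integration" "HOL-Real_Asymp.Real_Asymp"
begin

text \<open>
  By Cauchy's formula, the perimeter of a planar convex body is half the integral over
  \<open>\<theta> \<in> [0, 2 \<pi>]\<close> of its width in the direction \<open>\<theta>\<close>. All processes start at the origin, so the width of
  the hull is the sum of the maxima, over all processes and times, of the projections to the
  directions \<open>\<theta>\<close> and \<open>\<theta> + \<pi>\<close>. The projections are one-dimensional Brownian motions and bridges, and by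
  independence their overall maximum has distribution function
  \<open>F x = erf (x / sqrt 2) ^ m * (1 - exp (- 2 * x\<^sup>2)) ^ n\<close>. Hence the expected perimeter is
  \<open>2 \<pi>\<close> times the integral of \<open>1 - F\<close>, that is, of \<open>x * F' x\<close>, over \<open>[0, \<infinity>)\<close>.

  The distribution of a single maximum comes from the reflection principle. On the grid of mesh
  \<open>1 / N\<close> the probability to stay below \<open>b\<close> is given by an \<open>N\<close>-fold iterate of a killed Gaussian
  kernel. Solutions of the heat equation that are antisymmetric about \<open>b\<close> bound these iterates from
  below, and solutions antisymmetric about \<open>b + \<epsilon>\<close> bound them from above up to the probability of a
  jump over \<open>(b, b + \<epsilon>)\<close>.
\<close>

section \<open>Perimeter of a planar convex body\<close>

text \<open>The heat flows are compared with the killed walk by sign alone: if a solution is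
  nonnegative below \<open>b\<close> and nonpositive above it, dropping the part of its integral
  above \<open>b\<close> can only increase it. So the reflection principle is obtained on finite
  grids without stopping times. A discrete walk jumps over the level instead of hitting it, which
  spoils the opposite inequality; raising the level by \<epsilon> repairs it as long as \<epsilon>
  is large against the step deviation. The hypotheses speak of coordinates, not of projections. A
  projection is obtained by rotating the pair of coordinate vectors taken on the grid, whose joint
  Gaussian density is rotation invariant. Cauchy's formula comes from Crofton's counting argument:
  the norm of a vector is a quarter of the integral of its absolute projections over all directions,
  and a line through the interior of a convex body meets the frontier at most twice. Suprema and the
  degeneracy of the hull are read off at dyadic times, where measurability is a countable matter;
  continuity of the paths makes this lossless.\<close>

definition dir :: "real \<Rightarrow> real^2" where
  "dir \<theta> = vector [cos \<theta>, sin \<theta>]"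

lemma inner_real2: "(x::real^2) \<bullet> y = x$1 * y$1 + x$2 * y$2"
  by (simp add: inner_vec_def sum_2)

lemma norm_real2: "norm (x::real^2) = sqrt ((x$1)\<^sup>2 + (x$2)\<^sup>2)"
  by (simp add: norm_eq_sqrt_inner inner_real2 power2_eq_square)

lemma inner_dir: "x \<bullet> dir \<theta> = x$1 * cos \<theta> + x$2 * sin \<theta>"
  by (simp add: inner_real2 dir_def)

lemma norm_dir [simp]: "norm (dir \<theta>) = 1"
  by (simp add: norm_real2 dir_def)

text \<open>Relative frontiers of convex bodies of equal affine dimension are homeomorphic, even
  across types. The model body is the disc in \<open>complex\<close>, whose frontier is already
  traversed by the simple loop \<open>circlepath\<close>.\<close>

lemma simple_loop_frontier_convex:
  fixes K :: "(real^2) set"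
  assumes "convex K" "compact K" "interior K \<noteq> {}"
  obtains g where "simple_path g" "pathfinish g = pathstart g" "path_image g = frontier K"
proof -
  have "aff_dim K = 2" using aff_dim_nonempty_interior[OF assms(3)] by simp
  moreover have "aff_dim (cball (0::complex) 1) = 2" by (simp add: aff_dim_cball)
  ultimately have "rel_frontier (cball (0::complex) 1) homeomorphic rel_frontier K"
    using assms by (intro homeomorphic_rel_frontiers_convex_bounded_sets) (auto simp: compact_imp_bounded)
  moreover have "rel_frontier K = frontier K"
    using assms by (simp add: rel_frontier_nonempty_interior)
  moreover have "rel_frontier (cball (0::complex) 1) = sphere 0 1" by (simp add: rel_frontier_cball)
  ultimately obtain h k where hk: "homeomorphism (sphere (0::complex) 1) (frontier K) h k"
    unfolding homeomorphic_def by auto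
  define g where "g = h \<circ> circlepath 0 1"
  have pi: "path_image (circlepath 0 1) = sphere 0 1" by (simp add: path_image_circlepath)
  show thesis
  proof
    show "simple_path g" unfolding g_def
      using hk pi by (intro simple_path_continuous_image)
        (auto simp: simple_path_circlepath homeomorphism_def intro: inj_on_inverseI)
    show "pathfinish g = pathstart g" unfolding g_def by (simp add: pathfinish_compose pathstart_compose)
    show "path_image g = frontier K" unfolding g_def path_image_compose pi
      using hk by (simp add: homeomorphism_def)
  qed
qed

lemma IVT_between:
  fixes f :: "real \<Rightarrow> real"
  assumes "a \<le> b" "continuous_on {a..b} f" "min (f a) (f b) \<le> c" "c \<le> max (f a) (f b)"
  shows "\<exists>t. a \<le> t \<and> t \<le> b \<and> f t = c"
proof (cases "f a \<le> f b")
  case True then show ?thesis using assms by (intro IVT') auto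
next
  case False then show ?thesis using assms by (intro IVT2') auto
qed

text \<open>Along the line the loop becomes a real function with equal end values. A value strictly
  between those at times 0 and 1/2 is taken once in each open half of the time interval, against
  injectivity.\<close>

lemma no_simple_loop_in_line:
  fixes g :: "real \<Rightarrow> real^2"
  assumes "simple_path g" "pathfinish g = pathstart g" "path_image g \<subseteq> {x. a \<bullet> x = b}" "a \<noteq> 0"
  shows False
proof -
  \<comment> \<open>The normal turned by a right angle; the inner product with it is injective on
    the line.\<close>
  define v where "v = (vector [- a$2, a$1] :: real^2)"
  define f where "f t = g t \<bullet> v" for t
  have inj: "g s = g t" if "s \<in> {0..1}" "t \<in> {0..1}" "f s = f t" for s t
  proof -
    have "g s \<in> path_image g" "g t \<in> path_image g" using that by (auto simp: path_image_def)
    then have "a \<bullet> (g s - g t) = 0" using assms(3) by (auto simp: inner_diff_right)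
    moreover have "v \<bullet> (g s - g t) = 0" using that by (simp add: f_def inner_diff_right inner_commute)
    ultimately have e: "a$1 * (g s - g t)$1 + a$2 * (g s - g t)$2 = 0"
      "- a$2 * (g s - g t)$1 + a$1 * (g s - g t)$2 = 0"
      by (auto simp: inner_real2 v_def)
    have n: "(a$1)\<^sup>2 + (a$2)\<^sup>2 \<noteq> 0" using assms(4)
      by (auto simp: vec_eq_iff forall_2 sum_power2_eq_zero_iff)
    have "((a$1)\<^sup>2 + (a$2)\<^sup>2) * (g s - g t)$1 = 0" "((a$1)\<^sup>2 + (a$2)\<^sup>2) * (g s - g t)$2 = 0"
      using e by algebra+
    then have "(g s - g t) $ 1 = 0" "(g s - g t) $ 2 = 0" using n by auto
    then show ?thesis by (simp add: vec_eq_iff forall_2)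
  qed
  have cont: "continuous_on {0..1} f" unfolding f_def
    using assms(1) by (auto simp: simple_path_def path_def intro!: continuous_intros)
  have lf: "s = t \<or> (s = 0 \<and> t = 1) \<or> (s = 1 \<and> t = 0)" if "s \<in> {0..1}" "t \<in> {0..1}" "f s = f t" for s t
    using inj[OF that] assms(1) that unfolding simple_path_def loop_free_def by blast
  have f01: "f 0 = f 1" using assms(2) by (simp add: f_def pathfinish_def pathstart_def)
  have "f (1/2) \<noteq> f 0" using lf[of "1/2" 0] by auto
  define c where "c = (f 0 + f (1/2)) / 2"
  have c_ne: "c \<noteq> f 0" "c \<noteq> f (1/2)" using \<open>f (1/2) \<noteq> f 0\<close> by (auto simp: c_def field_simps)
  have "\<exists>s\<in>{0<..<1/2}. f s = c" 
  proof -
    have "\<exists>s. 0 \<le> s \<and> s \<le> 1/2 \<and> f s = c"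
      by (intro IVT_between continuous_on_subset[OF cont]) (auto simp: c_def)
    then obtain s where s: "0 \<le> s" "s \<le> 1/2" "f s = c" by blast
    then have "s \<noteq> 0" "s \<noteq> 1/2" using c_ne by blast+
    with s show ?thesis by auto
  qed
  moreover have "\<exists>s\<in>{1/2<..<1}. f s = c" 
  proof -
    have "\<exists>s. 1/2 \<le> s \<and> s \<le> 1 \<and> f s = c"
      using f01 by (intro IVT_between continuous_on_subset[OF cont]) (auto simp: c_def)
    then obtain s where s: "1/2 \<le> s" "s \<le> 1" "f s = c" by blast
    then have "s \<noteq> 1" "s \<noteq> 1/2" using c_ne f01 by metis+
    with s show ?thesis by (intro bexI[of _ s]) auto
  qed
  ultimately obtain s t where "s \<in> {0<..<1/2}" "t \<in> {1/2<..<1}" "f s = f t" by metis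
  then show False using lf[of s t] by auto
qed

text \<open>A flat convex body is its own frontier and lies in a line, so the predicate under
  \<open>THE\<close> is constantly false. The value is thus the same for all such bodies, whatever
  it is.\<close>

lemma perimeter_empty_interior:
  assumes "convex K" "compact K" "interior K = {}"
  shows "perimeter K = (THE l. False)"
proof -
  obtain a b where ab: "a \<noteq> 0" "K \<subseteq> {x. a \<bullet> x = b}"
    using empty_interior_subset_hyperplane assms by metis
  have "frontier K = K" using assms by (simp add: frontier_def compact_imp_closed)
  then have "\<not> (\<exists>g. simple_path g \<and> pathfinish g = pathstart g \<and> path_image g = frontier K \<and> curve_length g = ennreal l)" for l
    using no_simple_loop_in_line ab by metis
  then have "(\<lambda>l. 0 \<le> l \<and> (\<exists>g. simple_path g \<and> pathfinish g = pathstart g \<and> path_image g = frontier K \<and>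
    curve_length g = ennreal l)) = (\<lambda>l. False)" by blast
  then show ?thesis unfolding perimeter_def by (rule arg_cong)
qed

text \<open>The nearer of two distinct frontier points on the ray would lie on the open segment from
  an interior point to a point of the closure, and so would be interior itself.\<close>

lemma frontier_unique_on_ray:
  fixes K :: "'a::euclidean_space set"
  assumes "convex K" "closed K" "z \<in> interior K" "p \<in> frontier K" "q \<in> frontier K"
    and "p = z + s *\<^sub>R v" "q = z + t *\<^sub>R v" "s > 0" "t > 0"
  shows "p = q"
proof -
  have *: False if "p \<in> frontier K" "q \<in> frontier K" "p = z + s *\<^sub>R v" "q = z + t *\<^sub>R v" "0 < s" "s < t" for p q s t
  proof -
    have "q \<noteq> z" using that(2) assms(3) by (auto simp: frontier_def)
    moreover have "p = (1 - s/t) *\<^sub>R z + (s/t) *\<^sub>R q" using that by (simp add: algebra_simps)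
    ultimately have "p \<in> open_segment z q" using that
      by (auto simp: in_segment intro!: exI[of _ "s/t"])
    moreover have "q \<in> closure K" using that(2) by (auto simp: frontier_def)
    ultimately have "p \<in> interior K"
      using in_interior_closure_convex_segment[OF assms(1,3)] by blast
    then show False using that(1) by (auto simp: frontier_def)
  qed
  show ?thesis using *[of p q s t] *[of q p t s] assms by (cases s t rule: linorder_cases) auto
qed

text \<open>The points \<open>x\<close> and \<open>y\<close> on both sides exclude support lines,
  which may contain a whole edge. The line then passes through an interior point \<open>z\<close>,
  and each of the two rays from \<open>z\<close> carries at most one frontier point.\<close>

lemma card_frontier_line_le_2:
  fixes K :: "(real^2) set"
  assumes "convex K" "compact K" "interior K \<noteq> {}" "u \<noteq> 0"
    and "x \<in> K" "x \<bullet> u < c" "y \<in> K" "c < y \<bullet> u" 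
    and "A \<subseteq> {p \<in> frontier K. p \<bullet> u = c}"
  shows "finite A" "card A \<le> 2"
proof -
  have cl: "closure (interior K) = K"
    using assms convex_closure_interior[of K] by (simp add: compact_imp_closed)
  \<comment> \<open>\<open>K\<close> is the closure of its interior, so an open half-plane that
    meets \<open>K\<close> also meets the interior.\<close>
  have "\<exists>x'\<in>interior K. x' \<bullet> u < c"
  proof -
    have "open {x. x \<bullet> u < c}" by (intro open_Collect_less continuous_intros)
    then show ?thesis using assms(5,6) cl open_Int_closure_eq_empty[of "{x. x \<bullet> u < c}" "interior K"] by blast
  qed
  then obtain x' where x': "x' \<in> interior K" "x' \<bullet> u < c" by blast
  have "\<exists>x'\<in>interior K. c < x' \<bullet> u"
  proof -
    have "open {x. c < x \<bullet> u}" by (intro open_Collect_less continuous_intros)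
    then show ?thesis using assms(7,8) cl open_Int_closure_eq_empty[of "{x. c < x \<bullet> u}" "interior K"] by blast
  qed
  then obtain y' where y': "y' \<in> interior K" "c < y' \<bullet> u" by blast
  define l where "l = (c - x' \<bullet> u) / (y' \<bullet> u - x' \<bullet> u)"
  define z where "z = (1 - l) *\<^sub>R x' + l *\<^sub>R y'"
  have l: "0 \<le> l" "l \<le> 1" using x' y' by (auto simp: l_def field_simps)
  have z: "z \<in> interior K" unfolding z_def
    using convexD_alt[OF convex_interior[OF assms(1)] x'(1) y'(1) l] .
  have "z \<bullet> u = x' \<bullet> u + l * (y' \<bullet> u - x' \<bullet> u)" by (simp add: z_def inner_add_left algebra_simps)
  then have zu: "z \<bullet> u = c" using x' y' by (simp add: l_def)
  define v where "v = (vector [- u$2, u$1] :: real^2)"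
  define N where "N = (u$1)\<^sup>2 + (u$2)\<^sup>2"
  have N: "N > 0" using assms(4)
    by (auto simp: vec_eq_iff forall_2 N_def sum_power2_gt_zero_iff)
  define s where "s p = (p - z) \<bullet> v / N" for p
  have rep: "p = z + s p *\<^sub>R v" if "p \<bullet> u = c" for p
  proof -
    have "(p - z) \<bullet> u = 0" using that zu by (simp add: inner_diff_left)
    then have e: "(p - z)$1 * u$1 + (p - z)$2 * u$2 = 0" by (simp add: inner_real2)
    have "s p * N = (p - z) \<bullet> v" using N by (simp add: s_def)
    then have sN: "s p * N = - (p - z)$1 * u$2 + (p-z)$2 * u$1" by (simp add: inner_real2 v_def algebra_simps)
    have "N * (p - z)$1 = N * (s p * (- u$2))" "N * (p - z)$2 = N * (s p * u$1)"
      using e sN unfolding N_def by algebra+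
    then have "(p - z)$1 = s p * (- u$2)" "(p - z)$2 = s p * u$1"
      using N by (metis less_irrefl mult_left_cancel)+
    then have "p - z = s p *\<^sub>R v" by (simp add: vec_eq_iff forall_2 v_def)
    then show ?thesis by (simp add: algebra_simps)
  qed
  have s0: "s p \<noteq> 0" if "p \<in> A" for p
    using rep[of p] that assms(9) z by (auto simp: frontier_def)
  \<comment> \<open>A point of \<open>A\<close> is determined by the ray on which it lies, that is,
    by one boolean.\<close>
  have inj: "inj_on (\<lambda>p. s p > 0) A"
  proof (rule inj_onI)
    fix p q assume pq: "p \<in> A" "q \<in> A" "(s p > 0) = (s q > 0)"
    have f: "p \<in> frontier K" "q \<in> frontier K" "p = z + s p *\<^sub>R v" "q = z + s q *\<^sub>R v"
      using pq assms(9) rep by auto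
    show "p = q"
    proof (cases "s p > 0")
      case True
      then show ?thesis using frontier_unique_on_ray[OF assms(1) _ z f] pq assms(2) compact_imp_closed by auto
    next
      case False
      then have "- s p > 0" "- s q > 0" using s0 pq by (auto simp: not_less order.order_iff_strict)
      moreover have "p = z + (- s p) *\<^sub>R (- v)" "q = z + (- s q) *\<^sub>R (- v)" using f by auto
      ultimately show ?thesis using frontier_unique_on_ray[OF assms(1) _ z f(1,2)] assms(2) compact_imp_closed by blast
    qed
  qed
  show "finite A" using inj by (rule inj_on_finite[of _ _ UNIV]) auto
  have "card A \<le> card (UNIV :: bool set)" by (rule card_inj_on_le[OF inj]) auto
  then show "card A \<le> 2" by simp
qed

section \<open>Crofton's and Cauchy's formulas\<close>

text \<open>In polar form the integrand is
  \<open>norm v * \<bar>cos (\<theta> - \<alpha>)\<bar>\<close>, and the absolute cosine has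
  integral 4 over a period. This is what recovers a length from projections.\<close>

lemma nn_integral_abs_inner_dir:
  "(\<integral>\<^sup>+\<theta>. ennreal \<bar>v \<bullet> dir \<theta>\<bar> * indicator {0..2*pi} \<theta> \<partial>lborel) = ennreal (4 * norm v)"
proof (cases "v = 0")
  case True then show ?thesis by simp
next
  case False
  define r where "r = norm v"
  have r: "r > 0" "(v$1)\<^sup>2 + (v$2)\<^sup>2 = r\<^sup>2" using False by (simp_all add: r_def) (simp add: norm_real2)
  \<comment> \<open>The sign \<open>e\<close> moves \<open>v\<close> into the right half-plane, so
    that \<open>arcsin\<close> yields its angle; the absolute value forgets the sign.\<close>
  have "\<exists>e. (e = 1 \<or> e = (-1::real)) \<and> e * v$1 \<ge> 0"
    by (cases "v$1 \<ge> 0", rule exI[of _ 1], simp, rule exI[of _ "-1"], simp)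
  then obtain e where e: "e = 1 \<or> e = (-1::real)" "e * v$1 \<ge> 0" by blast
  then have ee: "e * e = 1" by auto
  define \<alpha> where "\<alpha> = arcsin (e * v$2 / r)"
  have "(v$2)\<^sup>2 \<le> r\<^sup>2" using r(2) by (metis le_add_same_cancel2 zero_le_power2)
  then have b: "\<bar>v$2\<bar> \<le> r" using r(1) by (simp add: abs_le_square_iff[symmetric])
  then have b': "-1 \<le> e * v$2 / r" "e * v$2 / r \<le> 1" using e r(1) by (auto simp: field_simps)
  have sa: "sin \<alpha> = e * v$2 / r" unfolding \<alpha>_def using b' by simp
  have ab: "-(pi/2) \<le> \<alpha>" "\<alpha> \<le> pi/2" unfolding \<alpha>_def using arcsin_bounded b' by auto
  have "cos \<alpha> = sqrt (1 - (e * v$2 / r)\<^sup>2)" unfolding \<alpha>_def using b' by (simp add: cos_arcsin)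
  also have "1 - (e * v$2 / r)\<^sup>2 = (e * v$1 / r)\<^sup>2"
    using r ee by (simp add: power_divide power_mult_distrib field_simps power2_eq_square)
      (metis distrib_left mult.assoc mult_1)
  also have "sqrt \<dots> = e * v$1 / r" using e r by simp
  finally have ca: "cos \<alpha> = e * v$1 / r" .
  have v: "\<bar>v \<bullet> dir \<theta>\<bar> = r * \<bar>cos (\<theta> - \<alpha>)\<bar>" for \<theta>
  proof -
    have "v \<bullet> dir \<theta> = (e * e) * (v \<bullet> dir \<theta>)" using ee by simp
    also have "\<dots> = e * r * cos (\<theta> - \<alpha>)"
      using r by (simp add: inner_dir cos_diff sa ca algebra_simps)
    finally show ?thesis using e r by (auto simp: abs_mult)
  qed
  \<comment> \<open>The period is cut at the zeros of the cosine into three intervals of constant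
    sign.\<close>
  have 1: "((\<lambda>\<theta>. \<bar>cos (\<theta> - \<alpha>)\<bar>) has_integral (sin (\<alpha> + pi/2 - \<alpha>) - sin (0 - \<alpha>))) {0..\<alpha> + pi/2}"
  proof (rule has_integral_eq)
    show "((\<lambda>\<theta>. cos (\<theta> - \<alpha>)) has_integral (sin (\<alpha> + pi/2 - \<alpha>) - sin (0 - \<alpha>))) {0..\<alpha> + pi/2}"
      using ab by (intro fundamental_theorem_of_calculus)
        (auto intro!: derivative_eq_intros simp flip: has_real_derivative_iff_has_vector_derivative)
    show "cos (\<theta> - \<alpha>) = \<bar>cos (\<theta> - \<alpha>)\<bar>" if "\<theta> \<in> {0..\<alpha> + pi/2}" for \<theta>
      using cos_ge_zero[of "\<theta> - \<alpha>"] that ab by auto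
  qed
  have 2: "((\<lambda>\<theta>. \<bar>cos (\<theta> - \<alpha>)\<bar>) has_integral (- sin (\<alpha> + 3*pi/2 - \<alpha>) - (- sin (\<alpha> + pi/2 - \<alpha>)))) {\<alpha> + pi/2..\<alpha> + 3*pi/2}"
  proof (rule has_integral_eq)
    show "((\<lambda>\<theta>. - cos (\<theta> - \<alpha>)) has_integral (- sin (\<alpha> + 3*pi/2 - \<alpha>) - (- sin (\<alpha> + pi/2 - \<alpha>)))) {\<alpha> + pi/2..\<alpha> + 3*pi/2}"
      by (intro fundamental_theorem_of_calculus)
        (auto intro!: derivative_eq_intros simp flip: has_real_derivative_iff_has_vector_derivative)
    show "- cos (\<theta> - \<alpha>) = \<bar>cos (\<theta> - \<alpha>)\<bar>" if "\<theta> \<in> {\<alpha> + pi/2..\<alpha> + 3*pi/2}" for \<theta>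
      using cos_ge_zero[of "\<theta> - \<alpha> - pi"] that by (auto simp: cos_diff)
  qed
  have 3: "((\<lambda>\<theta>. \<bar>cos (\<theta> - \<alpha>)\<bar>) has_integral (sin (2*pi - \<alpha>) - sin (\<alpha> + 3*pi/2 - \<alpha>))) {\<alpha> + 3*pi/2..2*pi}"
  proof (rule has_integral_eq)
    show "((\<lambda>\<theta>. cos (\<theta> - \<alpha>)) has_integral (sin (2*pi - \<alpha>) - sin (\<alpha> + 3*pi/2 - \<alpha>))) {\<alpha> + 3*pi/2..2*pi}"
      using ab by (intro fundamental_theorem_of_calculus)
        (auto intro!: derivative_eq_intros simp flip: has_real_derivative_iff_has_vector_derivative)
    show "cos (\<theta> - \<alpha>) = \<bar>cos (\<theta> - \<alpha>)\<bar>" if "\<theta> \<in> {\<alpha> + 3*pi/2..2*pi}" for \<theta>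
    proof -
      have "cos (\<theta> - \<alpha> - 2*pi) = cos (\<theta> - \<alpha>)" by (simp add: cos_diff)
      then show ?thesis using cos_ge_zero[of "\<theta> - \<alpha> - 2*pi"] that ab by auto
    qed
  qed
  have "((\<lambda>\<theta>. \<bar>cos (\<theta> - \<alpha>)\<bar>) has_integral (sin (\<alpha> + pi/2 - \<alpha>) - sin (0 - \<alpha>)) + 
      (- sin (\<alpha> + 3*pi/2 - \<alpha>) - (- sin (\<alpha> + pi/2 - \<alpha>))) + (sin (2*pi - \<alpha>) - sin (\<alpha> + 3*pi/2 - \<alpha>))) {0..2*pi}"
    by (rule has_integral_combine[OF _ _ has_integral_combine[OF _ _ 1 2] 3]) (use ab in auto)
  also have "(sin (\<alpha> + pi/2 - \<alpha>) - sin (0 - \<alpha>)) + 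
      (- sin (\<alpha> + 3*pi/2 - \<alpha>) - (- sin (\<alpha> + pi/2 - \<alpha>))) + (sin (2*pi - \<alpha>) - sin (\<alpha> + 3*pi/2 - \<alpha>)) = 4"
    using sin_3over2_pi by (simp add: sin_diff)
  finally have "((\<lambda>\<theta>. r * \<bar>cos (\<theta> - \<alpha>)\<bar>) has_integral r * 4) {0..2*pi}" by (rule has_integral_mult_right)
  then have "(\<integral>\<^sup>+\<theta>. ennreal (r * \<bar>cos (\<theta> - \<alpha>)\<bar>) * indicator {0..2*pi} \<theta> \<partial>lborel) = ennreal (r * 4)"
    using r by (intro nn_integral_has_integral_lebesgue') auto
  then show ?thesis unfolding v by (simp add: r_def mult.commute)
qed

text \<open>
  The variation of \<open>g t \<bullet> u\<close> is the integral over \<open>c\<close> of the number of crossings of the level \<open>c\<close>,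
  and the line \<open>p \<bullet> u = c\<close> carries at most two frontier points.
\<close>
lemma loop_variation_le:
  fixes g :: "real \<Rightarrow> real^2"
  assumes K: "convex K" "compact K" "interior K \<noteq> {}"
    and g: "simple_path g" "path_image g = frontier K"
    and u: "u \<noteq> 0" and ts: "sorted ts" "set ts \<subseteq> {0..1}"
    and lohi: "\<And>p. p \<in> K \<Longrightarrow> lo \<le> p \<bullet> u" "\<And>p. p \<in> K \<Longrightarrow> p \<bullet> u \<le> hi"
  shows "(\<Sum>i<length ts - 1. \<bar>(g (ts ! Suc i) - g (ts ! i)) \<bullet> u\<bar>) \<le> 2 * (hi - lo)"
proof -
  define n where "n = length ts - 1"
  define f where "f t = g t \<bullet> u" for t
  define a where "a i = min (f (ts ! i)) (f (ts ! Suc i))" for i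
  define b where "b i = max (f (ts ! i)) (f (ts ! Suc i))" for i
  have cont: "continuous_on {0..1} f" unfolding f_def
    using g(1) by (auto simp: simple_path_def path_def intro!: continuous_intros)
  have tn: "ts ! i \<in> {0..1}" "ts ! Suc i \<in> {0..1}" "ts ! i \<le> ts ! Suc i" if "i < n" for i
    using that ts by (auto simp: n_def subset_iff sorted_nth_mono less_diff_conv)
  have gK: "g t \<in> K" "g t \<in> frontier K" if "t \<in> {0..1}" for t
  proof -
    show "g t \<in> frontier K" using that g(2) by (auto simp: path_image_def)
    then show "g t \<in> K" using K(2) compact_imp_closed frontier_subset_closed by blast
  qed
  have fK: "lo \<le> f t" "f t \<le> hi" if "t \<in> {0..1}" for t
    using lohi gK(1)[OF that] by (auto simp: f_def)
  have pt: "(\<Sum>i<n. indicator {a i<..<b i} c) \<le> (2 * indicator {lo..hi} c :: ennreal)" for c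
  proof -
    define J where "J = {i. i < n \<and> c \<in> {a i<..<b i}}"
    have fin: "finite J" by (simp add: J_def)
    have "(\<Sum>i<n. indicator {a i<..<b i} c) = (\<Sum>i\<in>J. (1::ennreal))"
      unfolding J_def by (rule sum.mono_neutral_cong_right) auto
    then have sJ: "(\<Sum>i<n. indicator {a i<..<b i} c) = (of_nat (card J) :: ennreal)" by simp
    show ?thesis
    proof (cases "J = {}")
      case True then show ?thesis using sJ by simp
    next
      case False
      then obtain i0 where i0: "i0 < n" "a i0 < c" "c < b i0" by (auto simp: J_def)
      have "\<exists>x\<in>K. x \<bullet> u < c" "\<exists>y\<in>K. c < y \<bullet> u"
        using i0 gK(1) tn[OF i0(1)] by (auto simp: a_def b_def f_def min_less_iff_disj less_max_iff_disj)
      then obtain x y where xy: "x \<in> K" "x \<bullet> u < c" "y \<in> K" "c < y \<bullet> u" by blast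
      \<comment> \<open>The crossing time is strictly inside its interval because \<open>c\<close>
        differs from both end values. Hence crossing times of different intervals are different and
        avoid 0 and 1, where the loop repeats a point.\<close>
      have "\<exists>t. ts ! i < t \<and> t < ts ! Suc i \<and> f t = c" if "i \<in> J" for i
      proof -
        have i: "i < n" "a i < c" "c < b i" using that by (auto simp: J_def)
        have c': "continuous_on {ts ! i..ts ! Suc i} f"
          using tn[OF i(1)] by (intro continuous_on_subset[OF cont]) auto
        have "\<exists>t. ts ! i \<le> t \<and> t \<le> ts ! Suc i \<and> f t = c"
          using i tn[OF i(1)] c' by (intro IVT_between) (auto simp: a_def b_def)
        then obtain t where t: "ts ! i \<le> t" "t \<le> ts ! Suc i" "f t = c" by blast
        have "t \<noteq> ts ! i" "t \<noteq> ts ! Suc i" using t(3) i by (auto simp: a_def b_def min_def max_def split: if_splits)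
        then show ?thesis using t by (intro exI[of _ t]) auto
      qed
      then obtain \<tau> where \<tau>: "\<And>i. i \<in> J \<Longrightarrow> ts ! i < \<tau> i \<and> \<tau> i < ts ! Suc i \<and> f (\<tau> i) = c" by metis
      have \<tau>mono: "\<tau> i < \<tau> j" if "i \<in> J" "j \<in> J" "i < j" for i j
      proof -
        have "\<tau> i < ts ! Suc i" using \<tau> that by auto
        also have "\<dots> \<le> ts ! j" using that ts by (intro sorted_nth_mono) (auto simp: J_def n_def)
        also have "\<dots> < \<tau> j" using \<tau> that by auto
        finally show ?thesis .
      qed
      have \<tau>01: "\<tau> i \<in> {0<..<1}" if "i \<in> J" for i
        using \<tau>[OF that] tn[of i] that by (auto simp: J_def)
      have inj: "inj_on (\<lambda>i. g (\<tau> i)) J"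
      proof (rule inj_onI)
        fix i j assume ij: "i \<in> J" "j \<in> J" "g (\<tau> i) = g (\<tau> j)"
        then have "\<tau> i = \<tau> j" using g(1) \<tau>01[of i] \<tau>01[of j]
          unfolding simple_path_def loop_free_def by fastforce
        then show "i = j" using \<tau>mono[of i j] \<tau>mono[of j i] ij by (cases i j rule: linorder_cases) auto
      qed
      have A: "(\<lambda>i. g (\<tau> i)) ` J \<subseteq> {p \<in> frontier K. p \<bullet> u = c}"
      proof (clarsimp, intro conjI)
        fix i assume i: "i \<in> J"
        show "g (\<tau> i) \<in> frontier K" using gK(2) \<tau>01[OF i] by auto
        show "g (\<tau> i) \<bullet> u = c" using \<tau>[OF i] by (simp add: f_def)
      qed
      have "card J \<le> 2" using card_frontier_line_le_2(2)[OF K u xy A] card_image[OF inj] by simp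
      then have "(of_nat (card J) :: ennreal) \<le> of_nat 2" by (simp only: of_nat_le_iff)
      moreover have "c \<in> {lo..hi}" using lohi(1)[OF xy(1)] lohi(2)[OF xy(3)] xy by auto
      ultimately show ?thesis using sJ by simp
    qed
  qed
  have ne: "lo \<le> hi" using fK[of 0] by simp
  have "ennreal (\<Sum>i<n. \<bar>(g (ts ! Suc i) - g (ts ! i)) \<bullet> u\<bar>) = (\<Sum>i<n. ennreal \<bar>(g (ts ! Suc i) - g (ts ! i)) \<bullet> u\<bar>)"
    by (simp add: sum_ennreal)
  also have "\<dots> = (\<Sum>i<n. emeasure lborel {a i<..<b i})"
    by (intro sum.cong refl) (auto simp: a_def b_def f_def inner_diff_left abs_real_def min_def max_def)
  also have "\<dots> = (\<integral>\<^sup>+c. (\<Sum>i<n. indicator {a i<..<b i} c) \<partial>lborel)"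
    by (simp add: nn_integral_sum)
  also have "\<dots> \<le> (\<integral>\<^sup>+c. 2 * indicator {lo..hi} c \<partial>lborel)" by (intro nn_integral_mono pt)
  also have "\<dots> = 2 * ennreal (hi - lo)" using ne by (simp add: nn_integral_cmult)
  also have "\<dots> = ennreal (2 * (hi - lo))" using ne by (subst ennreal_mult') auto
  finally show ?thesis using ne unfolding n_def by (subst (asm) ennreal_le_iff) auto
qed

lemma sum_abs_diff_ge:
  fixes f :: "nat \<Rightarrow> real"
  assumes "i \<le> j"
  shows "\<bar>f j - f i\<bar> \<le> (\<Sum>k\<in>{i..<j}. \<bar>f (Suc k) - f k\<bar>)"
  using sum_abs[of "\<lambda>k. f (Suc k) - f k" "{i..<j}"] sum_Suc_diff'[OF assms, of f] by simp

text \<open>A closed sequence travels from its value at \<open>i\<close> to its value at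
  \<open>j\<close> and back again.\<close>

lemma closed_variation_ge:
  fixes f :: "nat \<Rightarrow> real"
  assumes "f 0 = f N" "i \<le> N" "j \<le> N"
  shows "2 * \<bar>f i - f j\<bar> \<le> (\<Sum>k<N. \<bar>f (Suc k) - f k\<bar>)"
proof -
  have *: "2 * \<bar>f i - f j\<bar> \<le> (\<Sum>k<N. \<bar>f (Suc k) - f k\<bar>)" if "i \<le> j" "j \<le> N" for i j
  proof -
    have "{..<N} = {0..<i} \<union> {i..<j} \<union> {j..<N}" using that by auto
    then have "(\<Sum>k<N. \<bar>f (Suc k) - f k\<bar>) = (\<Sum>k\<in>{0..<i} \<union> {i..<j} \<union> {j..<N}. \<bar>f (Suc k) - f k\<bar>)" by simp
    also have "\<dots> = (\<Sum>k\<in>{0..<i}. \<bar>f (Suc k) - f k\<bar>) + (\<Sum>k\<in>{i..<j}. \<bar>f (Suc k) - f k\<bar>) + (\<Sum>k\<in>{j..<N}. \<bar>f (Suc k) - f k\<bar>)"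
      using that by (simp add: sum.union_disjoint ivl_disj_int Int_Un_distrib2)
    finally have "\<bar>f i - f 0\<bar> + \<bar>f j - f i\<bar> + \<bar>f N - f j\<bar> \<le> (\<Sum>k<N. \<bar>f (Suc k) - f k\<bar>)"
      using sum_abs_diff_ge[of 0 i f, OF le0] sum_abs_diff_ge[OF that(1), of f]
        sum_abs_diff_ge[OF that(2), of f] by linarith
    moreover have "2 * \<bar>f i - f j\<bar> \<le> \<bar>f i - f 0\<bar> + \<bar>f j - f i\<bar> + \<bar>f N - f j\<bar>"
      using abs_triangle_ineq[of "f i - f 0" "f N - f j"] unfolding assms(1) by (simp add: abs_minus_commute)
    ultimately show ?thesis by linarith
  qed
  show ?thesis using *[of i j] *[of j i] assms by (cases "i \<le> j") (auto simp: abs_minus_commute)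
qed

lemma max_on_frontier:
  fixes K :: "'a::euclidean_space set"
  assumes "compact K" "K \<noteq> {}" "u \<noteq> 0"
  obtains p where "p \<in> frontier K" "p \<in> K" "\<And>q. q \<in> K \<Longrightarrow> q \<bullet> u \<le> p \<bullet> u"
proof -
  have "continuous_on K (\<lambda>q. q \<bullet> u)" by (intro continuous_intros)
  then obtain p where p: "p \<in> K" "\<And>q. q \<in> K \<Longrightarrow> q \<bullet> u \<le> p \<bullet> u"
    using continuous_attains_sup[OF assms(1,2)] by blast
  have "p \<notin> interior K"
  proof
    assume "p \<in> interior K"
    then obtain e where e: "e > 0" "cball p e \<subseteq> K" by (auto simp: mem_interior_cball)
    have "p + (e / norm u) *\<^sub>R u \<in> cball p e" using e assms(3) by (simp add: dist_norm)
    then have "(p + (e / norm u) *\<^sub>R u) \<bullet> u \<le> p \<bullet> u" using e p by blast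
    moreover have "e / norm u * (u \<bullet> u) > 0" using e assms(3) by simp
    ultimately show False by (simp add: inner_add_left)
  qed
  then have "p \<in> frontier K" using p(1) closure_subset by (auto simp: frontier_def)
  then show thesis using that p by blast
qed

definition width :: "(real^2) set \<Rightarrow> real \<Rightarrow> ennreal" where
  "width K \<theta> = (SUP p\<in>K. SUP q\<in>K. ennreal ((p - q) \<bullet> dir \<theta>))"

definition width_integral :: "(real^2) set \<Rightarrow> ennreal" where
  "width_integral K = (\<integral>\<^sup>+\<theta>. width K \<theta> * indicator {0..2*pi} \<theta> \<partial>lborel)"

text \<open>Inscribed polygons are averaged over directions. In a fixed direction the variation of a
  polygon is at most twice the width, by \<open>loop_variation_le\<close>; conversely, a fine closed
  polygon has vertices close to the extremal points of \<open>K\<close> and varies by almost twice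
  the width.\<close>

theorem crofton_convex_loop:
  fixes g :: "real \<Rightarrow> real^2"
  assumes K: "convex K" "compact K" "interior K \<noteq> {}"
    and g: "simple_path g" "pathfinish g = pathstart g" "path_image g = frontier K"
  shows "2 * curve_length g = width_integral K"
proof -
  have Kne: "K \<noteq> {}" using K(3) interior_subset by fastforce
  have dir0: "dir \<theta> \<noteq> 0" for \<theta> using norm_dir[of \<theta>] by (metis norm_zero zero_neq_one)
  have ex: "\<exists>a b. a \<in> frontier K \<and> b \<in> frontier K \<and> a \<in> K \<and> b \<in> K \<and> (\<forall>p\<in>K. p \<bullet> dir \<theta> \<le> a \<bullet> dir \<theta> \<and> b \<bullet> dir \<theta> \<le> p \<bullet> dir \<theta>)" for \<theta>
  proof -
    obtain a where "a \<in> frontier K" "a \<in> K" "\<And>q. q \<in> K \<Longrightarrow> q \<bullet> dir \<theta> \<le> a \<bullet> dir \<theta>"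
      using max_on_frontier[OF K(2) Kne dir0] by blast
    moreover obtain b where "b \<in> frontier K" "b \<in> K" "\<And>q. q \<in> K \<Longrightarrow> q \<bullet> - dir \<theta> \<le> b \<bullet> - dir \<theta>"
      using max_on_frontier[OF K(2) Kne, of "- dir \<theta>"] dir0 by auto
    ultimately show ?thesis by (intro exI[of _ a] exI[of _ b]) auto
  qed
  then obtain a b where ab: "\<And>\<theta>. a \<theta> \<in> frontier K" "\<And>\<theta>. b \<theta> \<in> frontier K" "\<And>\<theta>. a \<theta> \<in> K" "\<And>\<theta>. b \<theta> \<in> K"
    "\<And>\<theta> p. p \<in> K \<Longrightarrow> p \<bullet> dir \<theta> \<le> a \<theta> \<bullet> dir \<theta>" "\<And>\<theta> p. p \<in> K \<Longrightarrow> b \<theta> \<bullet> dir \<theta> \<le> p \<bullet> dir \<theta>"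
    by metis
  have width: "width K \<theta> = ennreal ((a \<theta> - b \<theta>) \<bullet> dir \<theta>)" for \<theta>
  proof (rule antisym)
    show "width K \<theta> \<le> ennreal ((a \<theta> - b \<theta>) \<bullet> dir \<theta>)" unfolding width_def
      by (intro SUP_least ennreal_leI) (auto simp: inner_diff_left intro!: diff_mono ab)
    show "ennreal ((a \<theta> - b \<theta>) \<bullet> dir \<theta>) \<le> width K \<theta>" unfolding width_def
      using ab by (intro SUP_upper2[of "a \<theta>"] SUP_upper2[of "b \<theta>"]) auto
  qed
  \<comment> \<open>Half the variation integrates to twice the length, because each vector
    contributes 4 times its norm, halved.\<close>
  have sum_eq: "(\<integral>\<^sup>+\<theta>. ennreal ((\<Sum>i<n. \<bar>v i \<bullet> dir \<theta>\<bar>) / 2) * indicator {0..2*pi} \<theta> \<partial>lborel) = 2 * (\<Sum>i<n. ennreal (norm (v i)))" for n and v :: "nat \<Rightarrow> real^2"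
  proof -
    have [measurable]: "(\<lambda>\<theta>. w \<bullet> dir \<theta>) \<in> borel_measurable borel" for w unfolding inner_dir by measurable
    have e: "ennreal ((\<Sum>i<n. \<bar>v i \<bullet> dir \<theta>\<bar>) / 2) = (\<Sum>i<n. ennreal \<bar>(v i /\<^sub>R 2) \<bullet> dir \<theta>\<bar>)" for \<theta>
      by (subst sum_ennreal) (auto simp: sum_divide_distrib abs_mult)
    have "(\<integral>\<^sup>+\<theta>. ennreal ((\<Sum>i<n. \<bar>v i \<bullet> dir \<theta>\<bar>) / 2) * indicator {0..2*pi} \<theta> \<partial>lborel)
      = (\<integral>\<^sup>+\<theta>. (\<Sum>i<n. ennreal \<bar>(v i /\<^sub>R 2) \<bullet> dir \<theta>\<bar> * indicator {0..2*pi} \<theta>) \<partial>lborel)"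
      unfolding e sum_distrib_right ..
    also have "\<dots> = (\<Sum>i<n. ennreal (4 * norm (v i /\<^sub>R 2)))"
      by (subst nn_integral_sum, measurable, simp only: nn_integral_abs_inner_dir)
    also have "\<dots> = 2 * (\<Sum>i<n. ennreal (norm (v i)))"
      unfolding sum_distrib_left by (intro sum.cong refl) (simp add: ennreal_mult')
    finally show ?thesis .
  qed
  show ?thesis
  proof (rule antisym)
    have "2 * (\<Sum>i<length ts - 1. ennreal (dist (g (ts ! i)) (g (ts ! Suc i)))) \<le> width_integral K"
      if "sorted ts" "set ts \<subseteq> {0..1}" for ts
    proof -
      have "2 * (\<Sum>i<length ts - 1. ennreal (dist (g (ts ! i)) (g (ts ! Suc i)))) =
        (\<integral>\<^sup>+\<theta>. ennreal ((\<Sum>i<length ts - 1. \<bar>(g (ts ! Suc i) - g (ts ! i)) \<bullet> dir \<theta>\<bar>) / 2) * indicator {0..2*pi} \<theta> \<partial>lborel)"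
        unfolding sum_eq by (simp add: dist_norm norm_minus_commute)
      also have "\<dots> \<le> width_integral K" unfolding width_integral_def
      proof (intro nn_integral_mono mult_right_mono)
        fix \<theta>
        have "(\<Sum>i<length ts - 1. \<bar>(g (ts ! Suc i) - g (ts ! i)) \<bullet> dir \<theta>\<bar>) \<le> 2 * (a \<theta> \<bullet> dir \<theta> - b \<theta> \<bullet> dir \<theta>)"
          using ab by (intro loop_variation_le[OF K g(1,3) dir0 that]) auto
        then show "ennreal ((\<Sum>i<length ts - 1. \<bar>(g (ts ! Suc i) - g (ts ! i)) \<bullet> dir \<theta>\<bar>) / 2) \<le> width K \<theta>"
          unfolding width by (intro ennreal_leI) (simp add: inner_diff_left)
      qed auto
      finally show ?thesis .
    qed
    then show "2 * curve_length g \<le> width_integral K"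
      unfolding curve_length_def SUP_mult_left_ennreal by (intro SUP_least) auto
  next
    \<comment> \<open>Moving both extremal points to vertices at distance below \<open>e\<close>
      costs \<open>2 * e\<close> in width, hence \<open>2 * e * (2 * pi)\<close> after integration
      over the directions.\<close>
    have le: "width_integral K \<le> 2 * curve_length g + ennreal (4 * e * pi)" if e: "e > 0" for e
    proof -
      have "uniformly_continuous_on {0..1} g"
        using g(1) by (intro compact_uniformly_continuous) (auto simp: simple_path_def path_def)
      then obtain d where d: "d > 0" "\<And>s t. s \<in> {0..1} \<Longrightarrow> t \<in> {0..1} \<Longrightarrow> dist s t < d \<Longrightarrow> dist (g s) (g t) < e"
        using e unfolding uniformly_continuous_on_def by metis
      obtain N :: nat where N: "N > 0" "1 / real N < d"
        using d(1) reals_Archimedean by (metis inverse_eq_divide of_nat_0_less_iff zero_less_Suc)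
      \<comment> \<open>Both 0 and 1 occur in the list, so the inscribed polygon is closed.\<close>
      define ts where "ts = map (\<lambda>i. real i / N) [0..<Suc N]"
      have ts: "sorted ts" "set ts \<subseteq> {0..1}" unfolding ts_def sorted_map using N
        by (auto intro!: sorted_wrt_mono_rel[OF _ sorted_wrt_upt] simp: divide_right_mono simp del: upt_Suc)
      have len: "length ts = Suc N" "length ts - 1 = N" by (auto simp: ts_def)
      have nth: "ts ! i = real i / N" if "i \<le> N" for i 
        using that by (simp add: ts_def del: upt_Suc)
      have near: "\<exists>i\<le>N. norm (p - g (ts ! i)) < e" if "p \<in> frontier K" for p
      proof -
        have "p \<in> g ` {0..1}" using that g(3) by (simp only: path_image_def)
        then obtain t where t: "p = g t" "t \<in> {0..1}" by (rule imageE)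
        define i where "i = nat \<lfloor>t * N\<rfloor>"
        have i1: "real i \<le> t * N" "t * N < real i + 1" using t by (auto simp: i_def)
        have "t * N \<le> N" using t by (simp add: mult_left_le_one_le)
        then have iN: "i \<le> N" using i1 by linarith
        have "real i / N \<le> t" "t < real i / N + 1 / N" using i1 N by (auto simp: field_simps)
        then have "dist t (ts ! i) < d" using nth[OF iN] N by (auto simp: dist_real_def)
        moreover have "ts ! i \<in> {0..1}" using nth[OF iN] iN N by auto
        ultimately show ?thesis using d(2) t iN by (auto simp: dist_norm)
      qed
      have "width_integral K \<le>
        (\<integral>\<^sup>+\<theta>. ennreal ((\<Sum>i<N. \<bar>(g (ts ! Suc i) - g (ts ! i)) \<bullet> dir \<theta>\<bar>) / 2) * indicator {0..2*pi} \<theta> + ennreal (2 * e) * indicator {0..2*pi} \<theta> \<partial>lborel)" unfolding width_integral_def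
      proof (intro nn_integral_mono)
        fix \<theta>
        define f where "f i = g (ts ! i) \<bullet> dir \<theta>" for i
        have f0N: "f 0 = f N" using g(2) N by (simp add: f_def nth pathfinish_def pathstart_def)
        obtain i j where i: "i \<le> N" "norm (a \<theta> - g (ts ! i)) < e" and j: "j \<le> N" "norm (b \<theta> - g (ts ! j)) < e"
          using near ab(1,2) by metis
        have "\<bar>(a \<theta> - g (ts ! i)) \<bullet> dir \<theta>\<bar> \<le> e" "\<bar>(b \<theta> - g (ts ! j)) \<bullet> dir \<theta>\<bar> \<le> e"
          using Cauchy_Schwarz_ineq2[of "a \<theta> - g (ts ! i)" "dir \<theta>"] Cauchy_Schwarz_ineq2[of "b \<theta> - g (ts ! j)" "dir \<theta>"] i j by auto
        then have "(a \<theta> - b \<theta>) \<bullet> dir \<theta> \<le> \<bar>f i - f j\<bar> + 2 * e"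
          by (simp add: f_def inner_diff_left)
        also have "\<dots> \<le> (\<Sum>k<N. \<bar>f (Suc k) - f k\<bar>) / 2 + 2 * e"
          using closed_variation_ge[of f N i j] f0N i j by simp
        finally have "width K \<theta> \<le> ennreal ((\<Sum>k<N. \<bar>f (Suc k) - f k\<bar>) / 2 + 2 * e)"
          unfolding width by (intro ennreal_leI)
        also have "\<dots> = ennreal ((\<Sum>k<N. \<bar>f (Suc k) - f k\<bar>) / 2) + ennreal (2 * e)"
          using e by (intro ennreal_plus) (auto intro: sum_nonneg)
        finally show "width K \<theta> * indicator {0..2*pi} \<theta> \<le> ennreal ((\<Sum>i<N. \<bar>(g (ts ! Suc i) - g (ts ! i)) \<bullet> dir \<theta>\<bar>) / 2) * indicator {0..2*pi} \<theta> + ennreal (2 * e) * indicator {0..2*pi} \<theta>"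
          by (auto simp: f_def inner_diff_left indicator_def)
      qed
      also have "\<dots> = 2 * (\<Sum>i<N. ennreal (norm (g (ts ! Suc i) - g (ts ! i)))) + ennreal (2 * e) * ennreal (2 * pi)"
      proof -
        have [measurable]: "(\<lambda>\<theta>. w \<bullet> dir \<theta>) \<in> borel_measurable borel" for w unfolding inner_dir by measurable
        show ?thesis
          by (subst nn_integral_add) (auto simp: sum_eq nn_integral_cmult)
      qed
      also have "ennreal (2 * e) * ennreal (2 * pi) = ennreal (4 * e * pi)" using e by (simp add: ennreal_mult[symmetric])
      also have "2 * (\<Sum>i<N. ennreal (norm (g (ts ! Suc i) - g (ts ! i)))) \<le> 2 * curve_length g"
        unfolding curve_length_def using ts len
        by (intro mult_left_mono SUP_upper2[of ts]) (auto simp: dist_norm norm_minus_commute)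
      finally show ?thesis by (simp add: add_mono)
    qed
    show "width_integral K \<le> 2 * curve_length g"
    proof (rule ennreal_le_epsilon)
      fix e :: real assume "e > 0"
      then show "width_integral K \<le> 2 * curve_length g + ennreal e"
        using le[of "e / (4 * pi)"] by simp
    qed
  qed
qed

text \<open>By Crofton's identity all parametrizations of the frontier have the same length, so
  \<open>THE\<close> denotes it. The width is at most the diameter, which keeps the integral finite
  and lets \<open>enn2real\<close> lose nothing.\<close>

theorem cauchy_perimeter:
  assumes K: "convex K" "compact K" "interior K \<noteq> {}"
  shows "perimeter K = enn2real (width_integral K) / 2"
proof -
  have "width_integral K \<le> (\<integral>\<^sup>+\<theta>. ennreal (diameter K) * indicator {0..2*pi} \<theta> \<partial>lborel)"
    unfolding width_integral_def width_def
  proof (intro nn_integral_mono mult_right_mono SUP_least ennreal_leI)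
    fix \<theta> p q assume pq: "p \<in> K" "q \<in> K"
    have "(p - q) \<bullet> dir \<theta> \<le> norm (p - q) * norm (dir \<theta>)" by (rule norm_cauchy_schwarz)
    also have "\<dots> \<le> diameter K" using diameter_bounded_bound[OF compact_imp_bounded[OF K(2)] pq]
      by (simp add: dist_norm)
    finally show "(p - q) \<bullet> dir \<theta> \<le> diameter K" .
  qed auto
  also have "\<dots> < \<infinity>" by (simp add: nn_integral_cmult ennreal_mult_less_top)
  finally obtain w where w: "width_integral K = ennreal w" "w \<ge> 0" by (cases "width_integral K") auto
  have len: "curve_length g = ennreal (w / 2)"
    if "simple_path g" "pathfinish g = pathstart g" "path_image g = frontier K" for g
  proof -
    have "2 * curve_length g = 2 * ennreal (w / 2)"
      using crofton_convex_loop[OF K that] w by (simp add: ennreal_mult'[symmetric] flip: ennreal_numeral)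
    then show ?thesis by (simp add: ennreal_mult_cancel_left)
  qed
  obtain g where g: "simple_path g" "pathfinish g = pathstart g" "path_image g = frontier K"
    using simple_loop_frontier_convex[OF K] .
  have "perimeter K = w / 2" unfolding perimeter_def
  proof (rule the_equality)
    show "0 \<le> w / 2 \<and> (\<exists>g. simple_path g \<and> pathfinish g = pathstart g \<and> path_image g = frontier K \<and> curve_length g = ennreal (w / 2))"
      using g len w by auto
  next
    fix l assume "0 \<le> l \<and> (\<exists>g. simple_path g \<and> pathfinish g = pathstart g \<and> path_image g = frontier K \<and> curve_length g = ennreal l)"
    then show "l = w / 2" using len w by force
  qed
  then show ?thesis using w by simp
qed

section \<open>Gaussian walks killed above a level\<close>

abbreviation gauss :: "real \<Rightarrow> real \<Rightarrow> real" where
  "gauss \<equiv> normal_density 0"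

text \<open>One step of a Gaussian walk with step deviation \<open>\<sigma>\<close>, killed above the level \<open>b\<close>.\<close>
definition killed_step :: "real \<Rightarrow> real \<Rightarrow> (real \<Rightarrow> ennreal) \<Rightarrow> real \<Rightarrow> ennreal" where
  "killed_step \<sigma> b f z = (\<integral>\<^sup>+y. ennreal (gauss \<sigma> (y - z)) * (indicator {..b} y * f y) \<partial>lborel)"

abbreviation killed_motion :: "real \<Rightarrow> real \<Rightarrow> nat \<Rightarrow> ennreal" where
  "killed_motion \<sigma> b k \<equiv> (killed_step \<sigma> b ^^ k) (\<lambda>_. 1) 0"

text \<open>The terminal weight is the density of one further step back to 0, so there are
  \<open>k + 1\<close> steps in all. The result is not normalized: the density of the free walk at 0
  still has to be divided out.\<close>

abbreviation killed_bridge :: "real \<Rightarrow> real \<Rightarrow> nat \<Rightarrow> ennreal" where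
  "killed_bridge \<sigma> b k \<equiv> (killed_step \<sigma> b ^^ k) (\<lambda>z. ennreal (gauss \<sigma> z)) 0"

lemma borel_measurable_killed_step [measurable]:
  assumes [measurable]: "f \<in> borel_measurable borel"
  shows "killed_step \<sigma> b f \<in> borel_measurable borel"
  unfolding killed_step_def by measurable

lemma normal_density_shift: "gauss \<sigma> (y - z) = normal_density z \<sigma> y"
  by (simp add: normal_density_def)

lemma integrable_normal_density_bounded:
  fixes u :: "real \<Rightarrow> real"
  assumes "\<sigma> > 0" "u \<in> borel_measurable borel" "\<And>y. \<bar>u y\<bar> \<le> C"
  shows "integrable lborel (\<lambda>y. gauss \<sigma> (y - z) * u y)"
proof (rule Bochner_Integration.integrable_bound)
  show "integrable lborel (\<lambda>y. normal_density z \<sigma> y * C)" using assms(1) by simp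
  show "(\<lambda>y. gauss \<sigma> (y - z) * u y) \<in> borel_measurable lborel" using assms(2) by measurable
  have "\<bar>gauss \<sigma> (y - z) * u y\<bar> \<le> \<bar>normal_density z \<sigma> y * C\<bar>" for y
    using assms(3)[of y] by (simp add: normal_density_shift abs_mult mult_left_mono)
  then show "AE y in lborel. norm (gauss \<sigma> (y - z) * u y) \<le> norm (normal_density z \<sigma> y * C)" by simp
qed

text \<open>A free step integrates \<open>u k\<close> over the whole line, a killed step only up to
  \<open>b\<close>. The omitted part is nonpositive, so subsolutions stay below the killed iterates
  by induction.\<close>

lemma killed_step_lower:
  fixes u :: "nat \<Rightarrow> real \<Rightarrow> real"
  assumes \<sigma>: "\<sigma> > 0" 
    and meas: "\<And>k. u k \<in> borel_measurable borel" "f \<in> borel_measurable borel"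
    and bdd: "\<And>k y. \<bar>u k y\<bar> \<le> C"
    and heat: "\<And>k z. u (Suc k) z = (\<integral>y. gauss \<sigma> (y - z) * u k y \<partial>lborel)"
    and sgn: "\<And>k y. y \<le> b \<Longrightarrow> 0 \<le> u k y" "\<And>k y. b \<le> y \<Longrightarrow> u k y \<le> 0"
    and init: "\<And>z. z \<le> b \<Longrightarrow> ennreal (u 0 z) \<le> f z"
  shows "z \<le> b \<Longrightarrow> ennreal (u k z) \<le> (killed_step \<sigma> b ^^ k) f z"
proof (induction k arbitrary: z)
  case 0 then show ?case using init by simp
next
  case (Suc k)
  have int: "integrable lborel (\<lambda>y. gauss \<sigma> (y - z) * u k y)"
    by (rule integrable_normal_density_bounded[OF \<sigma> meas(1) bdd])
  have int': "integrable lborel (\<lambda>y. gauss \<sigma> (y - z) * (indicator {..b} y * u k y))"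
    using bdd by (intro integrable_normal_density_bounded[OF \<sigma>, of _ "max C 0"] borel_measurable_times meas)
      (auto simp: indicator_def le_max_iff_disj)
  have "u (Suc k) z \<le> (\<integral>y. gauss \<sigma> (y - z) * (indicator {..b} y * u k y) \<partial>lborel)"
    unfolding heat using sgn
    by (intro integral_mono[OF int int'] mult_left_mono) (auto simp: indicator_def)
  then have "ennreal (u (Suc k) z) \<le> ennreal (\<integral>y. gauss \<sigma> (y - z) * (indicator {..b} y * u k y) \<partial>lborel)"
    by (rule ennreal_leI)
  also have "\<dots> = (\<integral>\<^sup>+y. ennreal (gauss \<sigma> (y - z) * (indicator {..b} y * u k y)) \<partial>lborel)"
    using sgn by (intro nn_integral_eq_integral[symmetric] int') (auto simp: indicator_def)
  also have "\<dots> \<le> (\<integral>\<^sup>+y. ennreal (gauss \<sigma> (y - z)) * (indicator {..b} y * (killed_step \<sigma> b ^^ k) f y) \<partial>lborel)"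
    using Suc.IH by (intro nn_integral_mono) (auto simp: ennreal_mult' indicator_def intro!: mult_left_mono)
  finally show ?case by (simp add: killed_step_def[of _ _ "(killed_step \<sigma> b ^^ k) f"])
qed

text \<open>With \<open>w = y - z - \<epsilon>\<close> the exponent splits as \<open>(y - z)\<^sup>2
  = \<epsilon>\<^sup>2 + 2 * \<epsilon> * w + w\<^sup>2\<close>, and the cross term is nonnegative.
  Bounding by a shifted density, which has mass 1, makes the tail integral immediate.\<close>

lemma normal_density_tail_le:
  assumes "\<sigma> > 0" "\<epsilon> \<ge> 0" "z + \<epsilon> \<le> y"
  shows "gauss \<sigma> (y - z) \<le> exp (- \<epsilon>\<^sup>2 / (2 * \<sigma>\<^sup>2)) * normal_density (z + \<epsilon>) \<sigma> y"
proof -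
  have "- (y - z)\<^sup>2 \<le> - \<epsilon>\<^sup>2 - (y - (z + \<epsilon>))\<^sup>2"
  proof -
    have "0 \<le> 2 * \<epsilon> * (y - z - \<epsilon>)" using assms by simp
    then show ?thesis by (simp add: power2_eq_square algebra_simps)
  qed
  then have "- (y - z)\<^sup>2 / (2 * \<sigma>\<^sup>2) \<le> (- \<epsilon>\<^sup>2 - (y - (z + \<epsilon>))\<^sup>2) / (2 * \<sigma>\<^sup>2)"
    using assms(1) by (intro divide_right_mono) auto
  then have "exp (- (y - z)\<^sup>2 / (2 * \<sigma>\<^sup>2)) \<le> exp (- \<epsilon>\<^sup>2 / (2 * \<sigma>\<^sup>2)) * exp (- (y - (z + \<epsilon>))\<^sup>2 / (2 * \<sigma>\<^sup>2))"
    by (simp add: exp_add[symmetric] diff_divide_distrib)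
  then show ?thesis using assms(1) by (simp add: normal_density_def divide_right_mono)
qed

text \<open>
  Here \<open>u\<close> vanishes on the level \<open>b + \<epsilon>\<close> instead of \<open>b\<close>; each step of the walk that jumps over
  \<open>(b, b + \<epsilon>)\<close> costs the Gaussian tail \<open>exp (- \<epsilon>\<^sup>2 / (2 \<sigma>\<^sup>2))\<close>.
\<close>
lemma killed_step_upper:
  fixes u :: "nat \<Rightarrow> real \<Rightarrow> real"
  assumes \<sigma>: "\<sigma> > 0" and \<epsilon>: "\<epsilon> > 0" and C: "C \<ge> 0"
    and meas: "\<And>k. u k \<in> borel_measurable borel" "f \<in> borel_measurable borel"
    and bdd: "\<And>k y. \<bar>u k y\<bar> \<le> C"
    and heat: "\<And>k z. u (Suc k) z = (\<integral>y. gauss \<sigma> (y - z) * u k y \<partial>lborel)"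
    and sgn: "\<And>k y. y \<le> b + \<epsilon> \<Longrightarrow> 0 \<le> u k y" 
    and init: "\<And>z. z \<le> b \<Longrightarrow> f z \<le> ennreal (u 0 z + C * exp (- \<epsilon>\<^sup>2 / (2 * \<sigma>\<^sup>2)))"
  shows "z \<le> b \<Longrightarrow> (killed_step \<sigma> b ^^ k) f z \<le> ennreal (u k z + Suc k * (C * exp (- \<epsilon>\<^sup>2 / (2 * \<sigma>\<^sup>2))))"
proof (induction k arbitrary: z)
  case 0 then show ?case using init by simp
next
  case (Suc k)
  define D where "D = C * exp (- \<epsilon>\<^sup>2 / (2 * \<sigma>\<^sup>2))"
  have D: "D \<ge> 0" using C by (simp add: D_def)
  define e where "e = Suc k * D"
  have e: "e \<ge> 0" using D by (simp add: e_def)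
  let ?p = "\<lambda>y. gauss \<sigma> (y - z)"
  have int: "integrable lborel (\<lambda>y. ?p y * u k y)"
    by (rule integrable_normal_density_bounded[OF \<sigma> meas(1) bdd])
  have int': "integrable lborel (\<lambda>y. ?p y * (indicator {..b} y * (u k y + e)))"
  proof (rule integrable_normal_density_bounded[OF \<sigma>, of _ "C + e"])
    show "\<bar>indicator {..b} y * (u k y + e)\<bar> \<le> C + e" for y
      using bdd[of k y] C e by (auto simp: indicator_def abs_le_iff)
  qed (use meas in measurable)
  have ip: "integrable lborel (\<lambda>y. ?p y * e)" 
    by (rule integrable_normal_density_bounded[OF \<sigma>, of _ e]) (use e in auto)
  have iq: "integrable lborel (\<lambda>y. D * normal_density (z + \<epsilon>) \<sigma> y)" using \<sigma> by simp
  have "(killed_step \<sigma> b ^^ Suc k) f z = (\<integral>\<^sup>+y. ennreal (?p y) * (indicator {..b} y * (killed_step \<sigma> b ^^ k) f y) \<partial>lborel)"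
    by (simp add: killed_step_def[of _ _ "(killed_step \<sigma> b ^^ k) f"])
  also have "\<dots> \<le> (\<integral>\<^sup>+y. ennreal (?p y * (indicator {..b} y * (u k y + e))) \<partial>lborel)"
    using Suc.IH unfolding e_def D_def
    by (intro nn_integral_mono) (auto simp: ennreal_mult' indicator_def intro!: mult_left_mono)
  also have "\<dots> = ennreal (\<integral>y. ?p y * (indicator {..b} y * (u k y + e)) \<partial>lborel)"
    using sgn e \<epsilon> by (intro nn_integral_eq_integral int') (auto simp: indicator_def)
  also have "\<dots> \<le> ennreal (\<integral>y. ?p y * u k y + ?p y * e + D * normal_density (z + \<epsilon>) \<sigma> y \<partial>lborel)"
  proof (intro ennreal_leI integral_mono int' Bochner_Integration.integrable_add int ip iq)
    fix y
    \<comment> \<open>Below \<open>b\<close> both sides agree up to a nonnegative term. In the gap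
      the left side is 0 and \<open>u\<close> is still nonnegative. Beyond the gap \<open>u\<close>
      may fall to \<open>- C\<close>, which the third summand outweighs by the tail bound, as
      \<open>z\<close> is at most \<open>b\<close>.\<close>
    consider "y \<le> b" | "b < y" "y \<le> b + \<epsilon>" | "b + \<epsilon> < y" by linarith
    then show "?p y * (indicator {..b} y * (u k y + e)) \<le> ?p y * u k y + ?p y * e + D * normal_density (z + \<epsilon>) \<sigma> y"
    proof cases
      case 1 then show ?thesis using D by (simp add: algebra_simps)
    next
      case 2 then show ?thesis using sgn[of y k] D e by (simp add: indicator_def)
    next
      case 3
      have "?p y \<le> exp (- \<epsilon>\<^sup>2 / (2 * \<sigma>\<^sup>2)) * normal_density (z + \<epsilon>) \<sigma> y"
        using 3 Suc.prems \<epsilon> by (intro normal_density_tail_le[OF \<sigma>]) auto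
      then have "C * ?p y \<le> D * normal_density (z + \<epsilon>) \<sigma> y" using C by (simp add: D_def mult_left_mono mult.assoc)
      moreover have "- C \<le> u k y" using bdd[of k y] by (simp add: abs_le_iff)
      then have "?p y * (- C) \<le> ?p y * u k y" by (intro mult_left_mono) auto
      moreover have "0 \<le> ?p y * e" using e by simp
      ultimately show ?thesis using 3 \<epsilon> by (simp add: indicator_def mult.commute)
    qed
  qed
  also have "(\<integral>y. ?p y * u k y + ?p y * e + D * normal_density (z + \<epsilon>) \<sigma> y \<partial>lborel) = u (Suc k) z + e + D"
    using \<sigma> int ip iq by (simp add: heat normal_density_shift)
  also have "\<dots> = u (Suc k) z + Suc (Suc k) * (C * exp (- \<epsilon>\<^sup>2 / (2 * \<sigma>\<^sup>2)))"
    by (simp add: e_def D_def algebra_simps)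
  finally show ?case .
qed

section \<open>Heat flows antisymmetric about a level\<close>

lemma nn_integral_normal_density_semigroup:
  assumes "\<sigma> > 0" "\<tau> > 0"
  shows "(\<integral>\<^sup>+y. ennreal (gauss \<sigma> (y - z)) * ennreal (gauss \<tau> (r - y)) \<partial>lborel) =
    ennreal (gauss (sqrt (\<sigma>\<^sup>2 + \<tau>\<^sup>2)) (r - z))"
proof -
  have "(\<integral>\<^sup>+y. ennreal (gauss \<sigma> (y - z)) * ennreal (gauss \<tau> (r - y)) \<partial>lborel) =
    (\<integral>\<^sup>+w. ennreal (gauss \<sigma> ((r - z) - w) * gauss \<tau> w) \<partial>lborel)"
    by (subst nn_integral_real_affine[of _ "-1" r]) (auto simp: ennreal_mult' algebra_simps)
  then show ?thesis using fun_cong[OF conv_normal_density_zero_mean[OF assms], of "r - z"] by simp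
qed

lemma integral_normal_density_semigroup:
  assumes "\<sigma> > 0" "\<tau> > 0"
  shows "(\<integral>y. gauss \<sigma> (y - z) * gauss \<tau> (r - y) \<partial>lborel) =
    gauss (sqrt (\<sigma>\<^sup>2 + \<tau>\<^sup>2)) (r - z)"
  using nn_integral_normal_density_semigroup[OF assms, of z r]
  by (subst integral_eq_nn_integral) (auto simp: ennreal_mult')

lemma normal_density_le:
  assumes "\<sigma> > 0"
  shows "gauss \<sigma> x \<le> exp (- x\<^sup>2 / (2 * \<sigma>\<^sup>2)) / \<sigma>"
proof -
  have "\<sigma> \<le> sqrt (2 * pi) * \<sigma>" using assms pi_gt3 by simp
  moreover have "sqrt (2 * pi * \<sigma>\<^sup>2) = sqrt (2 * pi) * \<sigma>" using assms by (simp add: real_sqrt_mult)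
  ultimately show ?thesis unfolding normal_density_def using assms
    by (simp add: frac_le)
qed

lemma normal_density_mono_abs:
  assumes "\<sigma> > 0" "\<bar>x\<bar> \<le> \<bar>y\<bar>"
  shows "gauss \<sigma> y \<le> gauss \<sigma> x"
proof -
  have "x\<^sup>2 \<le> y\<^sup>2" using assms(2) by (simp add: abs_le_square_iff)
  then show ?thesis using assms(1) unfolding normal_density_def
    by (intro mult_left_mono) (auto simp: divide_right_mono)
qed

text \<open>The index \<open>k\<close> stands for \<open>k + 1\<close> steps, which avoids the
  degenerate variance 0 of an empty walk. Later \<open>N\<close> steps of variance
  \<open>1 / N\<close> therefore appear with index \<open>N - 1\<close>.\<close>

definition walk_density :: "real \<Rightarrow> nat \<Rightarrow> real \<Rightarrow> real" where
  "walk_density \<sigma> k = gauss (\<sigma> * sqrt (Suc k))"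

lemma walk_density_0 [simp]: "walk_density \<sigma> 0 = gauss \<sigma>"
  by (simp add: walk_density_def)

lemma walk_density_nonneg [simp]: "0 \<le> walk_density \<sigma> k x"
  by (simp add: walk_density_def)

lemma walk_density_uminus: "walk_density \<sigma> k (- x) = walk_density \<sigma> k x"
  by (simp add: walk_density_def normal_density_def)

lemma borel_measurable_walk_density [measurable]: "walk_density \<sigma> k \<in> borel_measurable borel"
  by (simp add: walk_density_def)

lemma walk_density_heat:
  assumes "\<sigma> > 0"
  shows "(\<integral>y. gauss \<sigma> (y - z) * walk_density \<sigma> k (r - y) \<partial>lborel) = walk_density \<sigma> (Suc k) (r - z)"
    and "(\<integral>\<^sup>+y. ennreal (gauss \<sigma> (y - z)) * ennreal (walk_density \<sigma> k (r - y)) \<partial>lborel) = ennreal (walk_density \<sigma> (Suc k) (r - z))"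
proof -
  have "sqrt (\<sigma>\<^sup>2 + (\<sigma> * sqrt (Suc k))\<^sup>2) = sqrt (\<sigma>\<^sup>2 * Suc (Suc k))"
    by (simp add: power_mult_distrib algebra_simps)
  also have "\<dots> = \<sigma> * sqrt (Suc (Suc k))" using assms by (simp only: real_sqrt_mult real_sqrt_abs abs_of_pos)
  finally have *: "sqrt (\<sigma>\<^sup>2 + (\<sigma> * sqrt (Suc k))\<^sup>2) = \<sigma> * sqrt (Suc (Suc k))" .
  have "0 < \<sigma> * sqrt (Suc k)" using assms by simp
  note ** = integral_normal_density_semigroup[OF assms this, of z r] nn_integral_normal_density_semigroup[OF assms this, of z r]
  show "(\<integral>y. gauss \<sigma> (y - z) * walk_density \<sigma> k (r - y) \<partial>lborel) = walk_density \<sigma> (Suc k) (r - z)"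
    unfolding walk_density_def using **(1) unfolding * .
  show "(\<integral>\<^sup>+y. ennreal (gauss \<sigma> (y - z)) * ennreal (walk_density \<sigma> k (r - y)) \<partial>lborel) = ennreal (walk_density \<sigma> (Suc k) (r - z))"
    unfolding walk_density_def using **(2) unfolding * .
qed

lemma walk_density_le:
  assumes "\<sigma> > 0" shows "walk_density \<sigma> k x \<le> 1 / \<sigma>"
proof -
  have "\<sigma> \<le> \<sigma> * sqrt (Suc k)" using assms by simp
  moreover have "walk_density \<sigma> k x \<le> exp (- x\<^sup>2 / (2 * (\<sigma> * sqrt (Suc k))\<^sup>2)) / (\<sigma> * sqrt (Suc k))"
    unfolding walk_density_def using assms by (intro normal_density_le) simp
  moreover have "exp (- x\<^sup>2 / (2 * (\<sigma> * sqrt (Suc k))\<^sup>2)) / (\<sigma> * sqrt (Suc k)) \<le> 1 / \<sigma>"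
    using assms by (intro frac_le) auto
  ultimately show ?thesis by linarith
qed

lemma integrable_normal_density_walk_density:
  assumes "\<sigma> > 0"
  shows "integrable lborel (\<lambda>y. gauss \<sigma> (y - z) * walk_density \<sigma> k (r - y))"
  using walk_density_le[OF assms]
  by (intro integrable_normal_density_bounded[OF assms, of _ "1/\<sigma>"]) auto

text \<open>Method of images: subtracting the mirror image in \<open>c\<close> makes the heat kernel antisymmetric about \<open>c\<close>.\<close>
definition bridge_flow :: "real \<Rightarrow> real \<Rightarrow> nat \<Rightarrow> real \<Rightarrow> real" where
  "bridge_flow \<sigma> c k z = walk_density \<sigma> k z - walk_density \<sigma> k (2 * c - z)"

lemma bridge_flow_heat:
  assumes "\<sigma> > 0"
  shows "bridge_flow \<sigma> c (Suc k) z = (\<integral>y. gauss \<sigma> (y - z) * bridge_flow \<sigma> c k y \<partial>lborel)"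
proof -
  have "(\<integral>y. gauss \<sigma> (y - z) * bridge_flow \<sigma> c k y \<partial>lborel) =
    (\<integral>y. gauss \<sigma> (y - z) * walk_density \<sigma> k (0 - y) - gauss \<sigma> (y - z) * walk_density \<sigma> k (2 * c - y) \<partial>lborel)"
    by (intro Bochner_Integration.integral_cong) (auto simp: bridge_flow_def walk_density_uminus algebra_simps)
  also have "\<dots> = walk_density \<sigma> (Suc k) (0 - z) - walk_density \<sigma> (Suc k) (2 * c - z)"
    by (simp only: Bochner_Integration.integral_diff[OF integrable_normal_density_walk_density integrable_normal_density_walk_density, OF assms assms] walk_density_heat[OF assms])
  finally show ?thesis by (simp add: bridge_flow_def walk_density_uminus)
qed

lemma bridge_flow_bound: "\<sigma> > 0 \<Longrightarrow> \<bar>bridge_flow \<sigma> c k y\<bar> \<le> 1 / \<sigma>"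
  using walk_density_le[of \<sigma> k y] walk_density_le[of \<sigma> k "2*c-y"] walk_density_nonneg[of \<sigma> k y] walk_density_nonneg[of \<sigma> k "2*c-y"]
  unfolding bridge_flow_def by (auto simp del: walk_density_nonneg)

text \<open>Since \<open>c\<close> is nonnegative, of \<open>y\<close> and its mirror image
  \<open>2 * c - y\<close> the one below \<open>c\<close> is the closer to 0, where the density is
  larger.\<close>

lemma bridge_flow_sgn:
  assumes "\<sigma> > 0" "c \<ge> 0"
  shows "y \<le> c \<Longrightarrow> 0 \<le> bridge_flow \<sigma> c k y" and "c \<le> y \<Longrightarrow> bridge_flow \<sigma> c k y \<le> 0"
  using assms unfolding bridge_flow_def walk_density_def
  by (auto intro!: normal_density_mono_abs)

lemma killed_bridge_bounds:
  assumes "\<sigma> > 0" "b \<ge> 0" "\<epsilon> > 0"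
  shows "ennreal (bridge_flow \<sigma> b k 0) \<le> killed_bridge \<sigma> b k"
    and "killed_bridge \<sigma> b k
      \<le> ennreal (bridge_flow \<sigma> (b + \<epsilon>) k 0 + Suc k * (1 / \<sigma> * exp (- \<epsilon>\<^sup>2 / (2 * \<sigma>\<^sup>2))))"
proof -
  have [measurable]: "bridge_flow \<sigma> c k \<in> borel_measurable borel" for c k
    unfolding bridge_flow_def[abs_def] by measurable
  show "ennreal (bridge_flow \<sigma> b k 0) \<le> killed_bridge \<sigma> b k"
  proof (rule killed_step_lower[where C="1/\<sigma>" and u="bridge_flow \<sigma> b", OF assms(1) _ _ bridge_flow_bound[OF assms(1)] bridge_flow_heat[OF assms(1)]])
    show "ennreal (bridge_flow \<sigma> b 0 z) \<le> ennreal (gauss \<sigma> z)" for z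
      by (intro ennreal_leI) (simp add: bridge_flow_def)
  qed (measurable, auto intro!: bridge_flow_sgn[OF assms(1,2)] assms(2))
  show "killed_bridge \<sigma> b k
      \<le> ennreal (bridge_flow \<sigma> (b + \<epsilon>) k 0 + Suc k * (1 / \<sigma> * exp (- \<epsilon>\<^sup>2 / (2 * \<sigma>\<^sup>2))))"
  proof (rule killed_step_upper[where C="1/\<sigma>" and u="bridge_flow \<sigma> (b + \<epsilon>)", OF assms(1,3) _ _ _ bridge_flow_bound[OF assms(1)] bridge_flow_heat[OF assms(1)]])
    fix z assume "z \<le> b"
    \<comment> \<open>The terminal weight exceeds the flow by the mirror term, whose argument is at
      distance at least \<epsilon> from 0; so it fits into the one error term that the comparison
      allows initially.\<close>
    then have z: "\<bar>\<epsilon>\<bar> \<le> \<bar>2 * (b + \<epsilon>) - z\<bar>" using assms by auto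
    have "gauss \<sigma> (2 * (b + \<epsilon>) - z) \<le> gauss \<sigma> \<epsilon>"
      by (rule normal_density_mono_abs[OF assms(1) z])
    also have "\<dots> \<le> 1 / \<sigma> * exp (- \<epsilon>\<^sup>2 / (2 * \<sigma>\<^sup>2))" using normal_density_le[OF assms(1), of \<epsilon>] by simp
    finally show "ennreal (gauss \<sigma> z) \<le> ennreal (bridge_flow \<sigma> (b + \<epsilon>) 0 z + 1 / \<sigma> * exp (- \<epsilon>\<^sup>2 / (2 * \<sigma>\<^sup>2)))"
      by (intro ennreal_leI) (simp add: bridge_flow_def)
  next
    have "0 \<le> b + \<epsilon>" using assms by simp
    then show "0 \<le> bridge_flow \<sigma> (b + \<epsilon>) k y" if "y \<le> b + \<epsilon>" for k y
      using bridge_flow_sgn(1)[OF assms(1)] that by blast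
  qed (measurable, use assms in simp_all)
qed

definition walk_cdf :: "real \<Rightarrow> real \<Rightarrow> nat \<Rightarrow> real \<Rightarrow> ennreal" where
  "walk_cdf \<sigma> c k z = (\<integral>\<^sup>+r. indicator {..c} r * ennreal (walk_density \<sigma> k (r - z)) \<partial>lborel)"

lemma borel_measurable_walk_cdf [measurable]: "walk_cdf \<sigma> c k \<in> borel_measurable borel"
  unfolding walk_cdf_def by measurable

lemma nn_integral_walk_density:
  assumes "\<sigma> > 0" shows "(\<integral>\<^sup>+r. ennreal (walk_density \<sigma> k (r - z)) \<partial>lborel) = 1"
proof -
  have s: "0 < \<sigma> * sqrt (Suc k)" using assms by simp
  interpret prob_space "density lborel (normal_density z (\<sigma> * sqrt (Suc k)))" by (rule prob_space_normal_density[OF s])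
  have "(\<integral>\<^sup>+r. ennreal (walk_density \<sigma> k (r - z)) \<partial>lborel) = emeasure (density lborel (normal_density z (\<sigma> * sqrt (Suc k)))) UNIV"
    by (simp add: emeasure_density walk_density_def normal_density_shift)
  then show ?thesis using emeasure_space_1 by simp
qed

lemma walk_cdf_complement:
  assumes "\<sigma> > 0"
  shows "walk_cdf \<sigma> c k z + (\<integral>\<^sup>+r. indicator {c<..} r * ennreal (walk_density \<sigma> k (r - z)) \<partial>lborel) = 1"
proof -
  have "walk_cdf \<sigma> c k z + (\<integral>\<^sup>+r. indicator {c<..} r * ennreal (walk_density \<sigma> k (r - z)) \<partial>lborel) =
    (\<integral>\<^sup>+r. ennreal (walk_density \<sigma> k (r - z)) \<partial>lborel)"
    unfolding walk_cdf_def
    by (subst nn_integral_add[symmetric]) (auto intro!: nn_integral_cong simp: indicator_def)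
  then show ?thesis unfolding nn_integral_walk_density[OF assms] .
qed

lemma walk_cdf_le_1: "\<sigma> > 0 \<Longrightarrow> walk_cdf \<sigma> c k z \<le> 1"
  using walk_cdf_complement[of \<sigma> c k z] by (metis add_increasing2 order_refl zero_le)

lemma walk_cdf_heat:
  assumes "\<sigma> > 0"
  shows "(\<integral>\<^sup>+y. ennreal (gauss \<sigma> (y - z)) * walk_cdf \<sigma> c k y \<partial>lborel) = walk_cdf \<sigma> c (Suc k) z"
proof -
  have "(\<integral>\<^sup>+y. ennreal (gauss \<sigma> (y - z)) * walk_cdf \<sigma> c k y \<partial>lborel) =
    (\<integral>\<^sup>+y. (\<integral>\<^sup>+r. ennreal (gauss \<sigma> (y - z)) * (indicator {..c} r * ennreal (walk_density \<sigma> k (r - y))) \<partial>lborel) \<partial>lborel)"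
    unfolding walk_cdf_def by (intro nn_integral_cong nn_integral_cmult[symmetric]) measurable
  also have "\<dots> = (\<integral>\<^sup>+r. (\<integral>\<^sup>+y. ennreal (gauss \<sigma> (y - z)) * (indicator {..c} r * ennreal (walk_density \<sigma> k (r - y))) \<partial>lborel) \<partial>lborel)"
    by (rule lborel_pair.Fubini') measurable
  also have "\<dots> = (\<integral>\<^sup>+r. indicator {..c} r * (\<integral>\<^sup>+y. ennreal (gauss \<sigma> (y - z)) * ennreal (walk_density \<sigma> k (r - y)) \<partial>lborel) \<partial>lborel)"
    by (subst nn_integral_cmult[symmetric]) (auto intro!: nn_integral_cong simp: mult_ac)
  also have "\<dots> = walk_cdf \<sigma> c (Suc k) z"
    by (simp add: walk_density_heat[OF assms] walk_cdf_def)
  finally show ?thesis .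
qed

text \<open>The probability that the walk ends at or below \<open>c\<close> minus the probability
  that it ends above: the heat flow of a sign function that changes at \<open>c\<close>. It is the
  usual reflection formula for the probability that the maximum stays below
  \<open>c\<close>.\<close>

definition motion_flow :: "real \<Rightarrow> real \<Rightarrow> nat \<Rightarrow> real \<Rightarrow> real" where
  "motion_flow \<sigma> c k z = 2 * enn2real (walk_cdf \<sigma> c k z) - 1"

lemma enn2real_walk_cdf:
  assumes "\<sigma> > 0"
  shows "0 \<le> enn2real (walk_cdf \<sigma> c k z)" "enn2real (walk_cdf \<sigma> c k z) \<le> 1"
    "ennreal (enn2real (walk_cdf \<sigma> c k z)) = walk_cdf \<sigma> c k z"
proof -
  show "enn2real (walk_cdf \<sigma> c k z) \<le> 1" using walk_cdf_le_1[OF assms, of c k z] enn2real_leI[of 1] by simp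
  show "ennreal (enn2real (walk_cdf \<sigma> c k z)) = walk_cdf \<sigma> c k z"
    using le_less_trans[OF walk_cdf_le_1[OF assms, of c k z] ennreal_one_less_top] by simp
qed simp

lemma motion_flow_heat:
  assumes "\<sigma> > 0"
  shows "motion_flow \<sigma> c (Suc k) z = (\<integral>y. gauss \<sigma> (y - z) * motion_flow \<sigma> c k y \<partial>lborel)"
proof -
  have i: "integrable lborel (\<lambda>y. gauss \<sigma> (y - z) * enn2real (walk_cdf \<sigma> c k y))"
    using enn2real_walk_cdf[OF assms] by (intro integrable_normal_density_bounded[OF assms, of _ 1]) auto
  have "(\<integral>\<^sup>+y. ennreal (gauss \<sigma> (y - z) * enn2real (walk_cdf \<sigma> c k y)) \<partial>lborel) = walk_cdf \<sigma> c (Suc k) z"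
    using walk_cdf_heat[OF assms] enn2real_walk_cdf(3)[OF assms] by (simp add: ennreal_mult')
  then have e: "(\<integral>y. gauss \<sigma> (y - z) * enn2real (walk_cdf \<sigma> c k y) \<partial>lborel) = enn2real (walk_cdf \<sigma> c (Suc k) z)"
    by (subst integral_eq_nn_integral) auto
  have "(\<integral>y. gauss \<sigma> (y - z) * motion_flow \<sigma> c k y \<partial>lborel) =
    (\<integral>y. 2 * (gauss \<sigma> (y - z) * enn2real (walk_cdf \<sigma> c k y)) - normal_density z \<sigma> y \<partial>lborel)"
    by (intro Bochner_Integration.integral_cong) (auto simp: motion_flow_def normal_density_shift algebra_simps)
  also have "\<dots> = 2 * enn2real (walk_cdf \<sigma> c (Suc k) z) - 1"
    using i assms by (subst Bochner_Integration.integral_diff) (auto simp: e)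
  finally show ?thesis by (simp add: motion_flow_def)
qed

lemma motion_flow_bound: "\<sigma> > 0 \<Longrightarrow> \<bar>motion_flow \<sigma> c k y\<bar> \<le> 1"
  using enn2real_walk_cdf(1,2)[of \<sigma> c k y] unfolding motion_flow_def by linarith

text \<open>Reflecting the end point in the start \<open>z\<close> turns the mass above
  \<open>c\<close> into the mass below \<open>2 * z - c\<close>. Comparing this number with
  \<open>c\<close> decides which of the two probabilities is larger.\<close>

lemma motion_flow_sgn:
  assumes "\<sigma> > 0"
  shows "z \<le> c \<Longrightarrow> 0 \<le> motion_flow \<sigma> c k z" and "c \<le> z \<Longrightarrow> motion_flow \<sigma> c k z \<le> 0"
proof -
  define t where "t = (\<integral>\<^sup>+r. indicator {c<..} r * ennreal (walk_density \<sigma> k (r - z)) \<partial>lborel)"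
  have sum: "walk_cdf \<sigma> c k z + t = 1" using walk_cdf_complement[OF assms] by (simp add: t_def)
  have "t \<le> 1" using sum by (metis add_increasing order_refl zero_le)
  then obtain s where s: "t = ennreal s" "s \<ge> 0" by (cases t) (auto simp: top_unique)
  have s1: "enn2real (walk_cdf \<sigma> c k z) + s = 1"
  proof -
    have "ennreal (enn2real (walk_cdf \<sigma> c k z) + s) = ennreal 1" 
      using sum enn2real_walk_cdf[OF assms] s by (simp add: ennreal_plus)
    then show ?thesis using s enn2real_walk_cdf(1)[OF assms, of c k z] by (subst (asm) ennreal_inj) auto
  qed
  have refl: "t = (\<integral>\<^sup>+r. indicator {..<2*z-c} r * ennreal (walk_density \<sigma> k (r - z)) \<partial>lborel)"
    unfolding t_def
    by (subst nn_integral_real_affine[of _ "-1" "2*z"])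
      (auto intro!: nn_integral_cong simp: indicator_def walk_density_uminus[of \<sigma> k "z - _", simplified])
  show "0 \<le> motion_flow \<sigma> c k z" if "z \<le> c"
  proof -
    have "t \<le> walk_cdf \<sigma> c k z" unfolding refl walk_cdf_def using that
      by (intro nn_integral_mono) (auto simp: indicator_def)
    then have "ennreal s \<le> ennreal (enn2real (walk_cdf \<sigma> c k z))" using s enn2real_walk_cdf[OF assms] by simp
    then have "s \<le> enn2real (walk_cdf \<sigma> c k z)" by (subst (asm) ennreal_le_iff) auto
    then show ?thesis using s1 by (simp add: motion_flow_def)
  qed
  show "motion_flow \<sigma> c k z \<le> 0" if "c \<le> z"
  proof -
    have "walk_cdf \<sigma> c k z = (\<integral>\<^sup>+r. indicator {..<c} r * ennreal (walk_density \<sigma> k (r - z)) \<partial>lborel)" unfolding walk_cdf_def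
      \<comment> \<open>Open and closed half-lines differ by the null set
        \<open>{c}\<close>.\<close>
      by (intro nn_integral_cong_AE AE_I[of _ _ "{c}"]) (auto simp: indicator_def)
    also have "\<dots> \<le> t" unfolding refl using that
      by (intro nn_integral_mono) (auto simp: indicator_def)
    finally have "ennreal (enn2real (walk_cdf \<sigma> c k z)) \<le> ennreal s" using s enn2real_walk_cdf[OF assms] by simp
    then have "enn2real (walk_cdf \<sigma> c k z) \<le> s" using s by (subst (asm) ennreal_le_iff) auto
    then show ?thesis using s1 by (simp add: motion_flow_def)
  qed
qed

lemma killed_step_1: "killed_step \<sigma> b (\<lambda>_. 1) z = walk_cdf \<sigma> b 0 z"
  by (simp add: killed_step_def walk_cdf_def mult.commute)

lemma killed_motion_bounds:
  assumes "\<sigma> > 0" "b \<ge> 0" "\<epsilon> > 0"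
  shows "ennreal (motion_flow \<sigma> b k 0) \<le> killed_motion \<sigma> b (Suc k)"
    and "killed_motion \<sigma> b (Suc k) \<le> ennreal (motion_flow \<sigma> (b + \<epsilon>) k 0 + Suc k * (1 * exp (- \<epsilon>\<^sup>2 / (2 * \<sigma>\<^sup>2))))"
proof -
  have [measurable]: "motion_flow \<sigma> c k \<in> borel_measurable borel" for c k
    unfolding motion_flow_def[abs_def] by measurable
  \<comment> \<open>The flow of index 0 already contains one step, so the innermost killed step is
    absorbed into the initial function.\<close>
  have Suc: "(killed_step \<sigma> b ^^ Suc k) (\<lambda>_. 1) = (killed_step \<sigma> b ^^ k) (killed_step \<sigma> b (\<lambda>_. 1))"
    by (simp only: funpow_Suc_right o_apply)
  show "ennreal (motion_flow \<sigma> b k 0) \<le> killed_motion \<sigma> b (Suc k)"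
    unfolding Suc
  proof (rule killed_step_lower[where C=1 and u="motion_flow \<sigma> b", OF assms(1) _ _ motion_flow_bound[OF assms(1)] motion_flow_heat[OF assms(1)]])
    fix z :: real assume "z \<le> b"
    have "ennreal (motion_flow \<sigma> b 0 z) \<le> ennreal (enn2real (walk_cdf \<sigma> b 0 z))"
      using enn2real_walk_cdf(2)[OF assms(1), of b 0 z] by (intro ennreal_leI) (simp add: motion_flow_def)
    then show "ennreal (motion_flow \<sigma> b 0 z) \<le> killed_step \<sigma> b (\<lambda>_. 1) z"
      by (simp add: killed_step_1 enn2real_walk_cdf(3)[OF assms(1)])
  qed (measurable, auto intro!: motion_flow_sgn[OF assms(1)] assms(2))
  show "killed_motion \<sigma> b (Suc k) \<le> ennreal (motion_flow \<sigma> (b + \<epsilon>) k 0 + Suc k * (1 * exp (- \<epsilon>\<^sup>2 / (2 * \<sigma>\<^sup>2))))"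
    unfolding Suc
  proof (rule killed_step_upper[where C=1 and u="motion_flow \<sigma> (b + \<epsilon>)", OF assms(1,3) _ _ _ motion_flow_bound[OF assms(1)] motion_flow_heat[OF assms(1)]])
    fix z :: real assume z: "z \<le> b"
    define E where "E = exp (- \<epsilon>\<^sup>2 / (2 * \<sigma>\<^sup>2))"
    define t where "t = (\<integral>\<^sup>+r. indicator {b + \<epsilon><..} r * ennreal (walk_density \<sigma> 0 (r - z)) \<partial>lborel)"
    have sum: "walk_cdf \<sigma> (b + \<epsilon>) 0 z + t = 1" using walk_cdf_complement[OF assms(1), of "b + \<epsilon>" 0 z] by (simp only: t_def)
    have "t \<le> (\<integral>\<^sup>+r. ennreal E * ennreal (normal_density (z + \<epsilon>) \<sigma> r) \<partial>lborel)" unfolding t_def E_def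
      using normal_density_tail_le[OF assms(1), of \<epsilon> z] z assms
      by (intro nn_integral_mono) (auto simp: indicator_def ennreal_mult[symmetric] intro!: ennreal_leI)
    also have "\<dots> = ennreal E" using nn_integral_walk_density[OF assms(1), of 0 "z + \<epsilon>"]
      by (simp add: nn_integral_cmult normal_density_shift)
    finally have "1 \<le> walk_cdf \<sigma> (b + \<epsilon>) 0 z + ennreal E" unfolding sum[symmetric] by (intro add_left_mono)
    then have "ennreal 1 \<le> ennreal (enn2real (walk_cdf \<sigma> (b + \<epsilon>) 0 z) + E)"
      using enn2real_walk_cdf[OF assms(1)] by (simp add: ennreal_plus E_def)
    then have "1 \<le> enn2real (walk_cdf \<sigma> (b + \<epsilon>) 0 z) + E"
      by (subst (asm) ennreal_le_iff) (auto simp: E_def)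
    \<comment> \<open>Adding the probability \<open>P\<close> to both sides of
      \<open>1 \<le> P + E\<close> gives \<open>P \<le> (2 * P - 1) + E\<close>.\<close>
    then have *: "enn2real (walk_cdf \<sigma> (b + \<epsilon>) 0 z) \<le> motion_flow \<sigma> (b + \<epsilon>) 0 z + 1 * E"
      by (simp add: motion_flow_def)
    have "killed_step \<sigma> b (\<lambda>_. 1) z \<le> walk_cdf \<sigma> (b + \<epsilon>) 0 z" unfolding killed_step_1 walk_cdf_def using assms(3)
      by (intro nn_integral_mono) (auto simp: indicator_def)
    also have "\<dots> \<le> ennreal (motion_flow \<sigma> (b + \<epsilon>) 0 z + 1 * E)"
      using ennreal_leI[OF *] enn2real_walk_cdf(3)[OF assms(1)] by simp
    finally show "killed_step \<sigma> b (\<lambda>_. 1) z \<le> ennreal (motion_flow \<sigma> (b + \<epsilon>) 0 z + 1 * exp (- \<epsilon>\<^sup>2 / (2 * \<sigma>\<^sup>2)))"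
      by (simp add: E_def)
  next
    show "0 \<le> motion_flow \<sigma> (b + \<epsilon>) k y" if "y \<le> b + \<epsilon>" for k y
      using motion_flow_sgn(1)[OF assms(1)] that by blast
  qed (measurable, use assms in simp_all)
qed

section \<open>The error function and the limit of fine grids\<close>

lemma erf_has_real_derivative:
  "(erf has_real_derivative 2 / sqrt pi * exp (- z\<^sup>2)) (at z)"
proof -
  define R where "R = \<bar>z\<bar> + 1"
  have z: "z \<in> {-R<..<R}" by (auto simp: R_def)
  have cont: "continuous_on {-R..R} (\<lambda>y. exp (- (y\<^sup>2)))" by (intro continuous_intros)
  have "((\<lambda>u. LBINT y=ereal 0..u. exp (- (y\<^sup>2))) has_vector_derivative exp (- z\<^sup>2)) (at z within {-R..R})"
    by (rule interval_integral_FTC2[OF _ _ cont]) (auto simp: R_def)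
  then have "((\<lambda>u. LBINT y=0..u. exp (- (y\<^sup>2))) has_vector_derivative exp (- z\<^sup>2)) (at z within {-R..R})"
    by (simp only: zero_ereal_def)
  moreover have "at z within {-R..R} = at z" using z by (intro at_within_interior) (simp add: interior_atLeastAtMost_real)
  ultimately have "((\<lambda>u. LBINT y=0..u. exp (- (y\<^sup>2))) has_real_derivative exp (- z\<^sup>2)) (at z)"
    by (simp only: has_real_derivative_iff_has_vector_derivative)
  then show ?thesis unfolding erf_def[abs_def] by (rule DERIV_cmult)
qed

lemma erf_0 [simp]: "erf 0 = 0"
  by (simp add: erf_def zero_ereal_def)

lemma erf_sqrt2_has_real_derivative:
  "((\<lambda>x. erf (x / sqrt 2)) has_real_derivative 2 * gauss 1 x) (at x)"
proof -
  have "((\<lambda>x. erf (x / sqrt 2)) has_real_derivative (2 / sqrt pi * exp (- (x / sqrt 2)\<^sup>2)) * (1 / sqrt 2)) (at x)"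
    by (rule DERIV_chain2[OF erf_has_real_derivative]) (rule DERIV_cdivide[OF DERIV_ident])
  also have "(2 / sqrt pi * exp (- (x / sqrt 2)\<^sup>2)) * (1 / sqrt 2) = 2 * gauss 1 x"
    by (simp add: normal_density_def real_sqrt_mult power_divide)
  finally show ?thesis .
qed

text \<open>The total variance is 1. Half of the mass lies below 0, which cancels the 1 in
  \<open>motion_flow\<close>, and twice the mass of \<open>{0..c}\<close> is the error function by
  the fundamental theorem of calculus.\<close>

lemma motion_flow_eq_erf:
  assumes "\<sigma> * sqrt (Suc k) = 1" "\<sigma> > 0" "c \<ge> 0"
  shows "motion_flow \<sigma> c k 0 = erf (c / sqrt 2)"
proof -
  have d: "walk_density \<sigma> k = gauss 1" using assms(1) by (simp add: walk_density_def)
  define h where "h = (\<integral>\<^sup>+r. indicator {..<0} r * ennreal (gauss 1 r) \<partial>lborel)"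
  have "h = (\<integral>\<^sup>+r. indicator {0<..} r * ennreal (gauss 1 r) \<partial>lborel)" unfolding h_def
    by (subst nn_integral_real_affine[of _ "-1" 0]) (auto intro!: nn_integral_cong simp: indicator_def normal_density_def)
  moreover have "walk_cdf \<sigma> 0 k 0 = h" unfolding h_def walk_cdf_def d
    by (intro nn_integral_cong_AE AE_I[of _ _ "{0}"]) (auto simp: indicator_def)
  ultimately have hh: "h + h = 1" using walk_cdf_complement[OF assms(2), of 0 k 0] by (simp add: d)
  have "(\<integral>\<^sup>+r. ennreal (2 * gauss 1 r) * indicator {0..c} r \<partial>lborel) = ennreal (erf (c / sqrt 2) - erf (0 / sqrt 2))"
  proof (rule nn_integral_FTC_Icc[OF _ _ _ assms(3)])
    show "((\<lambda>x. erf (x / sqrt 2)) has_real_derivative 2 * gauss 1 x) (at x)" for x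
      by (rule erf_sqrt2_has_real_derivative)
  qed auto
  then have i: "2 * (\<integral>\<^sup>+r. ennreal (gauss 1 r) * indicator {0..c} r \<partial>lborel) = ennreal (erf (c / sqrt 2))"
    by (subst nn_integral_cmult[symmetric]) (auto simp: ennreal_mult' mult.assoc)
  have "erf (0 / sqrt 2) \<le> erf (c / sqrt 2)"
  proof (rule DERIV_nonneg_imp_nondecreasing[OF assms(3)])
    fix x
    show "\<exists>y. ((\<lambda>x. erf (x / sqrt 2)) has_real_derivative y) (at x) \<and> 0 \<le> y"
      by (intro exI conjI, rule erf_sqrt2_has_real_derivative) simp
  qed
  then have e0: "erf (c / sqrt 2) \<ge> 0" by simp
  have "walk_cdf \<sigma> c k 0 = h + (\<integral>\<^sup>+r. ennreal (gauss 1 r) * indicator {0..c} r \<partial>lborel)"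
    unfolding walk_cdf_def d h_def using assms(3)
    by (subst nn_integral_add[symmetric]) (auto intro!: nn_integral_cong simp: indicator_def)
  then have "2 * walk_cdf \<sigma> c k 0 = (h + h) + 2 * (\<integral>\<^sup>+r. ennreal (gauss 1 r) * indicator {0..c} r \<partial>lborel)"
    by (simp only: distrib_left mult_2)
  then have "2 * walk_cdf \<sigma> c k 0 = 1 + ennreal (erf (c / sqrt 2))" by (simp only: i hh)
  moreover have "2 * walk_cdf \<sigma> c k 0 = ennreal (2 * enn2real (walk_cdf \<sigma> c k 0))"
    by (subst ennreal_mult') (auto simp: enn2real_walk_cdf(3)[OF assms(2)])
  moreover have "1 + ennreal (erf (c / sqrt 2)) = ennreal (1 + erf (c / sqrt 2))"
    using e0 by (subst ennreal_plus) auto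
  ultimately have "ennreal (2 * enn2real (walk_cdf \<sigma> c k 0)) = ennreal (1 + erf (c / sqrt 2))" by simp
  then have "2 * enn2real (walk_cdf \<sigma> c k 0) = 1 + erf (c / sqrt 2)"
    using e0 enn2real_walk_cdf(1)[OF assms(2), of c k 0] by (subst (asm) ennreal_inj) auto
  then show ?thesis by (simp add: motion_flow_def)
qed

lemma sqrt_step:
  assumes "N > 0"
  shows "sqrt (1 / N) * sqrt (Suc (N - 1)) = 1" "sqrt (1 / N) > 0"
  using assms by (auto simp: real_sqrt_mult[symmetric])

text \<open>The overshoot \<open>N powr (-1/4)\<close> tends to \<open>0\<close>, but is still much larger than the step deviation \<open>sqrt (1/N)\<close>.\<close>
lemma overshoot_scale:
  fixes N :: nat
  assumes "N > 0"
  shows "real N powr (- (1/4)) > 0" "(real N powr (- (1/4)))\<^sup>2 / (2 * (sqrt (1 / N))\<^sup>2) = sqrt N / 2"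
proof -
  have "(real N powr (- (1/4)))\<^sup>2 * N = (real N powr (- (1/4)) * real N powr (- (1/4))) * real N powr 1"
    using assms by (simp add: power2_eq_square)
  also have "\<dots> = real N powr (1/2)" by (simp only: powr_add[symmetric]) simp
  finally show "(real N powr (- (1/4)))\<^sup>2 / (2 * (sqrt (1 / N))\<^sup>2) = sqrt N / 2" by (simp add: powr_half_sqrt)
qed (use assms in simp)

text \<open>The lower bound is exact at every \<open>N\<close>. The upper bound has the raised
  level, which tends to \<open>b\<close>, and an error of \<open>N\<close> Gaussian tails
  \<open>exp (- sqrt N / 2)\<close>, which tends to 0.\<close>

lemma motion_killed_limit:
  assumes "b \<ge> 0"
  shows "(\<lambda>N. killed_motion (sqrt (1 / real N)) b N) \<longlonglongrightarrow> ennreal (erf (b / sqrt 2))"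
proof (rule tendsto_sandwich)
  note s = sqrt_step
  define \<epsilon> :: "nat \<Rightarrow> real" where "\<epsilon> N = real N powr (- (1/4))" for N
  note e = overshoot_scale[folded \<epsilon>_def]
  show "\<forall>\<^sub>F N in sequentially. ennreal (erf (b / sqrt 2)) \<le> killed_motion (sqrt (1 / real N)) b N"
    using eventually_gt_at_top[of 0]
  proof eventually_elim
    case (elim N)
    then show ?case using killed_motion_bounds(1)[OF s(2)[OF elim] assms e(1)[OF elim], of "N - 1"] motion_flow_eq_erf[OF s[OF elim] assms] by simp
  qed
  show "\<forall>\<^sub>F N in sequentially. killed_motion (sqrt (1 / real N)) b N \<le> ennreal (erf ((b + \<epsilon> N) / sqrt 2) + real N * exp (- sqrt N / 2))"
    using eventually_gt_at_top[of 0]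
  proof eventually_elim
    case (elim N)
    have "b + \<epsilon> N \<ge> 0" using assms e(1)[OF elim] by simp
    then show ?case using killed_motion_bounds(2)[OF s(2)[OF elim] assms e(1)[OF elim], of "N - 1"] elim e(2)[OF elim] motion_flow_eq_erf[OF s[OF elim], of "b + \<epsilon> N"] by simp
  qed
  have "(\<lambda>N. erf ((b + \<epsilon> N) / sqrt 2) + real N * exp (- sqrt N / 2)) \<longlonglongrightarrow> erf ((b + 0) / sqrt 2) + 0"
  proof (intro tendsto_add)
    have "\<epsilon> \<longlonglongrightarrow> 0" unfolding \<epsilon>_def by real_asymp
    then have "(\<lambda>N. (b + \<epsilon> N) / sqrt 2) \<longlonglongrightarrow> (b + 0) / sqrt 2" by (intro tendsto_intros) auto
    moreover have "isCont erf ((b + 0) / sqrt 2)" by (rule DERIV_isCont[OF erf_has_real_derivative])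
    ultimately show "(\<lambda>N. erf ((b + \<epsilon> N) / sqrt 2)) \<longlonglongrightarrow> erf ((b + 0) / sqrt 2)" by (rule isCont_tendsto_compose[rotated])
    show "(\<lambda>N. real N * exp (- sqrt N / 2)) \<longlonglongrightarrow> 0" by real_asymp
  qed
  then show "(\<lambda>N. ennreal (erf ((b + \<epsilon> N) / sqrt 2) + real N * exp (- sqrt N / 2))) \<longlonglongrightarrow> ennreal (erf (b / sqrt 2))"
    by (intro tendsto_ennrealI) simp
qed simp

text \<open>As for motion, with an extra factor \<open>sqrt N\<close> in the error: the flow is
  bounded by the reciprocal step deviation instead of 1. The iteration count is \<open>N - 1\<close>
  because the last step is in the terminal weight.\<close>

lemma bridge_killed_limit:
  assumes "b \<ge> 0"
  shows "(\<lambda>N. killed_bridge (sqrt (1 / real N)) b (N - 1))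
    \<longlonglongrightarrow> ennreal (gauss 1 0 * (1 - exp (- 2 * b\<^sup>2)))"
proof (rule tendsto_sandwich)
  note s = sqrt_step
  define \<epsilon> :: "nat \<Rightarrow> real" where "\<epsilon> N = real N powr (- (1/4))" for N
  note e = overshoot_scale[folded \<epsilon>_def]
  \<comment> \<open>After total variance 1 the mirror term is the standard density at
    \<open>2 * c\<close>, which is \<open>exp (- 2 * c\<^sup>2)\<close> times the density at
    0.\<close>
  have fl: "bridge_flow (sqrt (1 / N)) c (N - 1) 0 = gauss 1 0 * (1 - exp (- 2 * c\<^sup>2))" if "N > 0" for N c
    unfolding bridge_flow_def walk_density_def s(1)[OF that] by (simp add: normal_density_def algebra_simps power2_eq_square)
  show "\<forall>\<^sub>F N in sequentially. ennreal (gauss 1 0 * (1 - exp (- 2 * b\<^sup>2))) \<le> killed_bridge (sqrt (1 / real N)) b (N - 1)"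
    using eventually_gt_at_top[of 0]
  proof eventually_elim
    case (elim N)
    then show ?case using killed_bridge_bounds(1)[OF s(2)[OF elim] assms e(1)[OF elim], of "N - 1"] unfolding fl[OF elim] by blast
  qed
  show "\<forall>\<^sub>F N in sequentially. killed_bridge (sqrt (1 / real N)) b (N - 1)
     \<le> ennreal (gauss 1 0 * (1 - exp (- 2 * (b + \<epsilon> N)\<^sup>2)) + real N * (sqrt N * exp (- sqrt N / 2)))"
    using eventually_gt_at_top[of 0]
  proof eventually_elim
    case (elim N)
    have "1 / sqrt (1 / real N) = sqrt N" by (simp add: real_sqrt_divide)
    then show ?case using killed_bridge_bounds(2)[OF s(2)[OF elim] assms e(1)[OF elim], of "N - 1"] e(2)[OF elim] elim unfolding fl[OF elim]
      by (simp del: real_sqrt_divide)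
  qed
  have "(\<lambda>N. gauss 1 0 * (1 - exp (- 2 * (b + \<epsilon> N)\<^sup>2)) + real N * (sqrt N * exp (- sqrt N / 2))) \<longlonglongrightarrow> gauss 1 0 * (1 - exp (- 2 * (b + 0)\<^sup>2)) + 0"
  proof (intro tendsto_add)
    have "\<epsilon> \<longlonglongrightarrow> 0" unfolding \<epsilon>_def by real_asymp
    then show "(\<lambda>N. gauss 1 0 * (1 - exp (- 2 * (b + \<epsilon> N)\<^sup>2))) \<longlonglongrightarrow> gauss 1 0 * (1 - exp (- 2 * (b + 0)\<^sup>2))"
      by (intro tendsto_intros)
    show "(\<lambda>N. real N * (sqrt N * exp (- sqrt N / 2))) \<longlonglongrightarrow> 0" by real_asymp
  qed
  then show "(\<lambda>N. ennreal (gauss 1 0 * (1 - exp (- 2 * (b + \<epsilon> N)\<^sup>2)) + real N * (sqrt N * exp (- sqrt N / 2)))) \<longlonglongrightarrow> ennreal (gauss 1 0 * (1 - exp (- 2 * b\<^sup>2)))"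
    by (intro tendsto_ennrealI) simp
qed simp

section \<open>Rotation invariance\<close>

text \<open>For nonzero \<open>c\<close> the rotation is a composition of two affine substitutions
  in one variable: first \<open>u = c * x + s * y\<close> in \<open>x\<close>, then
  \<open>y = s * u + c * v\<close>. Each produces a factor \<open>\<bar>c\<bar>\<close>, and these
  cancel. The quarter turns, with \<open>c = 0\<close>, merely exchange the variables up to
  sign.\<close>

lemma nn_integral_rotate_plane:
  fixes G :: "real \<Rightarrow> real \<Rightarrow> ennreal"
  assumes G: "(\<lambda>p. G (fst p) (snd p)) \<in> borel_measurable (borel \<Otimes>\<^sub>M borel)"
    and cs: "c\<^sup>2 + s\<^sup>2 = (1::real)"
  shows "(\<integral>\<^sup>+x. \<integral>\<^sup>+y. G (c * x + s * y) (c * y - s * x) \<partial>lborel \<partial>lborel) = (\<integral>\<^sup>+x. \<integral>\<^sup>+y. G x y \<partial>lborel \<partial>lborel)"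
proof -
  have GM: "(\<lambda>z. G (f z) (g z)) \<in> borel_measurable N" if "f \<in> borel_measurable N" "g \<in> borel_measurable N" for f g and N :: "'z measure"
    using measurable_compose[OF measurable_Pair[OF that] G] by simp
  have [measurable]: "(\<lambda>z. G (f z) (g z)) \<in> borel_measurable N" if "f \<in> borel_measurable N" "g \<in> borel_measurable N" for f g and N :: "real measure"
    using GM that by blast
  have [measurable]: "(\<lambda>z. G (f z) (g z)) \<in> borel_measurable N" if "f \<in> borel_measurable N" "g \<in> borel_measurable N" for f g and N :: "(real \<times> real) measure"
    using GM that by blast
  show ?thesis
  proof (cases "c = 0")
    case True
    then have s: "s \<noteq> 0" "\<bar>s\<bar> = 1" using cs by (auto simp: power2_eq_1_iff)
    have "(\<integral>\<^sup>+x. \<integral>\<^sup>+y. G (c * x + s * y) (c * y - s * x) \<partial>lborel \<partial>lborel) = (\<integral>\<^sup>+x. \<integral>\<^sup>+y. G (s * y) (- s * x) \<partial>lborel \<partial>lborel)"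
      by (simp add: True)
    also have "\<dots> = (\<integral>\<^sup>+x. \<integral>\<^sup>+u. G u (- s * x) \<partial>lborel \<partial>lborel)"
    proof (rule nn_integral_cong)
      fix x
      show "(\<integral>\<^sup>+y. G (s * y) (- s * x) \<partial>lborel) = (\<integral>\<^sup>+u. G u (- s * x) \<partial>lborel)"
        using nn_integral_real_affine[of "\<lambda>u. G u (- s * x)" s 0] s by simp
    qed
    also have "\<dots> = (\<integral>\<^sup>+u. \<integral>\<^sup>+x. G u (- s * x) \<partial>lborel \<partial>lborel)"
      by (rule lborel_pair.Fubini') measurable
    also have "\<dots> = (\<integral>\<^sup>+u. \<integral>\<^sup>+v. G u v \<partial>lborel \<partial>lborel)"
    proof (rule nn_integral_cong)
      fix u
      show "(\<integral>\<^sup>+x. G u (- s * x) \<partial>lborel) = (\<integral>\<^sup>+v. G u v \<partial>lborel)"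
        using nn_integral_real_affine[of "\<lambda>v. G u v" "-s" 0] s by simp
    qed
    finally show ?thesis .
  next
    case False
    have "ennreal \<bar>c\<bar> * (\<integral>\<^sup>+x. \<integral>\<^sup>+y. G (c * x + s * y) (c * y - s * x) \<partial>lborel \<partial>lborel) =
      ennreal \<bar>c\<bar> * (\<integral>\<^sup>+y. \<integral>\<^sup>+x. G (c * x + s * y) (c * y - s * x) \<partial>lborel \<partial>lborel)"
      by (subst lborel_pair.Fubini') measurable
    also have "\<dots> = (\<integral>\<^sup>+y. ennreal \<bar>c\<bar> * (\<integral>\<^sup>+x. G (c * x + s * y) (c * y - s * x) \<partial>lborel) \<partial>lborel)"
      by (subst nn_integral_cmult) measurable
    also have "\<dots> = (\<integral>\<^sup>+y. \<integral>\<^sup>+u. G u ((y - s * u) / c) \<partial>lborel \<partial>lborel)"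
    proof (rule nn_integral_cong)
      fix y
      have e: "(y - s * (s * y + c * x)) / c = c * y - s * x" for x
      proof -
        have "y - s * (s * y + c * x) = y * (1 - s\<^sup>2) - s * c * x" by (simp add: power2_eq_square algebra_simps)
        also have "1 - s\<^sup>2 = c\<^sup>2" using cs by simp
        finally show ?thesis using False by (simp add: power2_eq_square field_simps)
      qed
      have "(\<integral>\<^sup>+u. G u ((y - s * u) / c) \<partial>lborel) = ennreal \<bar>c\<bar> * (\<integral>\<^sup>+x. G (s * y + c * x) ((y - s * (s * y + c * x)) / c) \<partial>lborel)"
        by (rule nn_integral_real_affine[OF _ False]) measurable
      then show "ennreal \<bar>c\<bar> * (\<integral>\<^sup>+x. G (c * x + s * y) (c * y - s * x) \<partial>lborel) = (\<integral>\<^sup>+u. G u ((y - s * u) / c) \<partial>lborel)"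
        unfolding e by (simp add: add.commute)
    qed
    also have "\<dots> = (\<integral>\<^sup>+u. \<integral>\<^sup>+y. G u ((y - s * u) / c) \<partial>lborel \<partial>lborel)"
      by (rule lborel_pair.Fubini') measurable
    also have "\<dots> = (\<integral>\<^sup>+u. ennreal \<bar>c\<bar> * (\<integral>\<^sup>+v. G u v \<partial>lborel) \<partial>lborel)"
    proof (rule nn_integral_cong)
      fix u
      have "(\<integral>\<^sup>+y. G u ((y - s * u) / c) \<partial>lborel) = ennreal \<bar>c\<bar> * (\<integral>\<^sup>+v. G u ((s * u + c * v - s * u) / c) \<partial>lborel)"
        by (rule nn_integral_real_affine[OF _ False]) measurable
      then show "(\<integral>\<^sup>+y. G u ((y - s * u) / c) \<partial>lborel) = ennreal \<bar>c\<bar> * (\<integral>\<^sup>+v. G u v \<partial>lborel)"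
        using False by simp
    qed
    also have "\<dots> = ennreal \<bar>c\<bar> * (\<integral>\<^sup>+x. \<integral>\<^sup>+y. G x y \<partial>lborel \<partial>lborel)"
      by (subst nn_integral_cmult) measurable
    finally show ?thesis using False by (simp add: ennreal_mult_cancel_left)
  qed
qed

abbreviation lborel_Pi :: "'i set \<Rightarrow> ('i \<Rightarrow> real) measure" where
  "lborel_Pi I \<equiv> PiM I (\<lambda>_. lborel)"

text \<open>If \<open>c\<close> and \<open>s\<close> are a cosine and a sine, then
  \<open>rot c s I x y\<close> and \<open>rot c (- s) I y x\<close> are the two coordinates of the
  family of points \<open>(x i, y i)\<close>, all rotated by the same angle.\<close>

definition rot :: "real \<Rightarrow> real \<Rightarrow> 'i set \<Rightarrow> ('i \<Rightarrow> real) \<Rightarrow> ('i \<Rightarrow> real) \<Rightarrow> 'i \<Rightarrow> real" where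
  "rot c s I x y = (\<lambda>i\<in>I. c * x i + s * y i)"

lemma rot_fun_upd:
  "i \<notin> I \<Longrightarrow> rot c s (insert i I) (x(i := a)) (y(i := b)) = (rot c s I x y)(i := c * a + s * b)"
  by (auto simp: rot_def fun_eq_iff)

lemma measurable_rot:
  assumes "f \<in> measurable N (lborel_Pi I)" "g \<in> measurable N (lborel_Pi I)"
  shows "(\<lambda>z. rot c s I (f z) (g z)) \<in> measurable N (lborel_Pi I)"
proof -
  have [measurable]: "(\<lambda>z. f z i) \<in> borel_measurable N" "(\<lambda>z. g z i) \<in> borel_measurable N" if "i \<in> I" for i
    using measurable_compose[OF assms(1) measurable_component_singleton[OF that]] 
      measurable_compose[OF assms(2) measurable_component_singleton[OF that]] by simp_all
  show ?thesis unfolding rot_def by measurable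
qed

interpretation lborel_product: product_sigma_finite "\<lambda>_. lborel :: real measure" ..

text \<open>The coordinates \<open>i\<close> of both vectors are split off together and rotated in
  their own plane; the induction hypothesis rotates the rest. Most steps are Fubini rearrangements
  that bring the two \<open>i\<close>-coordinates innermost.\<close>

lemma nn_integral_rotate_PiM:
  fixes F :: "('i \<Rightarrow> real) \<Rightarrow> ('i \<Rightarrow> real) \<Rightarrow> ennreal"
  assumes "finite I" "(\<lambda>p. F (fst p) (snd p)) \<in> borel_measurable (lborel_Pi I \<Otimes>\<^sub>M lborel_Pi I)"
    and cs: "c\<^sup>2 + s\<^sup>2 = (1::real)"
  shows "(\<integral>\<^sup>+x. \<integral>\<^sup>+y. F (rot c s I x y) (rot c (- s) I y x) \<partial>lborel_Pi I \<partial>lborel_Pi I) =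
    (\<integral>\<^sup>+x. \<integral>\<^sup>+y. F x y \<partial>lborel_Pi I \<partial>lborel_Pi I)"
  using assms(1,2)
proof (induction I arbitrary: F)
  case empty
  show ?case by (simp add: PiM_empty nn_integral_count_space_finite rot_def restrict_def)
next
  case (insert i I)
  let ?P = "lborel_Pi I"
  let ?Q = "lborel_Pi (insert i I)"
  note fin = insert.hyps(1) and iI = insert.hyps(2)
  interpret P: sigma_finite_measure ?P by (rule lborel_product.sigma_finite[OF fin])
  interpret Q: sigma_finite_measure ?Q by (rule lborel_product.sigma_finite) (simp add: fin)
  interpret LP: pair_sigma_finite "lborel :: real measure" ?P by standard
  interpret PL: pair_sigma_finite ?P "lborel :: real measure" by standard
  have FM: "(\<lambda>z. F (f z) (g z)) \<in> borel_measurable N" if "f \<in> measurable N ?Q" "g \<in> measurable N ?Q" for f g and N :: "'z measure"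
    using measurable_compose[OF measurable_Pair[OF that] insert.prems] by simp
  have upd: "(\<lambda>z. (f z)(i := g z)) \<in> measurable N ?Q" if "f \<in> measurable N ?P" "g \<in> measurable N lborel" for f g and N :: "'z measure"
    using measurable_compose[OF measurable_Pair[OF that] measurable_add_dim[of i I "\<lambda>_. lborel"]] by simp
  \<comment> \<open>The integrand after the \<open>i\<close>-plane has been integrated out, to which
    the induction hypothesis is applied.\<close>
  define H where "H w w' = (\<integral>\<^sup>+u. \<integral>\<^sup>+v. F (w(i := u)) (w'(i := v)) \<partial>lborel \<partial>lborel)" for w w'
  have HM: "(\<lambda>p. H (fst p) (snd p)) \<in> borel_measurable (?P \<Otimes>\<^sub>M ?P)"
    unfolding H_def
    by (rule lborel.borel_measurable_nn_integral, unfold case_prod_beta', rule lborel.borel_measurable_nn_integral)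
     (simp add: case_prod_beta', intro FM upd; measurable)
  have "(\<integral>\<^sup>+x. \<integral>\<^sup>+y. F (rot c s (insert i I) x y) (rot c (- s) (insert i I) y x) \<partial>?Q \<partial>?Q) =
    (\<integral>\<^sup>+x. \<integral>\<^sup>+a. \<integral>\<^sup>+y. F (rot c s (insert i I) (x(i := a)) y) (rot c (- s) (insert i I) y (x(i := a))) \<partial>?Q \<partial>lborel \<partial>?P)"
    by (rule lborel_product.product_nn_integral_insert[OF fin iI], rule Q.borel_measurable_nn_integral)
      (simp add: case_prod_beta', intro FM measurable_rot; measurable)
  also have "\<dots> = (\<integral>\<^sup>+x. \<integral>\<^sup>+a. \<integral>\<^sup>+y. \<integral>\<^sup>+b. F (rot c s (insert i I) (x(i := a)) (y(i := b))) (rot c (- s) (insert i I) (y(i := b)) (x(i := a))) \<partial>lborel \<partial>?P \<partial>lborel \<partial>?P)"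
    by (rule nn_integral_cong, rule nn_integral_cong, rule lborel_product.product_nn_integral_insert[OF fin iI], intro FM measurable_rot)
      (auto intro!: measurable_const simp: space_PiM PiE_def extensional_def)
  also have "\<dots> = (\<integral>\<^sup>+x. \<integral>\<^sup>+a. \<integral>\<^sup>+y. \<integral>\<^sup>+b. F ((rot c s I x y)(i := c * a + s * b)) ((rot c (- s) I y x)(i := c * b - s * a)) \<partial>lborel \<partial>?P \<partial>lborel \<partial>?P)"
    by (simp add: rot_fun_upd[OF iI])
  also have "\<dots> = (\<integral>\<^sup>+x. \<integral>\<^sup>+y. \<integral>\<^sup>+a. \<integral>\<^sup>+b. F ((rot c s I x y)(i := c * a + s * b)) ((rot c (- s) I y x)(i := c * b - s * a)) \<partial>lborel \<partial>lborel \<partial>?P \<partial>?P)"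
    by (rule nn_integral_cong, rule PL.Fubini', unfold case_prod_beta', rule lborel.borel_measurable_nn_integral)
      (simp add: case_prod_beta', intro FM upd measurable_rot; measurable)
  also have "\<dots> = (\<integral>\<^sup>+x. \<integral>\<^sup>+y. H (rot c s I x y) (rot c (- s) I y x) \<partial>?P \<partial>?P)"
    unfolding H_def
  proof (rule nn_integral_cong, rule nn_integral_cong)
    fix x y assume xy: "x \<in> space ?P" "y \<in> space ?P"
    have "rot c s I x y \<in> space ?P" "rot c (-s) I y x \<in> space ?P" by (auto simp: rot_def space_PiM)
    then show "(\<integral>\<^sup>+a. \<integral>\<^sup>+b. F ((rot c s I x y)(i := c * a + s * b)) ((rot c (- s) I y x)(i := c * b - s * a)) \<partial>lborel \<partial>lborel) =
      (\<integral>\<^sup>+u. \<integral>\<^sup>+v. F ((rot c s I x y)(i := u)) ((rot c (- s) I y x)(i := v)) \<partial>lborel \<partial>lborel)"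
      by (intro nn_integral_rotate_plane[OF _ cs] FM upd measurable_const) measurable
  qed
  also have "\<dots> = (\<integral>\<^sup>+x. \<integral>\<^sup>+y. H x y \<partial>?P \<partial>?P)" by (rule insert.IH[OF HM])
  also have "\<dots> = (\<integral>\<^sup>+x. \<integral>\<^sup>+a. \<integral>\<^sup>+y. \<integral>\<^sup>+b. F (x(i := a)) (y(i := b)) \<partial>lborel \<partial>?P \<partial>lborel \<partial>?P)"
    unfolding H_def
    by (rule nn_integral_cong, rule LP.Fubini', unfold case_prod_beta', rule lborel.borel_measurable_nn_integral)
      (simp add: case_prod_beta', intro FM upd; measurable)
  also have "\<dots> = (\<integral>\<^sup>+x. \<integral>\<^sup>+a. \<integral>\<^sup>+y. F (x(i := a)) y \<partial>?Q \<partial>lborel \<partial>?P)"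
    by (rule nn_integral_cong, rule nn_integral_cong, rule lborel_product.product_nn_integral_insert[OF fin iI, symmetric], intro FM)
      (auto intro!: measurable_const simp: space_PiM PiE_def extensional_def)
  also have "\<dots> = (\<integral>\<^sup>+x. \<integral>\<^sup>+y. F x y \<partial>?Q \<partial>?Q)"
    by (rule lborel_product.product_nn_integral_insert[OF fin iI, symmetric], rule Q.borel_measurable_nn_integral)
      (simp add: case_prod_beta', intro FM; measurable)
  finally show ?case .
qed

text \<open>By the last hypothesis the joint density of the independent pair is rotation invariant,
  and so is Lebesgue measure. Hence the rotated pair has the same joint law, and integrating out its
  second member leaves the density of the first.\<close>

lemma (in prob_space) distributed_rot:
  fixes \<rho> :: "('i \<Rightarrow> real) \<Rightarrow> ennreal"
  assumes I: "finite I" and cs: "c\<^sup>2 + s\<^sup>2 = (1::real)"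
    and X: "distributed M (lborel_Pi I) X \<rho>" and Y: "distributed M (lborel_Pi I) Y \<rho>"
    and ind: "indep_var (lborel_Pi I) X (lborel_Pi I) Y"
    and \<rho>: "\<And>x y. \<rho> x * \<rho> y = \<rho> (rot c s I x y) * \<rho> (rot c (- s) I y x)"
  shows "distributed M (lborel_Pi I) (\<lambda>\<omega>. rot c s I (X \<omega>) (Y \<omega>)) \<rho>"
proof -
  let ?P = "lborel_Pi I"
  interpret P: sigma_finite_measure ?P by (rule lborel_product.sigma_finite[OF I])
  interpret PP: pair_sigma_finite ?P ?P ..
  have [measurable]: "\<rho> \<in> borel_measurable ?P" using X by (auto simp: distributed_def)
  have [measurable]: "X \<in> measurable M ?P" "Y \<in> measurable M ?P" using X Y by (auto simp: distributed_def)
  have J: "distributed M (?P \<Otimes>\<^sub>M ?P) (\<lambda>\<omega>. (X \<omega>, Y \<omega>)) (\<lambda>(x, y). \<rho> x * \<rho> y)"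
    by (rule distributed_joint_indep[OF P.sigma_finite_measure_axioms P.sigma_finite_measure_axioms X Y ind])
  have Z: "(\<lambda>\<omega>. rot c s I (X \<omega>) (Y \<omega>)) \<in> measurable M ?P" by (rule measurable_rot) measurable
  have one: "(\<integral>\<^sup>+y. \<rho> y \<partial>?P) = 1"
    using distributed_emeasure[OF X sets.top] emeasure_space_1 measurable_space[of X M ?P]
    by (simp add: Int_absorb1 subset_vimage_iff cong: nn_integral_cong)
  have "distr M ?P (\<lambda>\<omega>. rot c s I (X \<omega>) (Y \<omega>)) = density ?P \<rho>"
  proof (rule measure_eqI)
    fix A assume "A \<in> sets (distr M ?P (\<lambda>\<omega>. rot c s I (X \<omega>) (Y \<omega>)))"
    then have A[measurable]: "A \<in> sets ?P" by simp
    have m: "(\<lambda>p. indicator A (rot c s I (fst p) (snd p)) :: ennreal) \<in> borel_measurable (?P \<Otimes>\<^sub>M ?P)"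
      by (rule measurable_compose[OF measurable_rot]) measurable
    have "emeasure (distr M ?P (\<lambda>\<omega>. rot c s I (X \<omega>) (Y \<omega>))) A = (\<integral>\<^sup>+\<omega>. indicator A (rot c s I (X \<omega>) (Y \<omega>)) \<partial>M)"
      using Z by (simp add: nn_integral_indicator[symmetric] nn_integral_distr del: nn_integral_indicator)
    also have "\<dots> = (\<integral>\<^sup>+p. (case p of (x, y) \<Rightarrow> \<rho> x * \<rho> y) * indicator A (rot c s I (fst p) (snd p)) \<partial>(?P \<Otimes>\<^sub>M ?P))"
      using distributed_nn_integral[OF J m] by simp
    also have "\<dots> = (\<integral>\<^sup>+x. \<integral>\<^sup>+y. \<rho> x * \<rho> y * indicator A (rot c s I x y) \<partial>?P \<partial>?P)"
      using m by (subst P.nn_integral_fst[symmetric]) (auto simp: case_prod_beta')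
    also have "\<dots> = (\<integral>\<^sup>+x. \<integral>\<^sup>+y. \<rho> (rot c s I x y) * \<rho> (rot c (- s) I y x) * indicator A (rot c s I x y) \<partial>?P \<partial>?P)"
      by (subst \<rho>) (rule refl)
    also have "\<dots> = (\<integral>\<^sup>+x. \<integral>\<^sup>+y. \<rho> x * \<rho> y * indicator A x \<partial>?P \<partial>?P)"
      by (rule nn_integral_rotate_PiM[OF I _ cs, of "\<lambda>x y. \<rho> x * \<rho> y * indicator A x"]) measurable
    also have "\<dots> = (\<integral>\<^sup>+x. \<rho> x * indicator A x * (\<integral>\<^sup>+y. \<rho> y \<partial>?P) \<partial>?P)"
      by (subst nn_integral_cmult[symmetric]) (auto intro!: nn_integral_cong simp: mult_ac)
    also have "\<dots> = emeasure (density ?P \<rho>) A" by (simp add: one emeasure_density)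
    finally show "emeasure (distr M ?P (\<lambda>\<omega>. rot c s I (X \<omega>) (Y \<omega>))) A = emeasure (density ?P \<rho>) A" .
  qed simp
  then show ?thesis using Z by (simp add: distributed_def)
qed

section \<open>Iterated kernels as integrals over path space\<close>

text \<open>Integrating out the last increment turns the terminal function \<open>f\<close> into
  \<open>killed_step \<sigma> b f\<close>, hence the induction over arbitrary \<open>f\<close>.
  Increments are the natural coordinates for Brownian motion, which is given by the law of its
  increments.\<close>

lemma nn_integral_killed_increments:
  assumes "f \<in> borel_measurable borel"
  shows "(\<integral>\<^sup>+x. (\<Prod>i<k. ennreal (gauss \<sigma> (x i)) * indicator {..b} (\<Sum>j\<le>i. x j)) * f (\<Sum>j<k. x j)
    \<partial>lborel_Pi {..<k}) = (killed_step \<sigma> b ^^ k) f 0"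
  using assms
proof (induction k arbitrary: f)
  case 0
  then show ?case by (simp add: PiM_empty nn_integral_count_space_finite)
next
  case (Suc k)
  note [measurable] = Suc.prems
  let ?P = "lborel_Pi {..<k}"
  define p where "p x = (\<Prod>i<k. ennreal (gauss \<sigma> (x i)) * indicator {..b} (\<Sum>j\<le>i. x j))" for x
  have [measurable]: "p \<in> borel_measurable ?P" unfolding p_def by measurable
  have upd: "(\<Prod>i<Suc k. ennreal (gauss \<sigma> ((x(k := y)) i)) * indicator {..b} (\<Sum>j\<le>i. (x(k := y)) j)) * f (\<Sum>j<Suc k. (x(k := y)) j)
    = p x * (ennreal (gauss \<sigma> y) * (indicator {..b} ((\<Sum>j<k. x j) + y) * f ((\<Sum>j<k. x j) + y)))" for x y
  proof -
    have 1: "(\<Prod>i<k. ennreal (gauss \<sigma> ((x(k := y)) i)) * indicator {..b} (\<Sum>j\<le>i. (x(k := y)) j)) = p x"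
      unfolding p_def by (intro prod.cong refl arg_cong2[where f="(*)"] arg_cong[where f="indicator {..b}"] sum.cong) auto
    have 2: "(\<Sum>j<k. (x(k := y)) j) = (\<Sum>j<k. x j)" by (intro sum.cong) auto
    show ?thesis unfolding prod.lessThan_Suc 1 by (simp add: lessThan_Suc_atMost[symmetric] 2 mult.assoc)
  qed
  have "(\<integral>\<^sup>+x. (\<Prod>i<Suc k. ennreal (gauss \<sigma> (x i)) * indicator {..b} (\<Sum>j\<le>i. x j)) * f (\<Sum>j<Suc k. x j)
    \<partial>lborel_Pi {..<Suc k}) =
    (\<integral>\<^sup>+x. \<integral>\<^sup>+y. p x * (ennreal (gauss \<sigma> y) * (indicator {..b} ((\<Sum>j<k. x j) + y) * f ((\<Sum>j<k. x j) + y))) \<partial>lborel \<partial>?P)"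
    unfolding upd[symmetric] lessThan_Suc[of k] 
    by (rule lborel_product.product_nn_integral_insert) (auto simp flip: lessThan_Suc)
  also have "\<dots> = (\<integral>\<^sup>+x. p x * killed_step \<sigma> b f (\<Sum>j<k. x j) \<partial>?P)"
  proof (rule nn_integral_cong)
    fix x
    have "killed_step \<sigma> b f (\<Sum>j<k. x j) = (\<integral>\<^sup>+y. ennreal (gauss \<sigma> y) * (indicator {..b} ((\<Sum>j<k. x j) + y) * f ((\<Sum>j<k. x j) + y)) \<partial>lborel)"
      unfolding killed_step_def by (subst nn_integral_real_affine[of _ 1 "\<Sum>j<k. x j"]) auto
    then show "(\<integral>\<^sup>+y. p x * (ennreal (gauss \<sigma> y) * (indicator {..b} ((\<Sum>j<k. x j) + y) * f ((\<Sum>j<k. x j) + y))) \<partial>lborel) = p x * killed_step \<sigma> b f (\<Sum>j<k. x j)"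
      by (simp add: nn_integral_cmult)
  qed
  also have "\<dots> = (killed_step \<sigma> b ^^ k) (killed_step \<sigma> b f) 0"
    unfolding p_def by (rule Suc.IH) measurable
  finally show ?case by (simp only: funpow_Suc_right o_apply)
qed

abbreviation killed_steps :: "real \<Rightarrow> real \<Rightarrow> nat \<Rightarrow> (nat \<Rightarrow> real) \<Rightarrow> ennreal" where
  "killed_steps \<sigma> b k x \<equiv>
    (\<Prod>i<k. ennreal (gauss \<sigma> ((x(0 := 0)) (Suc i) - (x(0 := 0)) i)) * indicator {..b} (x (Suc i)))"

text \<open>The counterpart for bridges, whose law is given as a density of positions. The update
  \<open>x(0 := 0)\<close> supplies the starting point, which is not a coordinate of the product
  over \<open>{1..k}\<close>.\<close>

lemma nn_integral_killed_positions:
  assumes "f \<in> borel_measurable borel"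
  shows "(\<integral>\<^sup>+x. killed_steps \<sigma> b k x * f ((x(0 := 0)) k)
    \<partial>lborel_Pi {1..k}) = (killed_step \<sigma> b ^^ k) f 0"
  using assms
proof (induction k arbitrary: f)
  case 0
  then show ?case by (simp add: PiM_empty nn_integral_count_space_finite)
next
  case (Suc k)
  note [measurable] = Suc.prems
  let ?P = "lborel_Pi {1..k}"
  have comp: "(\<lambda>x. (x(0 := 0)) i) \<in> borel_measurable (lborel_Pi {1..k})" if "i \<le> k" for i k :: nat
    using that measurable_component_singleton[of i "{1..k}" "\<lambda>_. lborel :: real measure"] by (cases "i = 0") (auto simp: Suc_le_eq)
  have comp': "(\<lambda>x. x (Suc i)) \<in> borel_measurable (lborel_Pi {1..k})" if "i < k" for i k
    using that measurable_component_singleton[of "Suc i" "{1..k}" "\<lambda>_. lborel :: real measure"] by auto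
  define p where "p x = killed_steps \<sigma> b k x" for x
  have pm: "(\<lambda>x. killed_steps \<sigma> b m x) \<in> borel_measurable (lborel_Pi {1..m})" for m
  proof (intro borel_measurable_prod_ennreal borel_measurable_times_ennreal)
    fix i assume i: "i \<in> {..<m}"
    have [measurable]: "(\<lambda>x. (x(0 := 0)) (Suc i)) \<in> borel_measurable (lborel_Pi {1..m})"
      "(\<lambda>x. (x(0 := 0)) i) \<in> borel_measurable (lborel_Pi {1..m})"
      "(\<lambda>x. x (Suc i)) \<in> borel_measurable (lborel_Pi {1..m})"
      using i comp[of "Suc i" m] comp[of i m] comp'[of i m] by auto
    show "(\<lambda>x. ennreal (gauss \<sigma> ((x(0 := 0)) (Suc i) - (x(0 := 0)) i))) \<in> borel_measurable (lborel_Pi {1..m})"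
      by measurable
    show "(\<lambda>x. indicator {..b} (x (Suc i)) :: ennreal) \<in> borel_measurable (lborel_Pi {1..m})"
      by measurable
  qed
  have upd: "killed_steps \<sigma> b (Suc k) (x(Suc k := y)) * f (((x(Suc k := y))(0 := 0)) (Suc k))
    = p x * (ennreal (gauss \<sigma> (y - (x(0 := 0)) k)) * (indicator {..b} y * f y))" for x y
  proof -
    have 1: "killed_steps \<sigma> b k (x(Suc k := y)) = p x"
      unfolding p_def by (intro prod.cong refl) auto
    show ?thesis unfolding prod.lessThan_Suc 1 by (simp add: mult.assoc)
  qed
  have full_meas: "(\<lambda>x. killed_steps \<sigma> b (Suc k) x * f ((x(0 := 0)) (Suc k)))
    \<in> borel_measurable (lborel_Pi {1..Suc k})"
    by (intro borel_measurable_times_ennreal pm measurable_compose[OF comp[of "Suc k" "Suc k"]]) (simp_all add: Suc.prems)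
  have ins: "{1..Suc k} = insert (Suc k) {1..k}" by auto
  have "(\<integral>\<^sup>+x. killed_steps \<sigma> b (Suc k) x * f ((x(0 := 0)) (Suc k))
    \<partial>lborel_Pi {1..Suc k}) =
    (\<integral>\<^sup>+x. \<integral>\<^sup>+y. p x * (ennreal (gauss \<sigma> (y - (x(0 := 0)) k)) * (indicator {..b} y * f y)) \<partial>lborel \<partial>?P)"
    unfolding upd[symmetric] ins
    by (rule lborel_product.product_nn_integral_insert) (simp_all only: ins[symmetric] full_meas, simp_all)
  also have "\<dots> = (\<integral>\<^sup>+x. p x * killed_step \<sigma> b f ((x(0 := 0)) k) \<partial>?P)"
    by (rule nn_integral_cong) (simp add: nn_integral_cmult killed_step_def)
  also have "\<dots> = (killed_step \<sigma> b ^^ k) (killed_step \<sigma> b f) 0"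
    unfolding p_def by (rule Suc.IH) measurable
  finally show ?case by (simp only: funpow_Suc_right o_apply)
qed

lemma (in prob_space) distributed_PiM:
  assumes I: "finite I" "I \<noteq> {}" and ind: "indep_vars (\<lambda>_. borel) X I"
    and d: "\<And>i. i \<in> I \<Longrightarrow> distributed M lborel (X i) (f i)"
  shows "distributed M (lborel_Pi I) (\<lambda>\<omega>. \<lambda>i\<in>I. X i \<omega> :: real) (\<lambda>x. \<Prod>i\<in>I. f i (x i))"
proof -
  have f[measurable]: "f i \<in> borel_measurable borel" if "i \<in> I" for i using d[OF that] by (auto simp: distributed_def)
  have X[measurable]: "X i \<in> borel_measurable M" if "i \<in> I" for i using d[OF that] by (auto simp: distributed_def)
  \<comment> \<open>Outside \<open>I\<close> any probability measure will do; it makes the whole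
    family a product of probability spaces.\<close>
  define D where "D i = (if i \<in> I then density lborel (f i) else return borel 0)" for i
  have D: "D i = distr M borel (X i)" if "i \<in> I" for i
    using d[OF that] that by (simp add: D_def distributed_def cong: distr_cong)
  have "prob_space (D i)" for i
  proof (cases "i \<in> I")
    case True
    show ?thesis unfolding D[OF True] using X[OF True] by (rule prob_space_distr)
  next
    case False
    then show ?thesis by (auto simp: D_def intro: prob_space_return)
  qed
  then interpret D: prob_space "D i" for i .
  interpret PD: product_sigma_finite D ..
  have sD: "sets (D i) = sets borel" for i by (simp add: D_def)
  have sP: "sets (lborel_Pi I) = sets (PiM I D)" "sets (PiM I (\<lambda>_. borel :: real measure)) = sets (PiM I D)"
    by (intro sets_PiM_cong; simp add: sD)+
  have m: "(\<lambda>x. \<Prod>i\<in>I. f i (x i)) \<in> borel_measurable (lborel_Pi I)" by measurable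
  have Z: "(\<lambda>\<omega>. \<lambda>i\<in>I. X i \<omega>) \<in> measurable M (lborel_Pi I)" by measurable
  have "distr M (lborel_Pi I) (\<lambda>\<omega>. \<lambda>i\<in>I. X i \<omega>) = distr M (PiM I (\<lambda>_. borel)) (\<lambda>\<omega>. \<lambda>i\<in>I. X i \<omega>)"
    by (rule distr_cong) (simp_all add: sP)
  also have "\<dots> = PiM I (\<lambda>i. distr M borel (X i))"
    using indep_vars_iff_distr_eq_PiM'[of I X "\<lambda>_. borel"] I ind by simp
  also have "\<dots> = PiM I D" by (rule PiM_cong) (simp_all add: D)
  also have "\<dots> = density (lborel_Pi I) (\<lambda>x. \<Prod>i\<in>I. f i (x i))"
  proof (rule PD.PiM_eqI[OF I(1), symmetric])
    show "sets (density (lborel_Pi I) (\<lambda>x. \<Prod>i\<in>I. f i (x i))) = sets (PiM I D)" by (simp add: sP)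
    fix A assume A: "\<And>i. i \<in> I \<Longrightarrow> A i \<in> sets (D i)"
    then have [measurable]: "i \<in> I \<Longrightarrow> A i \<in> sets borel" for i by (simp add: sD)
    have AP[measurable]: "PiE I A \<in> sets (lborel_Pi I)" using I by (intro sets_PiM_I_finite) auto
    have "emeasure (density (lborel_Pi I) (\<lambda>x. \<Prod>i\<in>I. f i (x i))) (PiE I A) = (\<integral>\<^sup>+x. (\<Prod>i\<in>I. f i (x i)) * indicator (PiE I A) x \<partial>lborel_Pi I)"
      using m by (subst emeasure_density) auto
    also have "\<dots> = (\<integral>\<^sup>+x. (\<Prod>i\<in>I. f i (x i) * indicator (A i) (x i)) \<partial>lborel_Pi I)"
    proof (rule nn_integral_cong)
      fix x assume x: "x \<in> space (lborel_Pi I)"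
      have "indicator (PiE I A) x = (\<Prod>i\<in>I. indicator (A i) (x i) :: ennreal)"
        using x I by (auto simp: space_PiM indicator_def PiE_iff prod_zero_iff intro!: prod.neutral[symmetric])
      then show "(\<Prod>i\<in>I. f i (x i)) * indicator (PiE I A) x = (\<Prod>i\<in>I. f i (x i) * indicator (A i) (x i))"
        by (simp add: prod.distrib)
    qed
    also have "\<dots> = (\<Prod>i\<in>I. \<integral>\<^sup>+x. f i x * indicator (A i) x \<partial>lborel)"
      using I by (intro lborel_product.product_nn_integral_prod) auto
    also have "\<dots> = (\<Prod>i\<in>I. emeasure (D i) (A i))"
      by (intro prod.cong) (auto simp: D_def emeasure_density)
    finally show "emeasure (density (lborel_Pi I) (\<lambda>x. \<Prod>i\<in>I. f i (x i))) (PiE I A) = (\<Prod>i\<in>I. emeasure (D i) (A i))" .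
  qed
  finally show ?thesis using m Z by (simp add: distributed_def)
qed

lemma (in prob_space) indep_var_of_indep_vars:
  assumes "indep_vars M' X I" "i \<in> I" "j \<in> I" "i \<noteq> j"
  shows "indep_var (M' i) (X i) (M' j) (X j)"
proof -
  have "indep_var (PiM {i} M') (\<lambda>\<omega>. restrict (\<lambda>i. X i \<omega>) {i}) (PiM {j} M') (\<lambda>\<omega>. restrict (\<lambda>i. X i \<omega>) {j})"
    using assms by (intro indep_var_restrict) auto
  from indep_var_compose[OF this, of "\<lambda>f. f i" "M' i" "\<lambda>f. f j" "M' j"] show ?thesis
    by (simp add: o_def)
qed

lemma normal_density_rot:
  assumes "c\<^sup>2 + s\<^sup>2 = (1::real)"
  shows "gauss \<sigma> a * gauss \<sigma> b = gauss \<sigma> (c * a + s * b) * gauss \<sigma> (c * b + - s * a)"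
proof -
  have "(c * a + s * b)\<^sup>2 + (c * b + - s * a)\<^sup>2 = (c\<^sup>2 + s\<^sup>2) * (a\<^sup>2 + b\<^sup>2)" by (simp add: power2_eq_square algebra_simps)
  also have "\<dots> = a\<^sup>2 + b\<^sup>2" using assms by simp
  finally have "exp (- (a\<^sup>2 + b\<^sup>2) / (2 * \<sigma>\<^sup>2)) = exp (- ((c * a + s * b)\<^sup>2 + (c * b + - s * a)\<^sup>2) / (2 * \<sigma>\<^sup>2))" by simp
  then have "exp (- a\<^sup>2 / (2 * \<sigma>\<^sup>2)) * exp (- b\<^sup>2 / (2 * \<sigma>\<^sup>2)) = exp (- (c * a + s * b)\<^sup>2 / (2 * \<sigma>\<^sup>2)) * exp (- (c * b + - s * a)\<^sup>2 / (2 * \<sigma>\<^sup>2))"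
    by (simp add: exp_add[symmetric] diff_divide_distrib add_divide_distrib)
  then show ?thesis by (simp add: normal_density_def)
qed

section \<open>Projections of planar Brownian motions and bridges\<close>

definition increments :: "(real \<Rightarrow> 'a \<Rightarrow> real^2) \<Rightarrow> nat \<Rightarrow> 2 \<Rightarrow> 'a \<Rightarrow> nat \<Rightarrow> real" where
  "increments X N c \<omega> = (\<lambda>i\<in>{..<N}. X (real (Suc i) / N) \<omega> $ c - X (real i / N) \<omega> $ c)"

lemma planar_motion_increments:
  assumes "prob_space M" and X: "planar_brownian_motion M X" and N: "N > 0"
  shows "prob_space.indep_var M (lborel_Pi {..<N}) (increments X N 1) (lborel_Pi {..<N}) (increments X N 2)"
    and "distributed M (lborel_Pi {..<N}) (increments X N c) (\<lambda>x. \<Prod>i<N. ennreal (gauss (sqrt (1 / N)) (x i)))"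
proof -
  interpret prob_space M by fact
  define \<sigma> where "\<sigma> = sqrt (1 / N)"
  let ?P = "lborel_Pi {..<N}"
  have BM: "brownian_motion M (\<lambda>t \<omega>. X t \<omega> $ c)" for c using X by (simp add: planar_brownian_motion_def)
  have t01: "real (Suc i) / N \<in> {0..1}" "real i / N \<in> {0..1}" if "i < N" for i using that N by auto
  show "indep_var ?P (increments X N 1) ?P (increments X N 2)"
  proof -
    have "indep_vars (\<lambda>_. PiM {0..1} (\<lambda>_. borel)) (\<lambda>c \<omega>. \<lambda>t\<in>{0..1}. X t \<omega> $ c) UNIV"
      using X by (simp add: planar_brownian_motion_def indep_processes_def)
    from indep_var_of_indep_vars[OF this, of 1 2]
    have iv: "indep_var (PiM {0..1} (\<lambda>_. borel)) (\<lambda>\<omega>. \<lambda>t\<in>{0..1}. X t \<omega> $ 1) (PiM {0..1} (\<lambda>_. borel)) (\<lambda>\<omega>. \<lambda>t\<in>{0..1}. X t \<omega> $ 2)"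
      by simp
    define \<phi> :: "(real \<Rightarrow> real) \<Rightarrow> nat \<Rightarrow> real" where "\<phi> f = (\<lambda>i\<in>{..<N}. f (real (Suc i) / N) - f (real i / N))" for f
    have \<phi>: "\<phi> \<in> measurable (PiM {0..1} (\<lambda>_. borel)) ?P"
      unfolding \<phi>_def
    proof (rule measurable_restrict)
      fix i assume "i \<in> {..<N}"
      then have [measurable]: "(\<lambda>f. f (real (Suc i) / N)) \<in> borel_measurable (PiM {0..1} (\<lambda>_. borel :: real measure))"
        "(\<lambda>f. f (real i / N)) \<in> borel_measurable (PiM {0..1} (\<lambda>_. borel :: real measure))"
        using t01[of i] by (auto intro!: measurable_component_singleton)
      show "(\<lambda>f. f (real (Suc i) / N) - f (real i / N)) \<in> measurable (PiM {0..1} (\<lambda>_. borel :: real measure)) lborel" by measurable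
    qed
    have "\<phi> \<circ> (\<lambda>\<omega>. \<lambda>t\<in>{0..1}. X t \<omega> $ c) = increments X N c" for c
      using t01 by (auto simp: \<phi>_def increments_def fun_eq_iff restrict_def)
    then show ?thesis using indep_var_compose[OF iv \<phi> \<phi>] by simp
  qed
  show "distributed M ?P (increments X N c) (\<lambda>x. \<Prod>i<N. ennreal (gauss (sqrt (1 / N)) (x i)))"
    unfolding increments_def \<sigma>_def[symmetric]
  proof (rule distributed_PiM)
    show "indep_vars (\<lambda>_. borel) (\<lambda>i \<omega>. X (real (Suc i) / N) \<omega> $ c - X (real i / N) \<omega> $ c) {..<N}"
    proof -
      have "mono_on {..N} (\<lambda>i. real i / N) \<and> (\<lambda>i. real i / N) ` {..N} \<subseteq> {0..1}"
        using N by (auto simp: mono_on_def divide_right_mono)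
      then show ?thesis using BM[of c] unfolding brownian_motion_def by blast
    qed
    fix i assume i: "i \<in> {..<N}"
    have e: "real (Suc i) / N - real i / N = 1 / N" by (simp add: diff_divide_distrib[symmetric])
    have "0 \<le> real i / N \<and> real i / N < real (Suc i) / N \<and> real (Suc i) / N \<le> 1" using i N by (auto simp: divide_strict_right_mono)
    then show "distributed M lborel (\<lambda>\<omega>. X (real (Suc i) / N) \<omega> $ c - X (real i / N) \<omega> $ c) (\<lambda>x. ennreal (gauss \<sigma> x))"
      using BM[of c] unfolding brownian_motion_def \<sigma>_def e[symmetric] by blast
  qed (use N in auto)
qed

text \<open>Rotating the increment vectors of the two coordinates gives the increments of the
  projection, and their partial sums telescope. \<open>X 0\<close> is subtracted because it vanishes
  only almost surely, whereas the event is described pointwise.\<close>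

lemma planar_motion_grid:
  assumes "prob_space M" and X: "planar_brownian_motion M X" and N: "N > 0"
  shows "emeasure M {\<omega>\<in>space M. \<forall>i<N. (X (real (Suc i) / N) \<omega> - X 0 \<omega>) \<bullet> dir \<theta> \<le> b} =
    killed_motion (sqrt (1 / N)) b N"
proof -
  interpret prob_space M by fact
  define c s where "c = cos \<theta>" and "s = sin \<theta>"
  have cs: "c\<^sup>2 + s\<^sup>2 = 1" by (simp add: c_def s_def)
  define \<sigma> where "\<sigma> = sqrt (1 / N)"
  let ?P = "lborel_Pi {..<N}"
  define \<rho> where "\<rho> x = (\<Prod>i<N. ennreal (gauss \<sigma> (x i)))" for x
  have dist: "distributed M ?P (increments X N c) \<rho>" for c
    unfolding \<rho>_def[abs_def] \<sigma>_def by (rule planar_motion_increments[OF assms])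
  have \<rho>: "\<rho> x * \<rho> y = \<rho> (rot c s {..<N} x y) * \<rho> (rot c (- s) {..<N} y x)" for x y
    unfolding \<rho>_def prod.distrib[symmetric]
    by (intro prod.cong refl) (simp only: ennreal_mult'[OF normal_density_nonneg, symmetric] normal_density_rot[OF cs, of \<sigma> "x _"], simp add: rot_def)
  define Z where "Z \<omega> = rot c s {..<N} (increments X N 1 \<omega>) (increments X N 2 \<omega>)" for \<omega>
  have Z: "distributed M ?P Z \<rho>" unfolding Z_def
    by (rule distributed_rot[OF _ cs dist dist planar_motion_increments(1)[OF assms] \<rho>]) simp
  have ZX: "(\<Sum>j\<le>i. Z \<omega> j) = (X (real (Suc i) / N) \<omega> - X 0 \<omega>) \<bullet> dir \<theta>" if "i < N" for i \<omega>
  proof -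
    have "(\<Sum>j\<le>i. Z \<omega> j) = (\<Sum>j\<le>i. X (real (Suc j) / N) \<omega> \<bullet> dir \<theta> - X (real j / N) \<omega> \<bullet> dir \<theta>)"
      using that by (intro sum.cong) (auto simp: Z_def rot_def increments_def inner_dir c_def s_def algebra_simps)
    also have "\<dots> = X (real (Suc i) / N) \<omega> \<bullet> dir \<theta> - X 0 \<omega> \<bullet> dir \<theta>"
      by (induction i) auto
    finally show ?thesis by (simp add: inner_diff_left)
  qed
  define A where "A = {x\<in>space ?P. \<forall>i\<in>{..<N}. (\<Sum>j\<le>i. x j) \<le> b}"
  have A: "A \<in> sets ?P" unfolding A_def
  proof (rule sets.sets_Collect_finite_All'[OF _ finite_lessThan])
    show "{..<N} \<noteq> {}" using N by auto
    fix i assume "i \<in> {..<N}"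
    then have [measurable]: "(\<lambda>x. x j) \<in> borel_measurable ?P" if "j \<in> {..i}" for j
      using that measurable_component_singleton[of j "{..<N}" "\<lambda>_. lborel :: real measure"] by auto
    show "{x\<in>space ?P. (\<Sum>j\<le>i. x j) \<le> b} \<in> sets ?P" by measurable
  qed
  have "{\<omega>\<in>space M. \<forall>i<N. (X (real (Suc i) / N) \<omega> - X 0 \<omega>) \<bullet> dir \<theta> \<le> b} = Z -` A \<inter> space M"
    using measurable_space[OF distributed_measurable[OF Z]] by (auto simp: A_def ZX)
  also have "emeasure M \<dots> = (\<integral>\<^sup>+x. \<rho> x * indicator A x \<partial>?P)" by (rule distributed_emeasure[OF Z A])
  also have "\<dots> = (\<integral>\<^sup>+x. (\<Prod>i<N. ennreal (gauss \<sigma> (x i)) * indicator {..b} (\<Sum>j\<le>i. x j)) * 1 \<partial>?P)"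
  proof (rule nn_integral_cong)
    fix x assume x: "x \<in> space ?P"
    have "indicator A x = (\<Prod>i<N. indicator {..b} (\<Sum>j\<le>i. x j) :: ennreal)"
      using x by (auto simp: A_def indicator_def prod_zero_iff)
    then show "\<rho> x * indicator A x = (\<Prod>i<N. ennreal (gauss \<sigma> (x i)) * indicator {..b} (\<Sum>j\<le>i. x j)) * 1"
      by (simp add: \<rho>_def prod.distrib)
  qed
  also have "\<dots> = killed_motion \<sigma> b N" by (rule nn_integral_killed_increments) simp
  finally show ?thesis by (simp add: \<sigma>_def)
qed

text \<open>The bridge density is the product of all \<open>Suc k\<close> step densities with both
  ends pinned to 0, divided by \<open>gauss 1 0\<close>; the factor on the left clears this
  denominator. The last step, back to 0, becomes the terminal weight of the killed iterate.\<close>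

lemma planar_bridge_grid:
  assumes "prob_space M" and X: "planar_brownian_bridge M X"
  shows "ennreal (gauss 1 0) * emeasure M {\<omega>\<in>space M. \<forall>i\<in>{1..k}. X (real i / Suc k) \<omega> \<bullet> dir \<theta> \<le> b} =
    killed_bridge (sqrt (1 / Suc k)) b k"
proof -
  interpret prob_space M by fact
  define c s where "c = cos \<theta>" and "s = sin \<theta>"
  have cs: "c\<^sup>2 + s\<^sup>2 = 1" by (simp add: c_def s_def)
  define \<sigma> where "\<sigma> = sqrt (1 / Suc k)"
  let ?P = "lborel_Pi {1..k}"
  define pos where "pos c \<omega> = (\<lambda>i\<in>{1..k}. X (real i / Suc k) \<omega> $ c)" for c \<omega>
  define pin where "pin x = x(0 := 0, Suc k := 0)" for x :: "nat \<Rightarrow> real"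
  define d where "d x = (\<Prod>i<Suc k. gauss \<sigma> (pin x (Suc i) - pin x i))" for x
  define \<rho> where "\<rho> x = ennreal (d x / gauss 1 0)" for x
  have d0: "0 \<le> d x" for x by (simp add: d_def prod_nonneg)
  have BB: "brownian_bridge M (\<lambda>t \<omega>. X t \<omega> $ c)" for c using X by (simp add: planar_brownian_bridge_def)
  have t01: "real i / Suc k \<in> {0..1}" if "i \<in> {1..k}" for i using that by auto
  have ind: "indep_var ?P (pos 1) ?P (pos 2)"
  proof -
    have "indep_vars (\<lambda>_. PiM {0..1} (\<lambda>_. borel)) (\<lambda>c \<omega>. \<lambda>t\<in>{0..1}. X t \<omega> $ c) UNIV"
      using X by (simp add: planar_brownian_bridge_def indep_processes_def)
    from indep_var_of_indep_vars[OF this, of 1 2]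
    have iv: "indep_var (PiM {0..1} (\<lambda>_. borel)) (\<lambda>\<omega>. \<lambda>t\<in>{0..1}. X t \<omega> $ 1) (PiM {0..1} (\<lambda>_. borel)) (\<lambda>\<omega>. \<lambda>t\<in>{0..1}. X t \<omega> $ 2)"
      by simp
    define \<phi> :: "(real \<Rightarrow> real) \<Rightarrow> nat \<Rightarrow> real" where "\<phi> f = (\<lambda>i\<in>{1..k}. f (real i / Suc k))" for f
    have \<phi>: "\<phi> \<in> measurable (PiM {0..1} (\<lambda>_. borel)) ?P"
      unfolding \<phi>_def
    proof (rule measurable_restrict)
      fix i assume "i \<in> {1..k}"
      then show "(\<lambda>f. f (real i / Suc k)) \<in> measurable (PiM {0..1} (\<lambda>_. borel :: real measure)) lborel"
        using measurable_component_singleton[OF t01, of i "\<lambda>_. borel :: real measure"] by simp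
    qed
    have "\<phi> \<circ> (\<lambda>\<omega>. \<lambda>t\<in>{0..1}. X t \<omega> $ c) = pos c" for c
      using t01 by (auto simp: \<phi>_def pos_def fun_eq_iff restrict_def)
    then show ?thesis using indep_var_compose[OF iv \<phi> \<phi>] by simp
  qed
  have dist: "distributed M ?P (pos c) \<rho>" for c
  proof -
    have st: "real 0 / Suc k = 0 \<and> real (Suc k) / Suc k = 1 \<and> strict_mono_on {..Suc k} (\<lambda>i. real i / Suc k)"
    proof (intro conjI strict_mono_onI)
      fix i j :: nat assume "i < j"
      then show "real i / Suc k < real j / Suc k" by (intro divide_strict_right_mono) simp_all
    qed simp_all
    have e: "real (Suc i) / Suc k - real i / Suc k = 1 / Suc k" for i by (simp add: diff_divide_distrib[symmetric])
    have "\<forall>k \<tau>. \<tau> 0 = 0 \<and> \<tau> (Suc k) = 1 \<and> strict_mono_on {..Suc k} \<tau> \<longrightarrow>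
        distributed M (lborel_Pi {1..k}) (\<lambda>\<omega>. \<lambda>i\<in>{1..k}. X (\<tau> i) \<omega> $ c)
          (\<lambda>x. ennreal (brownian_density \<tau> (Suc k) (x(0 := 0, Suc k := 0)) / gauss 1 0))"
      using BB[of c] unfolding brownian_bridge_def by (elim conjE)
    from this[rule_format, of "\<lambda>i. real i / Suc k" k, OF st]
    have "distributed M ?P (pos c) (\<lambda>x. ennreal (brownian_density (\<lambda>i. real i / Suc k) (Suc k) (x(0 := 0, Suc k := 0)) / gauss 1 0))"
      unfolding pos_def .
    then show ?thesis unfolding \<rho>_def[abs_def] d_def brownian_density_def e \<sigma>_def pin_def .
  qed
  \<comment> \<open>The pinned values are 0, so pinning commutes with the linear map
    \<open>rot\<close>, and rotation invariance can be checked step by step.\<close>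
  have pin_rot: "pin (rot c s {1..k} x y) i = c * pin x i + s * pin y i" if "i \<le> Suc k" for i x y c s
    using that by (auto simp: pin_def rot_def)
  have dd: "d x * d y = d (rot c s {1..k} x y) * d (rot c (- s) {1..k} y x)" for x y
    unfolding d_def prod.distrib[symmetric]
  proof (intro prod.cong refl)
    fix i assume "i \<in> {..<Suc k}"
    then have i: "Suc i \<le> Suc k" "i \<le> Suc k" by auto
    show "gauss \<sigma> (pin x (Suc i) - pin x i) * gauss \<sigma> (pin y (Suc i) - pin y i) =
      gauss \<sigma> (pin (rot c s {1..k} x y) (Suc i) - pin (rot c s {1..k} x y) i) *
      gauss \<sigma> (pin (rot c (- s) {1..k} y x) (Suc i) - pin (rot c (- s) {1..k} y x) i)"
    proof -
      have "pin (rot c s {1..k} x y) (Suc i) - pin (rot c s {1..k} x y) i = c * (pin x (Suc i) - pin x i) + s * (pin y (Suc i) - pin y i)"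
        unfolding pin_rot[OF i(1)] pin_rot[OF i(2)] by (simp add: algebra_simps)
      moreover have "pin (rot c (- s) {1..k} y x) (Suc i) - pin (rot c (- s) {1..k} y x) i = c * (pin y (Suc i) - pin y i) + - s * (pin x (Suc i) - pin x i)"
        unfolding pin_rot[OF i(1)] pin_rot[OF i(2)] by (simp add: algebra_simps)
      ultimately show ?thesis
        using normal_density_rot[OF cs, of \<sigma> "pin x (Suc i) - pin x i" "pin y (Suc i) - pin y i"] by (simp only:)
    qed
  qed
  have \<rho>: "\<rho> x * \<rho> y = \<rho> (rot c s {1..k} x y) * \<rho> (rot c (- s) {1..k} y x)" for x y
  proof -
    have "\<rho> x * \<rho> y = ennreal (d x * d y / (gauss 1 0 * gauss 1 0))" for x y
      by (simp add: \<rho>_def ennreal_mult[symmetric] d0)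
    then show ?thesis by (simp only: dd[of x y])
  qed
  define Z where "Z \<omega> = rot c s {1..k} (pos 1 \<omega>) (pos 2 \<omega>)" for \<omega>
  have Z: "distributed M ?P Z \<rho>" unfolding Z_def
    by (rule distributed_rot[OF _ cs dist dist ind \<rho>]) simp
  have ZX: "Z \<omega> i = X (real i / Suc k) \<omega> \<bullet> dir \<theta>" if "i \<in> {1..k}" for i \<omega>
    using that by (auto simp: Z_def rot_def pos_def inner_dir c_def s_def)
  define A where "A = {x\<in>space ?P. \<forall>i<k. x (Suc i) \<le> b}"
  have A: "A \<in> sets ?P"
  proof -
    have [measurable]: "(\<lambda>x. x (Suc i)) \<in> borel_measurable ?P" if "i < k" for i
      using that measurable_component_singleton[of "Suc i" "{1..k}" "\<lambda>_. lborel :: real measure"] by auto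
    have "A = (\<Inter>i\<in>{..<k}. {x\<in>space ?P. x (Suc i) \<le> b}) \<inter> space ?P" by (auto simp: A_def)
    also have "\<dots> \<in> sets ?P"
    proof (cases "k = 0")
      case False
      then show ?thesis by (intro sets.Int sets.finite_INT) auto
    qed simp
    finally show ?thesis .
  qed
  have all: "(\<forall>i\<in>{1..k}. Q i) \<longleftrightarrow> (\<forall>i<k. Q (Suc i))" for Q
    by (auto simp: Suc_le_eq) (metis Suc_le_D Suc_le_lessD less_Suc_eq_le Suc_less_eq gr0_conv_Suc)
  have "{\<omega>\<in>space M. \<forall>i\<in>{1..k}. X (real i / Suc k) \<omega> \<bullet> dir \<theta> \<le> b} = {\<omega>\<in>space M. \<forall>i\<in>{1..k}. Z \<omega> i \<le> b}"
    by (auto simp: ZX)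
  also have "\<dots> = Z -` A \<inter> space M" unfolding all
    using measurable_space[OF distributed_measurable[OF Z]] by (auto simp: A_def)
  also have "emeasure M \<dots> = (\<integral>\<^sup>+x. \<rho> x * indicator A x \<partial>?P)" by (rule distributed_emeasure[OF Z A])
  finally have E: "emeasure M {\<omega>\<in>space M. \<forall>i\<in>{1..k}. X (real i / Suc k) \<omega> \<bullet> dir \<theta> \<le> b} = (\<integral>\<^sup>+x. \<rho> x * indicator A x \<partial>?P)" .
  have \<rho>m: "\<rho> \<in> borel_measurable ?P" using Z by (simp add: distributed_def)
  have "ennreal (gauss 1 0) * (\<integral>\<^sup>+x. \<rho> x * indicator A x \<partial>?P) = (\<integral>\<^sup>+x. ennreal (gauss 1 0) * (\<rho> x * indicator A x) \<partial>?P)"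
    using \<rho>m A by (intro nn_integral_cmult[symmetric]) auto
  also have "\<dots> = (\<integral>\<^sup>+x. killed_steps \<sigma> b k x * ennreal (gauss \<sigma> ((x(0 := 0)) k)) \<partial>?P)"
  proof (rule nn_integral_cong)
    fix x assume x: "x \<in> space ?P"
    have iA: "indicator A x = (\<Prod>i<k. indicator {..b} (x (Suc i)) :: ennreal)"
      using x by (auto simp: A_def indicator_def prod_zero_iff)
    have dx: "d x = (\<Prod>i<k. gauss \<sigma> ((x(0 := 0)) (Suc i) - (x(0 := 0)) i)) * gauss \<sigma> ((x(0 := 0)) k)"
    proof -
      have "(\<Prod>i<k. gauss \<sigma> (pin x (Suc i) - pin x i)) = (\<Prod>i<k. gauss \<sigma> ((x(0 := 0)) (Suc i) - (x(0 := 0)) i))"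
        by (intro prod.cong) (auto simp: pin_def)
      moreover have "pin x (Suc k) - pin x k = - (x(0 := 0)) k" by (simp add: pin_def)
      then have "gauss \<sigma> (pin x (Suc k) - pin x k) = gauss \<sigma> ((x(0 := 0)) k)"
        by (simp only:) (simp add: normal_density_def)
      ultimately show ?thesis by (simp add: d_def)
    qed
    have n0: "gauss 1 0 > 0" by (rule normal_density_pos) simp
    have "ennreal (gauss 1 0) * \<rho> x = ennreal (d x)"
      unfolding \<rho>_def using n0 d0[of x] by (subst ennreal_mult[symmetric]) (auto simp: less_imp_le)
    also have "\<dots> = (\<Prod>i<k. ennreal (gauss \<sigma> ((x(0 := 0)) (Suc i) - (x(0 := 0)) i))) * ennreal (gauss \<sigma> ((x(0 := 0)) k))"
      unfolding dx by (simp add: ennreal_mult prod_nonneg prod_ennreal del: fun_upd_apply)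
    finally show "ennreal (gauss 1 0) * (\<rho> x * indicator A x) = killed_steps \<sigma> b k x * ennreal (gauss \<sigma> ((x(0 := 0)) k))"
      unfolding prod.distrib iA by (simp only: mult.assoc[symmetric]) (simp only: mult_ac)
  qed
  also have "\<dots> = killed_bridge \<sigma> b k"
    by (rule nn_integral_killed_positions) measurable
  finally show ?thesis unfolding E by (simp add: \<sigma>_def)
qed

section \<open>From grids to the maximum over all dyadic times\<close>

text \<open>The dyadic grids are nested, so the events on them decrease to an event over a countable
  dense set of times.\<close>

definition unit_dyadics :: "real set" where
  "unit_dyadics = (\<Union>n. (\<lambda>i::nat. real i / 2 ^ n) ` {..2 ^ n})"

lemma countable_unit_dyadics: "countable unit_dyadics"
  unfolding unit_dyadics_def by auto

lemma unit_dyadics_subset: "unit_dyadics \<subseteq> {0..1}"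
proof
  fix t assume "t \<in> unit_dyadics"
  then obtain i n :: nat where i: "t = real i / 2 ^ n" "i \<le> 2 ^ n" by (auto simp: unit_dyadics_def)
  have "real i \<le> real (2 ^ n)" using i(2) by (simp only: of_nat_le_iff)
  then show "t \<in> {0..1}" using i(1) by simp
qed

lemma zero_in_unit_dyadics: "0 \<in> unit_dyadics"
proof -
  have "real 0 / 2 ^ 0 \<in> unit_dyadics" unfolding unit_dyadics_def by blast
  then show ?thesis by simp
qed

text \<open>Rounding \<open>t\<close> down to the grid of level \<open>n\<close> gives dyadic times
  that converge to \<open>t\<close>.\<close>

lemma unit_dyadics_closed_property:
  fixes f :: "real \<Rightarrow> 'b::topological_space"
  assumes "continuous_on {0..1} f" "closed C" "\<And>t. t \<in> unit_dyadics \<Longrightarrow> f t \<in> C" "t \<in> {0..1}"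
  shows "f t \<in> C"
proof -
  define a where "a n = real (nat \<lfloor>t * 2 ^ n\<rfloor>) / 2 ^ n" for n
  have t0: "0 \<le> t * 2 ^ n" "t * 2 ^ n \<le> 2 ^ n" for n using assms(4) by (auto simp: mult_left_le_one_le)
  have r: "real (nat \<lfloor>t * 2 ^ n\<rfloor>) = of_int \<lfloor>t * 2 ^ n\<rfloor>" for n using t0(1)[of n] by simp
  have an: "a n \<in> unit_dyadics" for n
  proof -
    have "real (nat \<lfloor>t * 2 ^ n\<rfloor>) \<le> 2 ^ n" using t0(2)[of n] of_int_floor_le[of "t * 2 ^ n"] unfolding r by linarith
    then have "real (nat \<lfloor>t * 2 ^ n\<rfloor>) \<le> real (2 ^ n)" by simp
    then have "nat \<lfloor>t * 2 ^ n\<rfloor> \<le> 2 ^ n" by (simp only: of_nat_le_iff)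
    then show ?thesis unfolding a_def unit_dyadics_def by blast
  qed
  have "a \<longlonglongrightarrow> t"
  proof (rule tendsto_sandwich)
    show "\<forall>\<^sub>F n in sequentially. t - (1/2) ^ n \<le> a n"
    proof (intro always_eventually allI)
      fix n
      have "t * 2 ^ n - 1 \<le> of_int \<lfloor>t * 2 ^ n\<rfloor>" by linarith
      then have "(t * 2 ^ n - 1) / 2 ^ n \<le> a n" unfolding a_def r by (intro divide_right_mono) auto
      then show "t - (1/2) ^ n \<le> a n" by (simp add: diff_divide_distrib power_divide)
    qed
    show "\<forall>\<^sub>F n in sequentially. a n \<le> t"
    proof (intro always_eventually allI)
      fix n
      have "a n \<le> (t * 2 ^ n) / 2 ^ n" unfolding a_def r by (intro divide_right_mono) auto
      then show "a n \<le> t" by simp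
    qed
    have "(\<lambda>n. t - (1/2::real) ^ n) \<longlonglongrightarrow> t - 0" by (intro tendsto_intros LIMSEQ_power_zero) auto
    then show "(\<lambda>n. t - (1/2::real) ^ n) \<longlonglongrightarrow> t" by simp
  qed simp
  moreover have "a n \<in> {0..1}" for n using an unit_dyadics_subset by blast
  ultimately have "(\<lambda>n. f (a n)) \<longlonglongrightarrow> f t"
    using assms(4) by (intro continuous_on_tendsto_compose[OF assms(1)] always_eventually allI)
  then show ?thesis using assms(2,3) an by (intro Lim_in_closed_set[OF assms(2) _ trivial_limit_sequentially]) auto
qed

definition planar_process :: "'a measure \<Rightarrow> (real \<Rightarrow> 'a \<Rightarrow> real^2) \<Rightarrow> bool" where
  "planar_process M X \<longleftrightarrow> (\<forall>c. continuous_process M (\<lambda>t \<omega>. X t \<omega> $ c)) \<and> (AE \<omega> in M. X 0 \<omega> = 0)"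

lemma planar_process_motion: "planar_brownian_motion M X \<Longrightarrow> planar_process M X"
  unfolding planar_process_def planar_brownian_motion_def brownian_motion_def
  by (auto simp: vec_eq_iff forall_2)

lemma planar_process_bridge: "planar_brownian_bridge M X \<Longrightarrow> planar_process M X"
  unfolding planar_process_def planar_brownian_bridge_def brownian_bridge_def
  by (auto simp: vec_eq_iff forall_2)

lemma planar_bridge_1: "planar_brownian_bridge M X \<Longrightarrow> AE \<omega> in M. X 1 \<omega> = 0"
  unfolding planar_brownian_bridge_def brownian_bridge_def
  by (auto simp: vec_eq_iff forall_2)

lemma planar_process_component_measurable:
  "planar_process M X \<Longrightarrow> t \<in> {0..1} \<Longrightarrow> (\<lambda>\<omega>. X t \<omega> $ c) \<in> borel_measurable M"
  by (simp add: planar_process_def continuous_process_def)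

lemma planar_process_inner_measurable:
  assumes "planar_process M X" "t \<in> {0..1}"
  shows "(\<lambda>\<omega>. X t \<omega> \<bullet> v) \<in> borel_measurable M"
  using planar_process_component_measurable[OF assms] unfolding inner_real2 by measurable

lemma planar_process_continuous:
  assumes "planar_process M X" "\<omega> \<in> space M"
  shows "continuous_on {0..1} (\<lambda>t. X t \<omega>)"
proof -
  have "continuous_on {0..1} (\<lambda>t. X t \<omega> $ c)" for c
    using assms by (simp add: planar_process_def continuous_process_def)
  then have "continuous_on {0..1} (\<lambda>t. \<chi> c. X t \<omega> $ c)" by (intro continuous_on_vec_lambda)
  then show ?thesis by simp
qed

lemma sets_Collect_Ball_countable:
  assumes "countable J" "\<And>j. j \<in> J \<Longrightarrow> {x\<in>space M. P j x} \<in> sets M"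
  shows "{x\<in>space M. \<forall>j\<in>J. P j x} \<in> sets M"
proof (cases "J = {}")
  case False
  then have "{x\<in>space M. \<forall>j\<in>J. P j x} = (\<Inter>j\<in>J. {x\<in>space M. P j x})" by auto
  also have "\<dots> \<in> sets M" using assms False by (intro sets.countable_INT') auto
  finally show ?thesis .
qed simp

lemma planar_process_event:
  assumes "planar_process M X" "countable J" "\<And>j. j \<in> J \<Longrightarrow> \<tau> j \<in> {0..1}"
  shows "{\<omega>\<in>space M. \<forall>j\<in>J. X (\<tau> j) \<omega> \<bullet> v \<le> b} \<in> sets M"
proof (rule sets_Collect_Ball_countable[OF assms(2)])
  fix j assume "j \<in> J"
  note [measurable] = planar_process_inner_measurable[OF assms(1) assms(3)[OF this]]
  show "{\<omega>\<in>space M. X (\<tau> j) \<omega> \<bullet> v \<le> b} \<in> sets M" by measurable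
qed

lemma unit_dyadics_cases:
  "(\<forall>t\<in>unit_dyadics. P t) \<longleftrightarrow> (\<forall>n. \<forall>i\<le>2 ^ n. P (real i / 2 ^ n))"
  by (auto simp: unit_dyadics_def)

text \<open>Continuity of the measure from above, along the decreasing grid events.\<close>

lemma emeasure_dyadic_limit:
  assumes "prob_space M" and X: "planar_process M X" and b: "b \<ge> 0"
    and lim: "(\<lambda>n. emeasure M {\<omega>\<in>space M. \<forall>i\<le>2 ^ n. X (real i / 2 ^ n) \<omega> \<bullet> v \<le> b}) \<longlonglongrightarrow> p"
  shows "emeasure M {\<omega>\<in>space M. \<forall>t\<in>unit_dyadics. X t \<omega> \<bullet> v \<le> b} = p"
proof -
  interpret prob_space M by fact
  define E where "E n = {\<omega>\<in>space M. \<forall>i\<le>2 ^ n. X (real i / 2 ^ n) \<omega> \<bullet> v \<le> b}" for n :: nat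
  have dy: "real i / 2 ^ n \<in> {0..1}" if "i \<le> 2 ^ n" for i n :: nat
    using that unit_dyadics_subset by (auto simp: unit_dyadics_def)
  have E: "E n \<in> sets M" for n
  proof -
    have "{\<omega>\<in>space M. \<forall>i\<in>{..2 ^ n}. X (real i / 2 ^ n) \<omega> \<bullet> v \<le> b} \<in> sets M"
      by (rule planar_process_event[OF X]) (simp_all only: countable_finite finite_atMost dy atMost_iff)
    then show ?thesis by (simp only: E_def Ball_def atMost_iff)
  qed
  have "decseq E"
  proof (rule decseq_SucI)
    fix n
    show "E (Suc n) \<subseteq> E n"
    proof
      fix \<omega> assume \<omega>: "\<omega> \<in> E (Suc n)"
      have "X (real i / 2 ^ n) \<omega> \<bullet> v \<le> b" if "i \<le> 2 ^ n" for i
      proof -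
        \<comment> \<open>Doubling the numerator embeds the grid of level \<open>n\<close> into the
          next one.\<close>
        have e: "real i / 2 ^ n = real (2 * i) / 2 ^ Suc n" by simp
        have "\<forall>j\<le>2 ^ Suc n. X (real j / 2 ^ Suc n) \<omega> \<bullet> v \<le> b" using \<omega> unfolding E_def mem_Collect_eq by (rule conjunct2)
        from spec[OF this, of "2 * i"] that show ?thesis unfolding e by (elim mp) simp
      qed
      then show "\<omega> \<in> E n" using \<omega> by (simp add: E_def)
    qed
  qed
  then have "(\<lambda>n. emeasure M (E n)) \<longlonglongrightarrow> emeasure M (\<Inter>n. E n)"
    using E by (intro Lim_emeasure_decseq) auto
  then have "emeasure M (\<Inter>n. E n) = p" using lim unfolding E_def by (rule LIMSEQ_unique)
  moreover have "(\<Inter>n. E n) = {\<omega>\<in>space M. \<forall>t\<in>unit_dyadics. X t \<omega> \<bullet> v \<le> b}"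
    unfolding unit_dyadics_cases E_def by auto
  ultimately show ?thesis by simp
qed

lemma emeasure_sup_motion:
  assumes M: "prob_space M" and X: "planar_brownian_motion M X" and b: "b \<ge> 0"
  shows "emeasure M {\<omega>\<in>space M. \<forall>t\<in>unit_dyadics. X t \<omega> \<bullet> dir \<theta> \<le> b} = ennreal (erf (b / sqrt 2))"
proof (rule emeasure_dyadic_limit[OF M planar_process_motion[OF X] b])
  interpret prob_space M by fact
  let ?E = "\<lambda>n::nat. emeasure M {\<omega>\<in>space M. \<forall>i\<le>2 ^ n. X (real i / 2 ^ n) \<omega> \<bullet> dir \<theta> \<le> b}"
  note PX = planar_process_motion[OF X]
  have AE0: "AE \<omega> in M. X 0 \<omega> = 0" using PX by (simp add: planar_process_def)
  have eq: "?E n =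
    killed_motion (sqrt (1 / real (2 ^ n))) b (2 ^ n)" for n :: nat
  proof -
    let ?A = "{\<omega>\<in>space M. \<forall>i\<in>{..2 ^ n}. X (real i / 2 ^ n) \<omega> \<bullet> dir \<theta> \<le> b}"
    let ?B = "{\<omega>\<in>space M. \<forall>i\<in>{..<2 ^ n}. (X (real (Suc i) / real (2 ^ n)) \<omega> - X 0 \<omega>) \<bullet> dir \<theta> \<le> b}"
    have dy: "real i / 2 ^ n \<in> {0..1}" if "i \<le> 2 ^ n" for i :: nat
      using that unit_dyadics_subset by (auto simp: unit_dyadics_def)
    have meas: "?A \<in> sets M"
      by (rule planar_process_event[OF PX]) (simp_all only: countable_finite finite_atMost dy atMost_iff)
    have meas': "?B \<in> sets M"
    proof (rule sets.sets_Collect_finite_All')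
      fix i :: nat assume i: "i \<in> {..<2 ^ n}"
      then have [measurable]: "(\<lambda>\<omega>. X (real (Suc i) / real (2 ^ n)) \<omega> \<bullet> dir \<theta>) \<in> borel_measurable M"
        using dy[of "Suc i"] by (intro planar_process_inner_measurable[OF PX]) auto
      have [measurable]: "(\<lambda>\<omega>. X 0 \<omega> \<bullet> dir \<theta>) \<in> borel_measurable M"
        by (intro planar_process_inner_measurable[OF PX]) auto
      show "{\<omega>\<in>space M. (X (real (Suc i) / real (2 ^ n)) \<omega> - X 0 \<omega>) \<bullet> dir \<theta> \<le> b} \<in> sets M"
        unfolding inner_diff_left by measurable
    qed (simp_all add: lessThan_empty_iff)
    have "emeasure M ?A =
      emeasure M ?B"
    proof (rule emeasure_eq_AE[OF _ meas meas'])
      show "AE \<omega> in M. \<omega> \<in> ?A \<longleftrightarrow>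
        \<omega> \<in> ?B"
        using AE0
      proof eventually_elim
        case (elim \<omega>)
        \<comment> \<open>Time 0 imposes no condition almost surely, as \<open>X 0\<close> vanishes
          and \<open>b\<close> is nonnegative; the other times are shifted to the index of the
          increment.\<close>
        have "(\<forall>i\<in>{..2 ^ n}. Q i) \<longleftrightarrow> (\<forall>i\<in>{..<2 ^ n :: nat}. Q (Suc i))" if "Q 0" for Q :: "nat \<Rightarrow> bool"
        proof safe
          fix i :: nat assume i: "\<forall>i\<in>{..<2 ^ n}. Q (Suc i)" "i \<le> 2 ^ n"
          then show "Q i" using that by (cases i) (auto simp: Suc_le_eq)
        qed auto
        from this[of "\<lambda>i. X (real i / 2 ^ n) \<omega> \<bullet> dir \<theta> \<le> b"] show ?case using elim b by simp
      qed
    qed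
    also have "\<dots> = killed_motion (sqrt (1 / real (2 ^ n))) b (2 ^ n)"
      using planar_motion_grid[OF M X, of "2 ^ n" \<theta> b] by (simp only: Ball_def lessThan_iff zero_less_power zero_less_numeral)
    finally show ?thesis by (simp add: Ball_def)
  qed
  have "strict_mono (\<lambda>n. 2 ^ n :: nat)" by (auto simp: strict_mono_def)
  from LIMSEQ_subseq_LIMSEQ[OF motion_killed_limit[OF b] this]
  show "(\<lambda>n. ?E n) \<longlonglongrightarrow> ennreal (erf (b / sqrt 2))"
    unfolding eq by (simp only: o_def)
qed

lemma emeasure_sup_bridge:
  assumes M: "prob_space M" and X: "planar_brownian_bridge M X" and b: "b \<ge> 0"
  shows "emeasure M {\<omega>\<in>space M. \<forall>t\<in>unit_dyadics. X t \<omega> \<bullet> dir \<theta> \<le> b} = ennreal (1 - exp (- 2 * b\<^sup>2))"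
proof (rule emeasure_dyadic_limit[OF M planar_process_bridge[OF X] b])
  interpret prob_space M by fact
  let ?E = "\<lambda>n::nat. emeasure M {\<omega>\<in>space M. \<forall>i\<le>2 ^ n. X (real i / 2 ^ n) \<omega> \<bullet> dir \<theta> \<le> b}"
  note PX = planar_process_bridge[OF X]
  have AE0: "AE \<omega> in M. X 0 \<omega> = 0 \<and> X 1 \<omega> = 0" using PX planar_bridge_1[OF X] by (auto simp: planar_process_def)
  define c where "c = gauss 1 0"
  have c: "c > 0" unfolding c_def by (rule normal_density_pos) simp
  have eq: "ennreal c * ?E n =
    killed_bridge (sqrt (1 / real (2 ^ n))) b (2 ^ n - 1)" for n :: nat
  proof -
    define k where "k = 2 ^ n - (1::nat)"
    have k: "2 ^ n = Suc k" by (simp add: k_def)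
    have k': "(2::real) ^ n = real (Suc k)" unfolding k[symmetric] by simp
    let ?A = "{\<omega>\<in>space M. \<forall>i\<in>{..Suc k}. X (real i / Suc k) \<omega> \<bullet> dir \<theta> \<le> b}"
    let ?B = "{\<omega>\<in>space M. \<forall>i\<in>{1..k}. X (real i / Suc k) \<omega> \<bullet> dir \<theta> \<le> b}"
    have dy: "real i / Suc k \<in> {0..1}" if "i \<le> Suc k" for i :: nat
      using that by auto
    have meas: "{\<omega>\<in>space M. \<forall>i\<in>I. X (real i / Suc k) \<omega> \<bullet> dir \<theta> \<le> b} \<in> sets M" if "I \<subseteq> {..Suc k}" for I
      using that by (intro planar_process_event[OF PX] dy countable_finite finite_subset[OF that]) auto
    have "emeasure M ?A =
      emeasure M ?B"
    proof (rule emeasure_eq_AE[OF _ meas meas])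
      show "AE \<omega> in M. \<omega> \<in> ?A \<longleftrightarrow>
        \<omega> \<in> ?B"
        using AE0
      proof eventually_elim
        case (elim \<omega>)
        \<comment> \<open>Almost surely both ends of the bridge are 0, which does not exceed
          \<open>b\<close>, so only the inner times matter.\<close>
        have "(\<forall>i\<in>{..Suc k}. Q i) \<longleftrightarrow> (\<forall>i\<in>{1..k}. Q i)" if "Q 0" "Q (Suc k)" for Q :: "nat \<Rightarrow> bool"
        proof -
          have "{..Suc k} = insert 0 (insert (Suc k) {1..k})" by auto
          then show ?thesis using that by simp
        qed
        from this[of "\<lambda>i. X (real i / Suc k) \<omega> \<bullet> dir \<theta> \<le> b"] show ?case using elim b by simp
      qed
    qed auto
    then show ?thesis
      using planar_bridge_grid[OF M X, of k \<theta> b] unfolding k k' c_def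
      by (simp add: Ball_def del: of_nat_Suc real_sqrt_divide)
  qed
  have "strict_mono (\<lambda>n. 2 ^ n :: nat)" by (auto simp: strict_mono_def)
  from LIMSEQ_subseq_LIMSEQ[OF bridge_killed_limit[OF b] this]
  have "(\<lambda>n. ennreal c * ?E n) \<longlonglongrightarrow> ennreal (c * (1 - exp (- 2 * b\<^sup>2)))"
    unfolding eq by (simp only: o_def c_def)
  \<comment> \<open>The normalization is removed inside the limit by multiplying with the reciprocal
    of \<open>c\<close>.\<close>
  then have "(\<lambda>n. ennreal (1 / c) * (ennreal c * ?E n)) \<longlonglongrightarrow>
    ennreal (1 / c) * ennreal (c * (1 - exp (- 2 * b\<^sup>2)))"
    by (intro ennreal_tendsto_cmult) auto
  moreover have "ennreal (1 / c) * (ennreal c * x) = x" for x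
  proof -
    have "ennreal (1 / c) * (ennreal c * x) = ennreal (1 / c * c) * x" using c by (subst ennreal_mult) (auto simp: mult.assoc)
    then show ?thesis using c by simp
  qed
  moreover have "ennreal (1 / c) * ennreal (c * (1 - exp (- 2 * b\<^sup>2))) = ennreal (1 - exp (- 2 * b\<^sup>2))"
    using c by (subst ennreal_mult'[symmetric]) auto
  ultimately show "(\<lambda>n. ?E n) \<longlonglongrightarrow> ennreal (1 - exp (- 2 * b\<^sup>2))"
    by simp
qed

section \<open>Convex hulls of random traces\<close>

text \<open>For fixed \<open>y j\<close> a single value of \<open>y i\<close> violates the claim,
  and points are Lebesgue null.\<close>

lemma AE_PiM_pair_not_collinear:
  fixes i j :: 'i and \<alpha> \<beta> :: real
  assumes "i \<noteq> j" "\<alpha> \<noteq> 0"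
  shows "AE y in lborel_Pi {i, j}. \<alpha> * y i \<noteq> \<beta> * y j"
proof -
  let ?P = "lborel_Pi {i, j}"
  have [measurable]: "(\<lambda>y. y i) \<in> borel_measurable ?P" "(\<lambda>y. y j) \<in> borel_measurable ?P"
    using measurable_component_singleton[of i "{i, j}" "\<lambda>_. lborel :: real measure"]
      measurable_component_singleton[of j "{i, j}" "\<lambda>_. lborel :: real measure"] by auto
  define A where "A = {y\<in>space ?P. \<alpha> * y i = \<beta> * y j}"
  have A[measurable]: "A \<in> sets ?P" unfolding A_def by measurable
  have "emeasure ?P A = (\<integral>\<^sup>+y. indicator A y \<partial>?P)" by simp
  also have "\<dots> = (\<integral>\<^sup>+y. \<integral>\<^sup>+z. indicator A (y(i := z)) \<partial>lborel \<partial>lborel_Pi {j})"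
    using assms(1) by (intro lborel_product.product_nn_integral_insert) auto
  also have "\<dots> = (\<integral>\<^sup>+y. 0 \<partial>lborel_Pi {j})"
  proof (rule nn_integral_cong)
    fix y
    have "(\<integral>\<^sup>+z. indicator A (y(i := z)) \<partial>lborel) \<le> (\<integral>\<^sup>+z. indicator {\<beta> * y j / \<alpha>} z \<partial>lborel)"
      using assms by (intro nn_integral_mono) (auto simp: A_def indicator_def field_simps)
    then show "(\<integral>\<^sup>+z. indicator A (y(i := z)) \<partial>lborel) = 0" by simp
  qed
  finally have "emeasure ?P A = 0" by simp
  then show ?thesis using A by (intro AE_I[of _ _ A]) (auto simp: A_def)
qed

text \<open>Twice the signed area of the triangle spanned by \<open>v\<close> and
  \<open>w\<close>.\<close>

definition cross :: "real^2 \<Rightarrow> real^2 \<Rightarrow> real" where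
  "cross v w = v$1 * w$2 - v$2 * w$1"

text \<open>The four increments over the two half intervals have a joint density, and the two planar
  increments are parallel only on a Lebesgue null set.\<close>

lemma motion_not_collinear:
  assumes "prob_space M" and X: "planar_brownian_motion M X"
  shows "AE \<omega> in M. cross (X (1/2) \<omega> - X 0 \<omega>) (X 1 \<omega> - X 0 \<omega>) \<noteq> 0"
proof -
  interpret prob_space M by fact
  let ?P = "lborel_Pi {..<2} :: (nat \<Rightarrow> real) measure"
  interpret P: sigma_finite_measure ?P by (rule lborel_product.sigma_finite) simp
  interpret PP: pair_sigma_finite ?P ?P ..
  define \<rho> :: "(nat \<Rightarrow> real) \<Rightarrow> ennreal" where "\<rho> x = (\<Prod>i<2. ennreal (gauss (sqrt (1 / real 2)) (x i)))" for x
  have d: "distributed M ?P (increments X 2 c) \<rho>" for c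
    unfolding \<rho>_def[abs_def] by (rule planar_motion_increments[OF assms]) simp
  have ind: "indep_var ?P (increments X 2 1) ?P (increments X 2 2)"
    by (rule planar_motion_increments[OF assms]) simp
  have J: "distributed M (?P \<Otimes>\<^sub>M ?P) (\<lambda>\<omega>. (increments X 2 1 \<omega>, increments X 2 2 \<omega>)) (\<lambda>(x, y). \<rho> x * \<rho> y)"
    by (rule distributed_joint_indep[OF P.sigma_finite_measure_axioms P.sigma_finite_measure_axioms d d ind])
  have P2: "{..<2} = {0, 1::nat}" "{..<2} = {1, 0::nat}" by auto
  have ae: "AE p in ?P \<Otimes>\<^sub>M ?P. fst p 0 * snd p 1 \<noteq> snd p 0 * fst p 1"
  proof (rule PP.AE_pair_measure)
    have [measurable]: "(\<lambda>x. x i) \<in> borel_measurable ?P" if "i < 2" for i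
      using that measurable_component_singleton[of i "{..<2}" "\<lambda>_. lborel :: real measure"] by auto
    show "{p\<in>space (?P \<Otimes>\<^sub>M ?P). fst p 0 * snd p 1 \<noteq> snd p 0 * fst p 1} \<in> sets (?P \<Otimes>\<^sub>M ?P)"
      by measurable
    \<comment> \<open>The instance with zero right-hand side says that \<open>x 0\<close> is almost
      surely nonzero; it then serves as the leading coefficient for \<open>y\<close>.\<close>
    have "AE x in ?P. 1 * x 0 \<noteq> 0 * x 1"
      unfolding P2(1) by (rule AE_PiM_pair_not_collinear) simp_all
    then show "AE x in ?P. AE y in ?P. fst (x, y) 0 * snd (x, y) 1 \<noteq> snd (x, y) 0 * fst (x, y) 1"
    proof eventually_elim
      case (elim x)
      then have "AE y in ?P. x 0 * y 1 \<noteq> x 1 * y 0"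
        unfolding P2(2) by (intro AE_PiM_pair_not_collinear) simp_all
      then show ?case by eventually_elim (simp add: mult.commute)
    qed
  qed
  have "AE p in distr M (?P \<Otimes>\<^sub>M ?P) (\<lambda>\<omega>. (increments X 2 1 \<omega>, increments X 2 2 \<omega>)). fst p 0 * snd p 1 \<noteq> snd p 0 * fst p 1"
    unfolding distributed_distr_eq_density[OF J]
    using J ae by (subst AE_density) (auto simp: distributed_def)
  from AE_distrD[OF distributed_measurable[OF J] this]
  have "AE \<omega> in M. increments X 2 1 \<omega> 0 * increments X 2 2 \<omega> 1 \<noteq> increments X 2 2 \<omega> 0 * increments X 2 1 \<omega> 1" by simp
  \<comment> \<open>The second vector is the sum of the two increments; its first summand drops out
    of the antisymmetric \<open>cross\<close>.\<close>
  then show ?thesis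
    by eventually_elim (auto simp: increments_def cross_def algebra_simps)
qed

text \<open>Both sides say that \<open>S\<close> lies in a line. The form with triples is a closed
  polynomial condition on the points, which passes to dense subsets and is measurable over countable
  ones.\<close>

lemma interior_convex_hull_empty_iff:
  fixes S :: "(real^2) set"
  shows "interior (convex hull S) = {} \<longleftrightarrow> (\<forall>p\<in>S. \<forall>q\<in>S. \<forall>r\<in>S. cross (q - p) (r - p) = 0)"
proof
  assume "interior (convex hull S) = {}"
  then obtain a b where a: "a \<noteq> 0" "convex hull S \<subseteq> {x. a \<bullet> x = b}"
    using empty_interior_subset_hyperplane[of "convex hull S"] convex_convex_hull by blast
  then have Sb: "a \<bullet> x = b" if "x \<in> S" for x using that hull_subset[of S convex] by blast
  show "\<forall>p\<in>S. \<forall>q\<in>S. \<forall>r\<in>S. cross (q - p) (r - p) = 0"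
  proof (intro ballI)
    fix p q r assume "p \<in> S" "q \<in> S" "r \<in> S"
    then have "a \<bullet> (q - p) = 0" "a \<bullet> (r - p) = 0" using Sb by (auto simp: inner_diff_right)
    moreover define v w where "v = q - p" and "w = r - p"
    ultimately have e: "a$1 * v$1 + a$2 * v$2 = 0" "a$1 * w$1 + a$2 * w$2 = 0" by (simp_all add: inner_real2)
    have "a$1 * cross v w = 0" "a$2 * cross v w = 0" using e unfolding cross_def by algebra+
    moreover have "a$1 \<noteq> 0 \<or> a$2 \<noteq> 0" using a(1) by (auto simp: vec_eq_iff forall_2)
    ultimately show "cross (q - p) (r - p) = 0" unfolding v_def[symmetric] w_def[symmetric] by auto
  qed
next
  assume c: "\<forall>p\<in>S. \<forall>q\<in>S. \<forall>r\<in>S. cross (q - p) (r - p) = 0"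
  have "\<exists>a b. a \<noteq> 0 \<and> S \<subseteq> {x. a \<bullet> x = b}"
  proof (cases "\<exists>p\<in>S. \<exists>q\<in>S. p \<noteq> q")
    case True
    then obtain p q where pq: "p \<in> S" "q \<in> S" "p \<noteq> q" by blast
    define a :: "real^2" where "a = vector [- (q - p)$2, (q - p)$1]"
    have "a \<noteq> 0" using pq(3) by (auto simp: a_def vec_eq_iff forall_2)
    moreover have "a \<bullet> r = a \<bullet> p" if "r \<in> S" for r
    proof -
      have "a \<bullet> (r - p) = cross (q - p) (r - p)" by (simp add: a_def inner_real2 cross_def algebra_simps)
      then show ?thesis using c pq that by (simp add: inner_diff_right)
    qed
    ultimately show ?thesis by blast
  next
    case False
    define a :: "real^2" where "a = vector [1, 0]"
    have "a \<noteq> 0" by (auto simp: a_def vec_eq_iff forall_2)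
    moreover obtain p where "S \<subseteq> {p}" using False by blast
    then have "S \<subseteq> {x. a \<bullet> x = a \<bullet> p}" by blast
    ultimately show ?thesis by blast
  qed
  then obtain a b where ab: "a \<noteq> 0" "S \<subseteq> {x. a \<bullet> x = b}" by blast
  have "convex hull S \<subseteq> {x. a \<bullet> x = b}" by (rule hull_minimal[OF ab(2)]) (rule convex_hyperplane)
  then have "interior (convex hull S) \<subseteq> interior {x. a \<bullet> x = b}" by (rule interior_mono)
  then show "interior (convex hull S) = {}" using ab(1) by simp
qed

section \<open>Widths, support functions and tail integrals\<close>

text \<open>With one point fixed, a bound on the difference is a closed half-plane condition on the
  other point and extends from \<open>D\<close> to \<open>K\<close>. The two points are treated one
  after the other; an infinite width of \<open>D\<close> is trivial.\<close>

lemma width_dense: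
  assumes "D \<subseteq> K" "K \<subseteq> closure (convex hull D)"
  shows "width K \<theta> = width D \<theta>"
proof (rule antisym)
  show "width D \<theta> \<le> width K \<theta>" unfolding width_def using assms(1)
    by (intro SUP_subset_mono order_refl)
  show "width K \<theta> \<le> width D \<theta>"
  proof (cases "width D \<theta>")
    case (real r)
    have D: "(a - b) \<bullet> dir \<theta> \<le> r" if "a \<in> D" "b \<in> D" for a b
    proof -
      have "ennreal ((a - b) \<bullet> dir \<theta>) \<le> ennreal r" unfolding real(2)[symmetric] width_def
        using that by (intro SUP_upper2[of a] SUP_upper2[of b]) auto
      then show ?thesis using real(1) by simp
    qed
    have ext: "K \<subseteq> C" if "closed C" "convex C" "D \<subseteq> C" for C
      using assms(2) closure_minimal[OF hull_minimal[of D C convex, OF that(3,2)] that(1)] by blast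
    have "(a - b) \<bullet> dir \<theta> \<le> r" if "a \<in> K" "b \<in> D" for a b
    proof -
      have eq: "{x. (x - b) \<bullet> dir \<theta> \<le> r} = {x. dir \<theta> \<bullet> x \<le> r + dir \<theta> \<bullet> b}"
        by (auto simp: inner_diff_left inner_commute[of "dir \<theta>"])
      have "K \<subseteq> {x. (x - b) \<bullet> dir \<theta> \<le> r}"
      proof (rule ext)
        show "D \<subseteq> {x. (x - b) \<bullet> dir \<theta> \<le> r}" using D that(2) by blast
      qed (unfold eq, rule closed_halfspace_le, rule convex_halfspace_le)
      then show ?thesis using that by blast
    qed
    then have KD: "(a - b) \<bullet> dir \<theta> \<le> r" if "a \<in> K" "b \<in> D" for a b using that by blast
    have "(a - b) \<bullet> dir \<theta> \<le> r" if "a \<in> K" "b \<in> K" for a b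
    proof -
      have eq: "{x. (a - x) \<bullet> dir \<theta> \<le> r} = {x. dir \<theta> \<bullet> x \<ge> dir \<theta> \<bullet> a - r}"
        by (auto simp: inner_diff_left inner_commute[of "dir \<theta>"])
      have "K \<subseteq> {x. (a - x) \<bullet> dir \<theta> \<le> r}"
      proof (rule ext)
        show "D \<subseteq> {x. (a - x) \<bullet> dir \<theta> \<le> r}" using KD that(1) by blast
      qed (unfold eq, rule closed_halfspace_ge, rule convex_halfspace_ge)
      then show ?thesis using that by blast
    qed
    then show ?thesis unfolding real(2) unfolding width_def by (intro SUP_least ennreal_leI)
  qed simp
qed

text \<open>The support function cut off at 0, hence the usual one for sets that contain the
  origin.\<close>

definition support :: "(real^2) set \<Rightarrow> real \<Rightarrow> ennreal" where
  "support D \<theta> = (SUP p\<in>D. ennreal (p \<bullet> dir \<theta>))"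

lemma dir_add_pi: "dir (\<theta> + pi) = - dir \<theta>"
  by (simp add: dir_def vec_eq_iff forall_2)

text \<open>A point with negative projection contributes 0 to the right-hand side, and on the left
  it may be replaced by the origin, which belongs to \<open>D\<close>.\<close>

lemma width_eq_support:
  assumes "0 \<in> D"
  shows "width D \<theta> = support D \<theta> + support D (\<theta> + pi)"
proof (rule antisym)
  have "ennreal ((p - q) \<bullet> dir \<theta>) \<le> support D \<theta> + support D (\<theta> + pi)" if "p \<in> D" "q \<in> D" for p q
  proof -
    have "ennreal ((p - q) \<bullet> dir \<theta>) \<le> ennreal (p \<bullet> dir \<theta>) + ennreal (q \<bullet> dir (\<theta> + pi))"
    proof -
      have "(p - q) \<bullet> dir \<theta> \<le> max 0 (p \<bullet> dir \<theta>) + max 0 (q \<bullet> dir (\<theta> + pi))"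
        by (simp add: dir_add_pi inner_diff_left)
      then have "ennreal ((p - q) \<bullet> dir \<theta>) \<le> ennreal (max 0 (p \<bullet> dir \<theta>) + max 0 (q \<bullet> dir (\<theta> + pi)))" by (rule ennreal_leI)
      also have "\<dots> = ennreal (max 0 (p \<bullet> dir \<theta>)) + ennreal (max 0 (q \<bullet> dir (\<theta> + pi)))" by (rule ennreal_plus) simp_all
      finally show ?thesis by (simp add: max_def ennreal_neg split: if_splits)
    qed
    also have "\<dots> \<le> support D \<theta> + support D (\<theta> + pi)"
      unfolding support_def using that by (intro add_mono SUP_upper) auto
    finally show ?thesis .
  qed
  then show "width D \<theta> \<le> support D \<theta> + support D (\<theta> + pi)" unfolding width_def by (intro SUP_least)
  have ne: "D \<noteq> {}" using assms by auto
  have "ennreal (p \<bullet> dir \<theta>) + ennreal (q \<bullet> dir (\<theta> + pi)) \<le> width D \<theta>" if pq: "p \<in> D" "q \<in> D" for p q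
  proof -
    have w: "ennreal ((p' - q') \<bullet> dir \<theta>) \<le> width D \<theta>" if "p' \<in> D" "q' \<in> D" for p' q'
      unfolding width_def using that by (intro SUP_upper2[of p'] SUP_upper2[of q']) auto
    consider "p \<bullet> dir \<theta> \<le> 0" | "q \<bullet> dir (\<theta> + pi) \<le> 0" | "p \<bullet> dir \<theta> \<ge> 0" "q \<bullet> dir (\<theta> + pi) \<ge> 0" by linarith
    then show ?thesis
    proof cases
      case 1 then show ?thesis using w[OF assms pq(2)] by (simp add: ennreal_neg dir_add_pi)
    next
      case 2 then show ?thesis using w[OF pq(1) assms] by (simp add: ennreal_neg)
    next
      case 3 then show ?thesis using w[OF pq] by (simp add: ennreal_plus[symmetric] dir_add_pi inner_diff_left del: ennreal_plus)
    qed
  qed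
  then show "support D \<theta> + support D (\<theta> + pi) \<le> width D \<theta>"
    unfolding support_def ennreal_SUP_add_left[OF ne, symmetric] ennreal_SUP_add_right[OF ne]
    by (intro SUP_least)
qed

text \<open>Layer-cake formula: a nonnegative value is the length of the interval below it, then
  Fubini.\<close>

lemma nn_integral_tail:
  assumes "sigma_finite_measure M" and [measurable]: "g \<in> borel_measurable M"
  shows "(\<integral>\<^sup>+\<omega>. g \<omega> \<partial>M) = (\<integral>\<^sup>+x. emeasure M {\<omega>\<in>space M. ennreal x < g \<omega>} * indicator {0..} x \<partial>lborel)"
proof -
  interpret sigma_finite_measure M by fact
  interpret pair_sigma_finite lborel M ..
  have a: "(\<integral>\<^sup>+x. indicator {x. 0 \<le> x \<and> ennreal x < a} x \<partial>lborel) = a" for a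
  proof (cases a)
    case (real r)
    then have "{x. 0 \<le> x \<and> ennreal x < a} = {0..<r}" by (auto simp: ennreal_less_iff)
    then show ?thesis using real by simp
  next
    case top
    then have e: "{x. 0 \<le> x \<and> ennreal x < a} = {0..}" by auto
    have "emeasure lborel {0::real..} = \<top>"
    proof (cases "emeasure lborel {0::real..}")
      case (real r)
      obtain n :: nat where n: "r < real n" using reals_Archimedean2 by blast
      have "ennreal (real n) = emeasure lborel {0..real n}" by simp
      also have "\<dots> \<le> emeasure lborel {0::real..}" by (rule emeasure_mono) auto
      finally show ?thesis using real n by simp
    qed
    then show ?thesis using top e by simp
  qed
  have "(\<integral>\<^sup>+\<omega>. g \<omega> \<partial>M) = (\<integral>\<^sup>+\<omega>. \<integral>\<^sup>+x. indicator {x. 0 \<le> x \<and> ennreal x < g \<omega>} x \<partial>lborel \<partial>M)"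
    unfolding a ..
  also have "\<dots> = (\<integral>\<^sup>+x. \<integral>\<^sup>+\<omega>. indicator {x. 0 \<le> x \<and> ennreal x < g \<omega>} x \<partial>M \<partial>lborel)"
    by (rule Fubini') measurable
  also have "\<dots> = (\<integral>\<^sup>+x. emeasure M {\<omega>\<in>space M. ennreal x < g \<omega>} * indicator {0..} x \<partial>lborel)"
  proof (rule nn_integral_cong)
    fix x
    have "(\<integral>\<^sup>+\<omega>. indicator {x. 0 \<le> x \<and> ennreal x < g \<omega>} x \<partial>M) = (\<integral>\<^sup>+\<omega>. indicator {\<omega>\<in>space M. ennreal x < g \<omega>} \<omega> * indicator {0..} x \<partial>M)"
      by (rule nn_integral_cong) (auto simp: indicator_def)
    also have "\<dots> = emeasure M {\<omega>\<in>space M. ennreal x < g \<omega>} * indicator {0..} x"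
      by (subst nn_integral_multc) auto
    finally show "(\<integral>\<^sup>+\<omega>. indicator {x. 0 \<le> x \<and> ennreal x < g \<omega>} x \<partial>M) = emeasure M {\<omega>\<in>space M. ennreal x < g \<omega>} * indicator {0..} x" .
  qed
  finally show ?thesis .
qed

section \<open>Law of the maximum\<close>

text \<open>Here the error function is the flow of one step of deviation 1, so the sign and the
  bound of flows apply.\<close>

lemma erf_bounds:
  assumes "x \<ge> 0"
  shows "0 \<le> erf (x / sqrt 2)" "erf (x / sqrt 2) \<le> 1"
proof -
  have e: "motion_flow 1 x 0 0 = erf (x / sqrt 2)" using assms by (intro motion_flow_eq_erf) auto
  show "0 \<le> erf (x / sqrt 2)" unfolding e[symmetric] using assms by (intro motion_flow_sgn) auto
  show "erf (x / sqrt 2) \<le> 1" unfolding e[symmetric] using motion_flow_bound[of 1 x 0 0] by simp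
qed

text \<open>The Gaussian tail above \<open>x\<close> is at most
  \<open>exp (- x\<^sup>2 / 2)\<close>, and it enters \<open>motion_flow\<close> twice. This
  provides the limit of the distribution function at infinity.\<close>

lemma erf_lower_bound:
  assumes "x \<ge> 0"
  shows "1 - 2 * exp (- x\<^sup>2 / 2) \<le> erf (x / sqrt 2)"
proof -
  define t where "t = (\<integral>\<^sup>+r. indicator {x<..} r * ennreal (walk_density 1 0 (r - 0)) \<partial>lborel)"
  define E where "E = exp (- x\<^sup>2 / (2 * 1\<^sup>2))"
  have sum: "walk_cdf 1 x 0 0 + t = 1" using walk_cdf_complement[of 1 x 0 0] by (simp only: t_def)
  have "t \<le> (\<integral>\<^sup>+r. ennreal E * ennreal (normal_density (0 + x) 1 r) \<partial>lborel)" unfolding t_def E_def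
  proof (rule nn_integral_mono)
    fix r :: real
    show "indicator {x<..} r * ennreal (walk_density 1 0 (r - 0)) \<le> ennreal (exp (- x\<^sup>2 / (2 * 1\<^sup>2))) * ennreal (normal_density (0 + x) 1 r)"
    proof (cases "r > x")
      case True
      have "gauss 1 (r - 0) \<le> exp (- x\<^sup>2 / (2 * 1\<^sup>2)) * normal_density (0 + x) 1 r"
        using True assms by (intro normal_density_tail_le) auto
      then show ?thesis using True by (subst ennreal_mult[symmetric]) (auto intro!: ennreal_leI)
    qed simp
  qed
  also have "\<dots> = ennreal E" using nn_integral_walk_density[of 1 0 "0 + x"]
    by (simp add: nn_integral_cmult normal_density_shift)
  finally have "1 \<le> walk_cdf 1 x 0 0 + ennreal E" unfolding sum[symmetric] by (intro add_left_mono)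
  also have "walk_cdf 1 x 0 0 = ennreal (enn2real (walk_cdf 1 x 0 0))" by (rule enn2real_walk_cdf(3)[symmetric]) simp
  finally have "ennreal 1 \<le> ennreal (enn2real (walk_cdf 1 x 0 0) + E)"
    by (simp add: ennreal_plus E_def)
  then have "1 \<le> enn2real (walk_cdf 1 x 0 0) + E"
    by (subst (asm) ennreal_le_iff) (auto simp: E_def)
  moreover have "motion_flow 1 x 0 0 = erf (x / sqrt 2)" using assms by (intro motion_flow_eq_erf) auto
  ultimately show ?thesis by (simp add: motion_flow_def E_def)
qed

lemma tendsto_erf_sqrt2: "((\<lambda>x. erf (x / sqrt 2)) \<longlongrightarrow> 1) at_top"
proof (rule tendsto_sandwich)
  show "\<forall>\<^sub>F x in at_top. 1 - 2 * exp (- x\<^sup>2 / 2) \<le> erf (x / sqrt 2)"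
    using eventually_ge_at_top[of 0] by eventually_elim (rule erf_lower_bound)
  show "\<forall>\<^sub>F x in at_top. erf (x / sqrt 2) \<le> 1"
    using eventually_ge_at_top[of 0] by eventually_elim (rule erf_bounds)
  show "((\<lambda>x::real. 1 - 2 * exp (- x\<^sup>2 / 2)) \<longlongrightarrow> 1) at_top" by real_asymp
qed simp

lemma borel_measurable_erf [measurable]: "erf \<in> borel_measurable borel"
proof (rule borel_measurable_continuous_onI, rule continuous_at_imp_continuous_on, rule ballI)
  show "isCont erf x" for x by (rule DERIV_isCont[OF erf_has_real_derivative])
qed

definition max_cdf :: "nat \<Rightarrow> nat \<Rightarrow> real \<Rightarrow> real" where
  "max_cdf m n x = erf (x / sqrt 2) ^ m * (1 - exp (- 2 * x\<^sup>2)) ^ n"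

definition motion_integrand :: "nat \<Rightarrow> nat \<Rightarrow> real \<Rightarrow> real" where
  "motion_integrand m n x = x * exp (- (x\<^sup>2 / 2)) * erf (x / sqrt 2) ^ (m - 1) * (1 - exp (- 2 * x\<^sup>2)) ^ n"

definition bridge_integrand :: "nat \<Rightarrow> nat \<Rightarrow> real \<Rightarrow> real" where
  "bridge_integrand m n x = x\<^sup>2 * exp (- 2 * x\<^sup>2) * erf (x / sqrt 2) ^ m * (1 - exp (- 2 * x\<^sup>2)) ^ (n - 1)"

definition max_density :: "nat \<Rightarrow> nat \<Rightarrow> real \<Rightarrow> real" where
  "max_density m n x =
    real m * (2 * gauss 1 x) * erf (x / sqrt 2) ^ (m - 1) * (1 - exp (- 2 * x\<^sup>2)) ^ n +
    real n * (4 * x * exp (- 2 * x\<^sup>2)) * erf (x / sqrt 2) ^ m * (1 - exp (- 2 * x\<^sup>2)) ^ (n - 1)"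

lemma borel_measurable_integrands [measurable]:
  "motion_integrand m n \<in> borel_measurable borel" "bridge_integrand m n \<in> borel_measurable borel"
  "max_density m n \<in> borel_measurable borel"
  unfolding motion_integrand_def[abs_def] bridge_integrand_def[abs_def] max_density_def[abs_def] by measurable

lemma bridge_cdf_bounds: "0 \<le> 1 - exp (- 2 * (x::real)\<^sup>2)" "1 - exp (- 2 * (x::real)\<^sup>2) \<le> 1"
  by auto

lemma max_density_nonneg:
  assumes "x \<ge> 0" shows "0 \<le> max_density m n x"
  unfolding max_density_def using assms erf_bounds(1)[OF assms] bridge_cdf_bounds(1)[of x]
  by (intro add_nonneg_nonneg mult_nonneg_nonneg zero_le_power) auto

lemma max_cdf_derivative:
  "(max_cdf m n has_real_derivative max_density m n x) (at x)"
proof -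
  have "((\<lambda>x. erf (x / sqrt 2) ^ m) has_real_derivative real m * (2 * gauss 1 x * erf (x / sqrt 2) ^ (m - Suc 0))) (at x)"
    by (rule DERIV_power[OF erf_sqrt2_has_real_derivative])
  moreover have "((\<lambda>x. (1 - exp (- 2 * x\<^sup>2)) ^ n) has_real_derivative real n * ((4 * x * exp (- 2 * x\<^sup>2)) * (1 - exp (- 2 * x\<^sup>2)) ^ (n - Suc 0))) (at x)"
    by (rule DERIV_power) (auto intro!: derivative_eq_intros)
  ultimately have "((\<lambda>x. erf (x / sqrt 2) ^ m * (1 - exp (- 2 * x\<^sup>2)) ^ n) has_real_derivative
    real m * (2 * gauss 1 x * erf (x / sqrt 2) ^ (m - Suc 0)) * (1 - exp (- 2 * x\<^sup>2)) ^ n +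
    real n * ((4 * x * exp (- 2 * x\<^sup>2)) * (1 - exp (- 2 * x\<^sup>2)) ^ (n - Suc 0)) * erf (x / sqrt 2) ^ m) (at x)"
    by (rule DERIV_mult)
  moreover have "real m * (2 * gauss 1 x * erf (x / sqrt 2) ^ (m - Suc 0)) * (1 - exp (- 2 * x\<^sup>2)) ^ n +
    real n * ((4 * x * exp (- 2 * x\<^sup>2)) * (1 - exp (- 2 * x\<^sup>2)) ^ (n - Suc 0)) * erf (x / sqrt 2) ^ m = max_density m n x"
    unfolding max_density_def One_nat_def by (simp only: mult_ac)
  ultimately show ?thesis unfolding max_cdf_def[abs_def] by simp
qed

lemma max_cdf_tendsto: "(max_cdf m n \<longlongrightarrow> 1) at_top"
proof -
  have "((\<lambda>x::real. 1 - exp (- 2 * x\<^sup>2)) \<longlongrightarrow> 1) at_top" by real_asymp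
  then have "((\<lambda>x. erf (x / sqrt 2) ^ m * (1 - exp (- 2 * x\<^sup>2)) ^ n) \<longlongrightarrow> 1 ^ m * 1 ^ n) at_top"
    by (intro tendsto_mult tendsto_power tendsto_erf_sqrt2)
  then show ?thesis by (simp add: max_cdf_def[abs_def])
qed

text \<open>Write \<open>1 - F x\<close> as the integral of the density over \<open>{x..}\<close>
  and exchange the integrals over the region where \<open>x\<close> lies between 0 and
  \<open>y\<close>. All terms are nonnegative, so no boundary term of an integration by parts has to
  be estimated.\<close>

lemma nn_integral_complement_max_cdf:
  "(\<integral>\<^sup>+x. ennreal (1 - max_cdf m n x) * indicator {0..} x \<partial>lborel) =
    (\<integral>\<^sup>+y. ennreal (y * max_density m n y) * indicator {0..} y \<partial>lborel)"
proof -
  have "(\<integral>\<^sup>+x. ennreal (1 - max_cdf m n x) * indicator {0..} x \<partial>lborel) =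
    (\<integral>\<^sup>+x. \<integral>\<^sup>+y. ennreal (max_density m n y) * indicator {0..y} x * indicator {0..} y \<partial>lborel \<partial>lborel)"
  proof (rule nn_integral_cong)
    fix x :: real
    show "ennreal (1 - max_cdf m n x) * indicator {0..} x = (\<integral>\<^sup>+y. ennreal (max_density m n y) * indicator {0..y} x * indicator {0..} y \<partial>lborel)"
    proof (cases "x \<ge> 0")
      case True
      have "(\<integral>\<^sup>+y. ennreal (max_density m n y) * indicator {x..} y \<partial>lborel) = ennreal (1 - max_cdf m n x)"
        using True max_density_nonneg by (intro nn_integral_FTC_atLeast max_cdf_derivative max_cdf_tendsto) auto
      moreover have "(\<integral>\<^sup>+y. ennreal (max_density m n y) * indicator {0..y} x * indicator {0..} y \<partial>lborel) = (\<integral>\<^sup>+y. ennreal (max_density m n y) * indicator {x..} y \<partial>lborel)"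
        using True by (intro nn_integral_cong) (auto simp: indicator_def)
      ultimately show ?thesis using True by simp
    qed simp
  qed
  also have "\<dots> = (\<integral>\<^sup>+y. \<integral>\<^sup>+x. ennreal (max_density m n y) * indicator {0..y} x * indicator {0..} y \<partial>lborel \<partial>lborel)"
  proof (rule lborel_pair.Fubini')
    have [measurable]: "{p::real \<times> real. 0 \<le> snd p \<and> snd p \<le> fst p} \<in> sets (borel \<Otimes>\<^sub>M borel)"
      "{p::real \<times> real. 0 \<le> fst p \<and> fst p \<le> snd p} \<in> sets (borel \<Otimes>\<^sub>M borel)"
    proof -
      have "{p \<in> space (borel \<Otimes>\<^sub>M borel). 0 \<le> snd p \<and> snd p \<le> fst p} \<in> sets (borel \<Otimes>\<^sub>M borel :: (real \<times> real) measure)"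
        "{p \<in> space (borel \<Otimes>\<^sub>M borel). 0 \<le> fst p \<and> fst p \<le> snd p} \<in> sets (borel \<Otimes>\<^sub>M borel :: (real \<times> real) measure)"
        by measurable
      then show "{p::real \<times> real. 0 \<le> snd p \<and> snd p \<le> fst p} \<in> sets (borel \<Otimes>\<^sub>M borel)"
        "{p::real \<times> real. 0 \<le> fst p \<and> fst p \<le> snd p} \<in> sets (borel \<Otimes>\<^sub>M borel)"
        by (simp_all add: space_pair_measure)
    qed
    \<comment> \<open>The variable interval is rewritten as a fixed set in the plane, whose
      measurability has just been shown.\<close>
    have e: "(\<lambda>(y, x). ennreal (max_density m n y) * indicator {0..y} x * indicator {0..} y) =
      (\<lambda>p. ennreal (max_density m n (fst p)) * indicator {p. 0 \<le> snd p \<and> snd p \<le> fst p} p * indicator {0..} (fst p))"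
      "(\<lambda>(x, y). ennreal (max_density m n y) * indicator {0..y} x * indicator {0..} y) =
      (\<lambda>p. ennreal (max_density m n (snd p)) * indicator {p. 0 \<le> fst p \<and> fst p \<le> snd p} p * indicator {0..} (snd p))"
      by (auto simp: fun_eq_iff indicator_def)
    show "(\<lambda>(y, x). ennreal (max_density m n y) * indicator {0..y} x * indicator {0..} y) \<in> borel_measurable (lborel \<Otimes>\<^sub>M lborel)"
      unfolding e by measurable
  qed
  also have "\<dots> = (\<integral>\<^sup>+y. ennreal (y * max_density m n y) * indicator {0..} y \<partial>lborel)"
  proof (rule nn_integral_cong)
    fix y :: real
    have "(\<integral>\<^sup>+x. ennreal (max_density m n y) * indicator {0..y} x * indicator {0..} y \<partial>lborel) = ennreal (max_density m n y) * indicator {0..} y * emeasure lborel {0..y}"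
      by (subst nn_integral_cmult_indicator[symmetric]) (auto intro!: nn_integral_cong simp: mult_ac)
    also have "\<dots> = ennreal (y * max_density m n y) * indicator {0..} y"
      using max_density_nonneg[of y m n] by (auto simp: indicator_def ennreal_mult mult.commute)
    finally show "(\<integral>\<^sup>+x. ennreal (max_density m n y) * indicator {0..y} x * indicator {0..} y \<partial>lborel) = ennreal (y * max_density m n y) * indicator {0..} y" .
  qed
  finally show ?thesis .
qed

lemma integrable_gaussian_moment: "integrable lborel (\<lambda>x::real. indicator {0..} x * (x * exp (- (x\<^sup>2 / 2))))"
proof (rule integrableI_bounded)
  have "(\<integral>\<^sup>+x. ennreal (x * exp (- (x\<^sup>2 / 2))) * indicator {0..} x \<partial>lborel) = ennreal (0 - (- exp (- (0\<^sup>2 / 2))))"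
  proof (rule nn_integral_FTC_atLeast)
    show "((\<lambda>x. - exp (- (x\<^sup>2 / 2))) has_real_derivative x * exp (- (x\<^sup>2 / 2))) (at x)" for x :: real
      by (auto intro!: derivative_eq_intros)
    show "((\<lambda>x::real. - exp (- (x\<^sup>2 / 2))) \<longlongrightarrow> 0) at_top" by real_asymp
  qed auto
  moreover have "(\<integral>\<^sup>+x. ennreal (norm (indicator {0..} x * (x * exp (- (x\<^sup>2 / 2))) :: real)) \<partial>lborel) = (\<integral>\<^sup>+x. ennreal (x * exp (- (x\<^sup>2 / 2))) * indicator {0..} x \<partial>lborel)"
    by (intro nn_integral_cong) (auto simp: indicator_def)
  ultimately show "(\<integral>\<^sup>+x. ennreal (norm (indicator {0..} x * (x * exp (- (x\<^sup>2 / 2))) :: real)) \<partial>lborel) < \<infinity>" by simp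
qed measurable

text \<open>One integrable majorant serves both integrands; the powers are powers of probabilities,
  hence at most 1.\<close>

lemma integrand_bounds:
  assumes "x \<ge> 0"
  shows "0 \<le> motion_integrand m n x" "motion_integrand m n x \<le> x * exp (- (x\<^sup>2 / 2))"
    "0 \<le> bridge_integrand m n x" "bridge_integrand m n x \<le> x * exp (- (x\<^sup>2 / 2))"
proof -
  have E: "0 \<le> erf (x / sqrt 2) ^ k" "erf (x / sqrt 2) ^ k \<le> 1" for k
    using erf_bounds[OF assms] by (auto intro: power_le_one)
  have B: "0 \<le> (1 - exp (- 2 * x\<^sup>2)) ^ k" "(1 - exp (- 2 * x\<^sup>2)) ^ k \<le> 1" for k
    by (rule zero_le_power[OF bridge_cdf_bounds(1)], rule power_le_one[OF bridge_cdf_bounds])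
  have EB: "0 \<le> erf (x / sqrt 2) ^ k * (1 - exp (- 2 * x\<^sup>2)) ^ l" "erf (x / sqrt 2) ^ k * (1 - exp (- 2 * x\<^sup>2)) ^ l \<le> 1" for k l
    by (rule mult_nonneg_nonneg[OF E(1) B(1)], rule mult_le_one[OF E(2) B])
  have mi: "motion_integrand m n x = (x * exp (- (x\<^sup>2 / 2))) * (erf (x / sqrt 2) ^ (m - 1) * (1 - exp (- 2 * x\<^sup>2)) ^ n)"
    by (simp only: motion_integrand_def mult.assoc)
  have bi: "bridge_integrand m n x = (x\<^sup>2 * exp (- 2 * x\<^sup>2)) * (erf (x / sqrt 2) ^ m * (1 - exp (- 2 * x\<^sup>2)) ^ (n - 1))"
    by (simp only: bridge_integrand_def mult.assoc)
  have x0: "0 \<le> x * exp (- (x\<^sup>2 / 2))" "0 \<le> x\<^sup>2 * exp (- 2 * x\<^sup>2)" using assms by auto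
  show "0 \<le> motion_integrand m n x" "0 \<le> bridge_integrand m n x"
    unfolding mi bi using x0 EB by (auto intro!: mult_nonneg_nonneg)
  show "motion_integrand m n x \<le> x * exp (- (x\<^sup>2 / 2))" unfolding mi using mult_left_mono[OF EB(2) x0(1)] by simp
  have "x \<le> exp (3 * x\<^sup>2 / 2)"
  proof -
    \<comment> \<open>The difference of \<open>1 + 3 * x\<^sup>2 / 2\<close> and \<open>x\<close> is
      \<open>3/2 * (x - 1/3)\<^sup>2 + 5/6\<close>. The exponent \<open>3/2\<close> is what
      separates \<open>exp (- 2 * x\<^sup>2)\<close> from
      \<open>exp (- x\<^sup>2 / 2)\<close>.\<close>
    have "(x - 1/3)\<^sup>2 = x\<^sup>2 - 2/3 * x + 1/9" by (simp add: power2_eq_square algebra_simps)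
    then have "x \<le> 1 + 3 * x\<^sup>2 / 2" using zero_le_power2[of "x - 1/3"] by linarith
    also have "\<dots> \<le> exp (3 * x\<^sup>2 / 2)" by (rule exp_ge_add_one_self)
    finally show ?thesis .
  qed
  then have "x * (x * exp (- 2 * x\<^sup>2)) \<le> x * (exp (3 * x\<^sup>2 / 2) * exp (- 2 * x\<^sup>2))" using assms by (intro mult_left_mono mult_right_mono) auto
  also have "exp (3 * x\<^sup>2 / 2) * exp (- 2 * x\<^sup>2) = exp (- (x\<^sup>2 / 2))" by (simp add: exp_add[symmetric])
  finally have "x\<^sup>2 * exp (- 2 * x\<^sup>2) \<le> x * exp (- (x\<^sup>2 / 2))" by (simp add: power2_eq_square mult.assoc)
  moreover have "bridge_integrand m n x \<le> x\<^sup>2 * exp (- 2 * x\<^sup>2)" unfolding bi using mult_left_mono[OF EB(2) x0(2)] by simp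
  ultimately show "bridge_integrand m n x \<le> x * exp (- (x\<^sup>2 / 2))" by linarith
qed

lemma set_integrable_integrands:
  "set_integrable lborel {0..} (motion_integrand m n)" "set_integrable lborel {0..} (bridge_integrand m n)"
proof -
  have "integrable lborel (\<lambda>x. indicator {0..} x * motion_integrand m n x)"
    using integrand_bounds
    by (intro Bochner_Integration.integrable_bound[OF integrable_gaussian_moment]) (auto simp: indicator_def)
  then show "set_integrable lborel {0..} (motion_integrand m n)" by (simp add: set_integrable_def)
  have "integrable lborel (\<lambda>x. indicator {0..} x * bridge_integrand m n x)"
    using integrand_bounds
    by (intro Bochner_Integration.integrable_bound[OF integrable_gaussian_moment]) (auto simp: indicator_def)
  then show "set_integrable lborel {0..} (bridge_integrand m n)" by (simp add: set_integrable_def)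
qed

text \<open>Origin of the constants in the theorem: \<open>2 * pi\<close> over the Gaussian
  normalization \<open>sqrt (2 * pi)\<close> is \<open>sqrt (2 * pi)\<close>, and
  \<open>2 * pi\<close> times the 4 from the derivative of \<open>1 - exp (- 2 * x\<^sup>2)\<close>
  is \<open>8 * pi\<close>.\<close>

lemma max_density_integrands:
  "2 * pi * (x * max_density m n x) = 2 * real m * sqrt (2 * pi) * motion_integrand m n x + 8 * real n * pi * bridge_integrand m n x"
proof -
  have nd: "gauss 1 x = exp (- (x\<^sup>2 / 2)) / sqrt (2 * pi)" by (simp add: normal_density_def)
  have "2 * pi / sqrt (2 * pi) = sqrt (2 * pi)" by (rule real_div_sqrt) simp
  moreover have "2 * pi * gauss 1 x = (2 * pi / sqrt (2 * pi)) * exp (- (x\<^sup>2 / 2))"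
    unfolding nd by (simp only: times_divide_eq_left times_divide_eq_right)
  ultimately have "2 * pi * gauss 1 x = sqrt (2 * pi) * exp (- (x\<^sup>2 / 2))" by (simp only:)
  then have 1: "2 * pi * (x * (real m * (2 * gauss 1 x) * E * B)) = 2 * real m * sqrt (2 * pi) * (x * exp (- (x\<^sup>2 / 2)) * E * B)" for E B
    by algebra
  have 2: "2 * pi * (x * (real n * (4 * x * e) * E * B)) = 8 * real n * pi * (x\<^sup>2 * e * E * B)" for e E B
    by (simp add: power2_eq_square)
  show ?thesis unfolding max_density_def motion_integrand_def bridge_integrand_def distrib_left 1 2 ..
qed

lemma nn_integral_max_cdf:
  "ennreal (2 * pi) * (\<integral>\<^sup>+x. ennreal (1 - max_cdf m n x) * indicator {0..} x \<partial>lborel) =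
    ennreal (2 * real m * sqrt (2 * pi) * (LBINT x:{0..}. motion_integrand m n x) + 8 * real n * pi * (LBINT x:{0..}. bridge_integrand m n x))"
proof -
  define h where "h x = 2 * real m * sqrt (2 * pi) * (indicator {0..} x * motion_integrand m n x) + 8 * real n * pi * (indicator {0..} x * bridge_integrand m n x)" for x :: real
  have i: "integrable lborel (\<lambda>x. indicator {0..} x * motion_integrand m n x)" "integrable lborel (\<lambda>x. indicator {0..} x * bridge_integrand m n x)"
    using set_integrable_integrands[of m n] by (simp_all add: set_integrable_def)
  then have hi: "integrable lborel h" unfolding h_def by (intro Bochner_Integration.integrable_add integrable_mult_right)
  have h0: "0 \<le> h x" for x unfolding h_def using integrand_bounds[of x m n]
    by (cases "x \<ge> 0") (auto simp: indicator_def)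
  have "ennreal (2 * pi) * (\<integral>\<^sup>+x. ennreal (1 - max_cdf m n x) * indicator {0..} x \<partial>lborel) =
    (\<integral>\<^sup>+x. ennreal (2 * pi) * (ennreal (x * max_density m n x) * indicator {0..} x) \<partial>lborel)"
    unfolding nn_integral_complement_max_cdf by (rule nn_integral_cmult[symmetric]) measurable
  also have "\<dots> = (\<integral>\<^sup>+x. ennreal (h x) \<partial>lborel)"
  proof (rule nn_integral_cong)
    fix x :: real
    show "ennreal (2 * pi) * (ennreal (x * max_density m n x) * indicator {0..} x) = ennreal (h x)"
    proof (cases "x \<ge> 0")
      case True
      then have "ennreal (2 * pi) * ennreal (x * max_density m n x) = ennreal (2 * pi * (x * max_density m n x))"
        by (subst ennreal_mult') auto
      then show ?thesis using True unfolding max_density_integrands h_def by simp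
    qed (simp add: h_def)
  qed
  also have "\<dots> = ennreal (\<integral>x. h x \<partial>lborel)" using hi h0 by (intro nn_integral_eq_integral) auto
  also have "(\<integral>x. h x \<partial>lborel) = 2 * real m * sqrt (2 * pi) * (LBINT x:{0..}. motion_integrand m n x) + 8 * real n * pi * (LBINT x:{0..}. bridge_integrand m n x)"
    unfolding h_def set_lebesgue_integral_def using i by (simp add: Bochner_Integration.integral_add)
  finally show ?thesis .
qed

section \<open>Expected perimeter of the hull of finitely many traces\<close>

definition traces :: "('p \<Rightarrow> real \<Rightarrow> 'a \<Rightarrow> real^2) \<Rightarrow> 'p set \<Rightarrow> real set \<Rightarrow> 'a \<Rightarrow> (real^2) set" where
  "traces X I T \<omega> = (\<lambda>(p, t). X p t \<omega>) ` (I \<times> T)"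

lemma traces_closed_property:
  assumes "\<And>p. p \<in> I \<Longrightarrow> continuous_on {0..1} (\<lambda>t. X p t \<omega>)" "closed C"
    and "\<And>x. x \<in> traces X I unit_dyadics \<omega> \<Longrightarrow> x \<in> C" and "x \<in> traces X I {0..1} \<omega>"
  shows "x \<in> C"
proof -
  obtain p t where pt: "p \<in> I" "t \<in> {0..1}" "x = X p t \<omega>" using assms(4) by (auto simp: traces_def)
  have "X p t \<omega> \<in> C" if "t \<in> unit_dyadics" for t
    by (rule assms(3)) (use pt(1) that in \<open>force simp: traces_def\<close>)
  then show ?thesis unfolding pt(3)
    by (rule unit_dyadics_closed_property[OF assms(1)[OF pt(1)] assms(2) _ pt(2)])
qed

lemma compact_traces:
  assumes "finite I" "\<And>p. p \<in> I \<Longrightarrow> continuous_on {0..1} (\<lambda>t. X p t \<omega>)"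
  shows "compact (traces X I {0..1} \<omega>)"
proof -
  have "traces X I {0..1} \<omega> = (\<Union>p\<in>I. (\<lambda>t. X p t \<omega>) ` {0..1})" by (force simp: traces_def)
  then show ?thesis using assms by (auto intro!: compact_UN compact_continuous_image)
qed

lemma traces_dyadics_subset: "traces X I unit_dyadics \<omega> \<subseteq> traces X I {0..1} \<omega>"
  unfolding traces_def using unit_dyadics_subset by (intro image_mono Sigma_mono) auto

lemma width_hull_traces:
  assumes "\<And>p. p \<in> I \<Longrightarrow> continuous_on {0..1} (\<lambda>t. X p t \<omega>)"
  shows "width (convex hull (traces X I {0..1} \<omega>)) \<theta> = width (traces X I unit_dyadics \<omega>) \<theta>"
proof (rule width_dense)
  let ?D = "traces X I unit_dyadics \<omega>"
  show "?D \<subseteq> convex hull (traces X I {0..1} \<omega>)"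
    using traces_dyadics_subset hull_subset by (rule subset_trans)
  have "traces X I {0..1} \<omega> \<subseteq> closure (convex hull ?D)"
  proof
    fix x assume x: "x \<in> traces X I {0..1} \<omega>"
    have "?D \<subseteq> closure (convex hull ?D)" using hull_subset closure_subset by (rule subset_trans)
    then show "x \<in> closure (convex hull ?D)"
      by (intro traces_closed_property[where X=X and I=I and \<omega>=\<omega>, OF _ closed_closure _ x] assms) auto
  qed
  then show "convex hull (traces X I {0..1} \<omega>) \<subseteq> closure (convex hull ?D)"
    by (intro hull_minimal convex_closure convex_convex_hull)
qed

text \<open>The vanishing of \<open>cross\<close> is a closed condition in each of the three points,
  so it passes from dyadic times to all times one point after the other.\<close>

lemma interior_hull_traces_empty_iff:
  assumes "\<And>p. p \<in> I \<Longrightarrow> continuous_on {0..1} (\<lambda>t. X p t \<omega>)"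
  shows "interior (convex hull (traces X I {0..1} \<omega>)) = {} \<longleftrightarrow>
    (\<forall>p\<in>traces X I unit_dyadics \<omega>. \<forall>q\<in>traces X I unit_dyadics \<omega>. \<forall>r\<in>traces X I unit_dyadics \<omega>. cross (q - p) (r - p) = 0)"
  unfolding interior_convex_hull_empty_iff
proof
  let ?D = "traces X I unit_dyadics \<omega>" and ?S = "traces X I {0..1} \<omega>"
  have cp: "x \<in> C" if "closed C" "\<And>x. x \<in> ?D \<Longrightarrow> x \<in> C" "x \<in> ?S" for x C
    by (rule traces_closed_property[where X=X and I=I and \<omega>=\<omega>, OF _ that]) (rule assms)
  show "\<forall>p\<in>?D. \<forall>q\<in>?D. \<forall>r\<in>?D. cross (q - p) (r - p) = 0" if "\<forall>p\<in>?S. \<forall>q\<in>?S. \<forall>r\<in>?S. cross (q - p) (r - p) = 0"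
  proof (intro ballI)
    fix p q r assume "p \<in> ?D" "q \<in> ?D" "r \<in> ?D"
    then have "p \<in> ?S" "q \<in> ?S" "r \<in> ?S" by (auto intro: subsetD[OF traces_dyadics_subset])
    then show "cross (q - p) (r - p) = 0" using that by simp
  qed
  assume D: "\<forall>p\<in>?D. \<forall>q\<in>?D. \<forall>r\<in>?D. cross (q - p) (r - p) = 0"
  have 1: "cross (q - p) (r - p) = 0" if "p \<in> ?D" "q \<in> ?D" "r \<in> ?S" for p q r
  proof -
    have "closed {r. cross (q - p) (r - p) = 0}" unfolding cross_def
      by (intro closed_Collect_eq continuous_intros)
    then have "r \<in> {r. cross (q - p) (r - p) = 0}" by (rule cp[OF _ _ that(3)]) (use D that in simp)
    then show ?thesis by simp
  qed
  have 2: "cross (q - p) (r - p) = 0" if "p \<in> ?D" "q \<in> ?S" "r \<in> ?S" for p q r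
  proof -
    have "closed {q. cross (q - p) (r - p) = 0}" unfolding cross_def
      by (intro closed_Collect_eq continuous_intros)
    then have "q \<in> {q. cross (q - p) (r - p) = 0}" by (rule cp[OF _ _ that(2)]) (use 1 that in simp)
    then show ?thesis by simp
  qed
  have "cross (q - p) (r - p) = 0" if "p \<in> ?S" "q \<in> ?S" "r \<in> ?S" for p q r
  proof -
    have "closed {p. cross (q - p) (r - p) = 0}" unfolding cross_def
      by (intro closed_Collect_eq continuous_intros)
    then have "p \<in> {p. cross (q - p) (r - p) = 0}" by (rule cp[OF _ _ that(1)]) (use 2 that in simp)
    then show ?thesis by simp
  qed
  then show "\<forall>p\<in>?S. \<forall>q\<in>?S. \<forall>r\<in>?S. cross (q - p) (r - p) = 0" by simp
qed

lemma support_traces: "support (traces X I T \<omega>) \<theta> = (SUP a\<in>I \<times> T. ennreal (X (fst a) (snd a) \<omega> \<bullet> dir \<theta>))"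
  unfolding support_def traces_def image_image by (simp add: case_prod_beta')

lemma width_traces: "width (traces X I T \<omega>) \<theta> =
    (SUP a\<in>I \<times> T. SUP b\<in>I \<times> T. ennreal ((X (fst a) (snd a) \<omega> - X (fst b) (snd b) \<omega>) \<bullet> dir \<theta>))"
  unfolding width_def traces_def image_image by (simp add: case_prod_beta')

context prob_space
begin

text \<open>The supremum over all processes is at most \<open>x\<close> iff each trajectory stays
  below \<open>x\<close>; these events are independent, so the distribution function is the product
  of the \<open>G p\<close>.\<close>

lemma expectation_support_traces:
  fixes X :: "'p \<Rightarrow> real \<Rightarrow> 'a \<Rightarrow> real^2"
  assumes I: "finite I" "I \<noteq> {}" and X: "\<And>p. p \<in> I \<Longrightarrow> planar_process M (X p)"
    and ind: "indep_processes M X I"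
    and law: "\<And>p x. p \<in> I \<Longrightarrow> x \<ge> 0 \<Longrightarrow>
      emeasure M {\<omega>\<in>space M. \<forall>t\<in>unit_dyadics. X p t \<omega> \<bullet> dir \<theta> \<le> x} = ennreal (G p x)"
    and G: "\<And>p x. p \<in> I \<Longrightarrow> x \<ge> 0 \<Longrightarrow> 0 \<le> G p x"
  shows "(\<integral>\<^sup>+\<omega>. support (traces X I unit_dyadics \<omega>) \<theta> \<partial>M) =
    (\<integral>\<^sup>+x. ennreal (1 - (\<Prod>p\<in>I. G p x)) * indicator {0..} x \<partial>lborel)"
proof -
  let ?A = "\<lambda>\<omega>. support (traces X I unit_dyadics \<omega>) \<theta>"
  have cJ: "countable (I \<times> unit_dyadics)" by (intro countable_SIGMA countable_finite[OF I(1)] countable_unit_dyadics)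
  have m: "(\<lambda>\<omega>. X p t \<omega> \<bullet> dir \<theta>) \<in> borel_measurable M" if "p \<in> I" "t \<in> unit_dyadics" for p t
    using that unit_dyadics_subset by (intro planar_process_inner_measurable[OF X]) auto
  have A[measurable]: "?A \<in> borel_measurable M" unfolding support_traces
    using cJ m by (intro borel_measurable_SUP) auto
  have "emeasure M {\<omega>\<in>space M. ennreal x < ?A \<omega>} = ennreal (1 - (\<Prod>p\<in>I. G p x))" if x: "x \<ge> 0" for x
  proof -
    \<comment> \<open>Independence is assumed for whole trajectories, so the condition is phrased as
      an event of the trajectory space; it involves only countably many times.\<close>
    define C where "C = {f\<in>space (PiM {0..1} (\<lambda>_. borel :: (real^2) measure)). \<forall>t\<in>unit_dyadics. f t \<bullet> dir \<theta> \<le> x}"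
    have C: "C \<in> sets (PiM {0..1} (\<lambda>_. borel :: (real^2) measure))" unfolding C_def
    proof (rule sets_Collect_Ball_countable[OF countable_unit_dyadics])
      fix t assume "t \<in> unit_dyadics"
      then have [measurable]: "(\<lambda>f. f t) \<in> borel_measurable (PiM {0..1} (\<lambda>_. borel :: (real^2) measure))"
        using unit_dyadics_subset by (intro measurable_component_singleton) auto
      show "{f\<in>space (PiM {0..1} (\<lambda>_. borel :: (real^2) measure)). f t \<bullet> dir \<theta> \<le> x} \<in> sets (PiM {0..1} (\<lambda>_. borel))" by measurable
    qed
    have iv: "indep_vars (\<lambda>_. PiM {0..1} (\<lambda>_. borel)) (\<lambda>p \<omega>. \<lambda>t\<in>{0..1}. X p t \<omega>) I"
      using ind by (simp add: indep_processes_def)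
    have pre: "(\<lambda>\<omega>. \<lambda>t\<in>{0..1}. X p t \<omega>) -` C \<inter> space M = {\<omega>\<in>space M. \<forall>t\<in>unit_dyadics. X p t \<omega> \<bullet> dir \<theta> \<le> x}" for p
      using unit_dyadics_subset by (auto simp: C_def space_PiM)
    have "{\<omega>\<in>space M. ?A \<omega> \<le> ennreal x} = (\<Inter>p\<in>I. (\<lambda>\<omega>. \<lambda>t\<in>{0..1}. X p t \<omega>) -` C \<inter> space M)"
      unfolding pre support_traces using I x by (auto simp: SUP_le_iff)
    then have "prob {\<omega>\<in>space M. ?A \<omega> \<le> ennreal x} = (\<Prod>p\<in>I. prob ((\<lambda>\<omega>. \<lambda>t\<in>{0..1}. X p t \<omega>) -` C \<inter> space M))"
      using indep_varsD[OF iv I(2,1) subset_refl C] by simp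
    also have "\<dots> = (\<Prod>p\<in>I. G p x)"
    proof (rule prod.cong)
      fix p assume p: "p \<in> I"
      show "prob ((\<lambda>\<omega>. \<lambda>t\<in>{0..1}. X p t \<omega>) -` C \<inter> space M) = G p x"
        unfolding pre measure_def law[OF p x] using G[OF p x] by simp
    qed simp
    finally have P: "prob {\<omega>\<in>space M. ?A \<omega> \<le> ennreal x} = (\<Prod>p\<in>I. G p x)" .
    have "{\<omega>\<in>space M. ennreal x < ?A \<omega>} = space M - {\<omega>\<in>space M. ?A \<omega> \<le> ennreal x}" by auto
    moreover have "{\<omega>\<in>space M. ?A \<omega> \<le> ennreal x} \<in> events" by measurable
    ultimately have "prob {\<omega>\<in>space M. ennreal x < ?A \<omega>} = 1 - (\<Prod>p\<in>I. G p x)"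
      using prob_compl P by simp
    then show ?thesis by (simp add: emeasure_eq_measure)
  qed
  then show ?thesis unfolding nn_integral_tail[OF sigma_finite_measure_axioms A]
    by (intro nn_integral_cong) (auto simp: indicator_def)
qed

text \<open>
  On the null event that the hull has no interior, its perimeter is the junk value \<open>THE l. False\<close>.
  \<open>M\<close> need not be complete, so measurability requires that this value is constant on that event.
\<close>
lemma expected_perimeter_hull:
  fixes X :: "'p \<Rightarrow> real \<Rightarrow> 'a \<Rightarrow> real^2"
  assumes I: "finite I" "I \<noteq> {}" and X: "\<And>p. p \<in> I \<Longrightarrow> planar_process M (X p)"
    and ind: "indep_processes M X I"
    and law: "\<And>p \<theta> x. p \<in> I \<Longrightarrow> x \<ge> 0 \<Longrightarrow>
      emeasure M {\<omega>\<in>space M. \<forall>t\<in>unit_dyadics. X p t \<omega> \<bullet> dir \<theta> \<le> x} = ennreal (G p x)"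
    and G: "\<And>p x. p \<in> I \<Longrightarrow> x \<ge> 0 \<Longrightarrow> 0 \<le> G p x"
    and nondeg: "AE \<omega> in M. interior (convex hull (traces X I {0..1} \<omega>)) \<noteq> {}"
    and q: "ennreal (2 * pi) * (\<integral>\<^sup>+x. ennreal (1 - (\<Prod>p\<in>I. G p x)) * indicator {0..} x \<partial>lborel) = ennreal q" "q \<ge> 0"
  shows "has_bochner_integral M (\<lambda>\<omega>. perimeter (convex hull (traces X I {0..1} \<omega>))) q"
proof -
  let ?K = "\<lambda>\<omega>. convex hull (traces X I {0..1} \<omega>)"
  let ?D = "\<lambda>\<omega>. traces X I unit_dyadics \<omega>"
  let ?L = "\<lambda>\<omega>. perimeter (?K \<omega>)"
  define J where "J = I \<times> unit_dyadics"
  have cJ: "countable J" unfolding J_def by (intro countable_SIGMA countable_finite[OF I(1)] countable_unit_dyadics)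
  have cont: "continuous_on {0..1} (\<lambda>t. X p t \<omega>)" if "p \<in> I" "\<omega> \<in> space M" for p \<omega>
    by (rule planar_process_continuous[OF X that(2)]) (rule that(1))
  have comp: "(\<lambda>\<omega>. X (fst a) (snd a) \<omega> $ c) \<in> borel_measurable M" if "a \<in> J" for a c
    using that unit_dyadics_subset unfolding J_def by (intro planar_process_component_measurable[OF X]) auto
  have m2: "(\<lambda>z. ennreal ((X (fst a) (snd a) (snd z) - X (fst b) (snd b) (snd z)) \<bullet> dir (fst z))) \<in> borel_measurable (lborel \<Otimes>\<^sub>M M)"
    if "a \<in> J" "b \<in> J" for a b
  proof -
    note [measurable] = comp[OF that(1)] comp[OF that(2)]
    show ?thesis unfolding inner_dir vector_minus_component by measurable
  qed
  have wm: "(\<lambda>z. width (?D (snd z)) (fst z)) \<in> borel_measurable (lborel \<Otimes>\<^sub>M M)"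
    unfolding width_traces J_def[symmetric] using cJ m2 by (intro borel_measurable_SUP) auto
  interpret pair_sigma_finite "lborel :: real measure" M ..
  define Wd where "Wd \<omega> = width_integral (?D \<omega>)" for \<omega>
  have wm1: "(\<lambda>(\<theta>, \<omega>). width (?D \<omega>) \<theta> * indicator {0..2*pi} \<theta>) \<in> borel_measurable (lborel \<Otimes>\<^sub>M M)"
    using wm by (simp add: case_prod_beta')
  have Wd[measurable]: "Wd \<in> borel_measurable M"
  proof -
    have "(\<lambda>(\<omega>, \<theta>). width (?D \<omega>) \<theta> * indicator {0..2*pi} \<theta>) \<in> borel_measurable (M \<Otimes>\<^sub>M lborel)"
      using measurable_compose[OF measurable_pair_swap' wm1] by (simp add: case_prod_beta')
    then show ?thesis unfolding Wd_def width_integral_def by (rule lborel.borel_measurable_nn_integral)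
  qed
  have per: "?L \<omega> = (if interior (?K \<omega>) = {} then (THE l. False) else enn2real (Wd \<omega>) / 2)" if \<omega>: "\<omega> \<in> space M" for \<omega>
  proof -
    have K: "convex (?K \<omega>)" "compact (?K \<omega>)"
      using compact_traces[where X=X and I=I and \<omega>=\<omega>, OF I(1) cont[OF _ \<omega>]] by (auto intro: compact_convex_hull)
    have "Wd \<omega> = width_integral (?K \<omega>)"
      unfolding Wd_def width_integral_def using width_hull_traces[where X=X and I=I and \<omega>=\<omega>, OF cont[OF _ \<omega>]] by simp
    then show ?thesis using cauchy_perimeter[OF K] perimeter_empty_interior[OF K] by auto
  qed
  \<comment> \<open>The degenerate event, written with countably many triples of dyadic points so
    that it is visibly measurable.\<close>
  define N where "N = {\<omega>\<in>space M. \<forall>a\<in>J. \<forall>b\<in>J. \<forall>c\<in>J.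
    cross (X (fst b) (snd b) \<omega> - X (fst a) (snd a) \<omega>) (X (fst c) (snd c) \<omega> - X (fst a) (snd a) \<omega>) = 0}"
  have N[measurable]: "N \<in> sets M" unfolding N_def
  proof (intro sets_Collect_Ball_countable cJ)
    fix a b c assume "a \<in> J" "b \<in> J" "c \<in> J"
    note [measurable] = comp[OF this(1)] comp[OF this(2)] comp[OF this(3)]
    show "{\<omega>\<in>space M. cross (X (fst b) (snd b) \<omega> - X (fst a) (snd a) \<omega>) (X (fst c) (snd c) \<omega> - X (fst a) (snd a) \<omega>) = 0} \<in> sets M"
      unfolding cross_def vector_minus_component by measurable
  qed
  have NK: "interior (?K \<omega>) = {} \<longleftrightarrow> \<omega> \<in> N" if "\<omega> \<in> space M" for \<omega>
  proof -
    have "interior (?K \<omega>) = {} \<longleftrightarrow> (\<forall>p\<in>?D \<omega>. \<forall>q\<in>?D \<omega>. \<forall>r\<in>?D \<omega>. cross (q - p) (r - p) = 0)"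
      by (rule interior_hull_traces_empty_iff[where X=X and I=I and \<omega>=\<omega>]) (rule cont[OF _ that])
    also have "\<dots> \<longleftrightarrow> \<omega> \<in> N" using that by (auto simp: N_def J_def traces_def)
    finally show ?thesis .
  qed
  have Lm: "?L \<in> borel_measurable M"
  proof -
    have "(\<lambda>\<omega>. if \<omega> \<in> N then (THE l::real. False) else enn2real (Wd \<omega>) / 2) \<in> borel_measurable M" by measurable
    moreover have "?L \<omega> = (if \<omega> \<in> N then (THE l::real. False) else enn2real (Wd \<omega>) / 2)" if "\<omega> \<in> space M" for \<omega>
      using per[OF that] NK[OF that] by simp
    ultimately show ?thesis by (subst measurable_cong)
  qed
  have zero: "AE \<omega> in M. 0 \<in> ?D \<omega>"
  proof -
    obtain p where p: "p \<in> I" using I by blast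
    have "AE \<omega> in M. X p 0 \<omega> = 0" using X[OF p] by (simp add: planar_process_def)
    then show ?thesis
      by eventually_elim (use p zero_in_unit_dyadics in \<open>force simp: traces_def\<close>)
  qed
  define Q where "Q = (\<integral>\<^sup>+x. ennreal (1 - (\<Prod>p\<in>I. G p x)) * indicator {0..} x \<partial>lborel)"
  have sm: "(\<lambda>\<omega>. support (?D \<omega>) \<theta>) \<in> borel_measurable M" for \<theta>
  proof -
    have "(\<lambda>\<omega>. ennreal (X (fst a) (snd a) \<omega> \<bullet> dir \<theta>)) \<in> borel_measurable M" if "a \<in> J" for a
    proof -
      note [measurable] = comp[OF that]
      show ?thesis unfolding inner_dir by measurable
    qed
    then show ?thesis unfolding support_traces J_def[symmetric] using cJ by (intro borel_measurable_SUP) auto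
  qed
  \<comment> \<open>\<open>law\<close> holds in every direction with the same \<open>G\<close>, so
    the two support terms have equal expectation, whatever \<theta> is.\<close>
  have Ew: "(\<integral>\<^sup>+\<omega>. width (?D \<omega>) \<theta> \<partial>M) = 2 * Q" for \<theta>
  proof -
    have "(\<integral>\<^sup>+\<omega>. width (?D \<omega>) \<theta> \<partial>M) = (\<integral>\<^sup>+\<omega>. support (?D \<omega>) \<theta> + support (?D \<omega>) (\<theta> + pi) \<partial>M)"
      by (intro nn_integral_cong_AE eventually_mono[OF zero] width_eq_support)
    also have "\<dots> = (\<integral>\<^sup>+\<omega>. support (?D \<omega>) \<theta> \<partial>M) + (\<integral>\<^sup>+\<omega>. support (?D \<omega>) (\<theta> + pi) \<partial>M)"
      by (rule nn_integral_add[OF sm sm])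
    also have "\<dots> = Q + Q"
      using expectation_support_traces[OF I X ind law G] by (simp add: Q_def)
    finally show ?thesis by (simp add: mult_2)
  qed
  have "(\<integral>\<^sup>+\<omega>. Wd \<omega> \<partial>M) = (\<integral>\<^sup>+\<theta>. \<integral>\<^sup>+\<omega>. width (?D \<omega>) \<theta> * indicator {0..2*pi} \<theta> \<partial>M \<partial>lborel)"
    unfolding Wd_def width_integral_def by (rule Fubini'[OF wm1])
  also have "\<dots> = (\<integral>\<^sup>+\<theta>. 2 * Q * indicator {0..2*pi} \<theta> \<partial>lborel)"
  proof (rule nn_integral_cong)
    fix \<theta>
    have "(\<lambda>\<omega>. width (?D \<omega>) \<theta>) \<in> borel_measurable M"
      using measurable_compose[OF measurable_Pair[OF measurable_const[of \<theta> lborel M] measurable_ident_sets[OF refl]] wm] by simp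
    then show "(\<integral>\<^sup>+\<omega>. width (?D \<omega>) \<theta> * indicator {0..2*pi} \<theta> \<partial>M) = 2 * Q * indicator {0..2*pi} \<theta>"
      by (simp add: nn_integral_multc Ew)
  qed
  also have "\<dots> = 2 * Q * ennreal (2 * pi)" by (simp add: nn_integral_cmult)
  also have "\<dots> = 2 * ennreal q" using q(1) by (simp add: Q_def mult_ac)
  finally have EW: "(\<integral>\<^sup>+\<omega>. Wd \<omega> \<partial>M) = 2 * ennreal q" .
  have fin: "AE \<omega> in M. Wd \<omega> \<noteq> \<infinity>"
    by (rule nn_integral_noteq_infinite[OF Wd]) (simp add: EW ennreal_mult_eq_top_iff)
  have L: "AE \<omega> in M. 0 \<le> ?L \<omega> \<and> ennreal (?L \<omega>) * 2 = Wd \<omega>"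
    using nondeg fin AE_space
  proof eventually_elim
    case (elim \<omega>)
    then have e: "?L \<omega> = enn2real (Wd \<omega>) / 2" using per by simp
    have "ennreal (enn2real (Wd \<omega>) / 2) * ennreal 2 = ennreal (enn2real (Wd \<omega>))"
      by (subst ennreal_mult[symmetric]) auto
    also have "\<dots> = Wd \<omega>" using elim(2) by (intro ennreal_enn2real) (simp add: less_top)
    finally show ?case unfolding e by simp
  qed
  have "(\<integral>\<^sup>+\<omega>. ennreal (?L \<omega>) \<partial>M) * 2 = (\<integral>\<^sup>+\<omega>. Wd \<omega> \<partial>M)"
    using Lm L by (subst nn_integral_multc[symmetric]) (auto intro!: nn_integral_cong_AE elim: eventually_mono)
  then have "2 * (\<integral>\<^sup>+\<omega>. ennreal (?L \<omega>) \<partial>M) = 2 * ennreal q" unfolding EW by (simp only: mult.commute)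
  then have "(\<integral>\<^sup>+\<omega>. ennreal (?L \<omega>) \<partial>M) = ennreal q" by (simp add: ennreal_mult_cancel_left)
  moreover have "AE \<omega> in M. 0 \<le> ?L \<omega>" using L by (rule eventually_mono) blast
  ultimately show ?thesis using Lm q(2) by (intro has_bochner_integral_nn_integral)
qed

end

theorem mainTheorem4:
  fixes M :: "'a measure"
    and m n :: nat
    and W B :: "nat \<Rightarrow> real \<Rightarrow> 'a \<Rightarrow> real^2"
    and L :: "'a \<Rightarrow> real"
  assumes "prob_space M"
    and "m > 0" and "n > 0"
    and "\<And>i. i \<in> {1..m} \<Longrightarrow> planar_brownian_motion M (W i)"
    and "\<And>j. j \<in> {1..n} \<Longrightarrow> planar_brownian_bridge M (B j)"
    and "indep_processes M (case_sum W B) ({1..m} <+> {1..n})"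
  defines "L \<equiv> \<lambda>\<omega>. perimeter (convex hull
      ((\<Union>i\<in>{1..m}. {W i t \<omega> |t. t \<in> {0..1}}) \<union> (\<Union>j\<in>{1..n}. {B j t \<omega> |t. t \<in> {0..1}})))"
  shows "integrable M L \<and>
    prob_space.expectation M L =
      2 * m * sqrt (2 * pi) *
        (LBINT x:{0..}. x * exp (- (x\<^sup>2 / 2)) * erf (x / sqrt 2) ^ (m - 1)
                        * (1 - exp (- 2 * x\<^sup>2)) ^ n) +
      8 * n * pi *
        (LBINT x:{0..}. x\<^sup>2 * exp (- 2 * x\<^sup>2) * erf (x / sqrt 2) ^ m
                        * (1 - exp (- 2 * x\<^sup>2)) ^ (n - 1))"
proof -
  interpret prob_space M by fact
  note motion = assms(4) and bridge = assms(5)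
  define I where "I = {1..m} <+> {1..n}"
  define X where "X = case_sum W B"
  define G :: "nat + nat \<Rightarrow> real \<Rightarrow> real" where "G = case_sum (\<lambda>i x. erf (x / sqrt 2)) (\<lambda>j x. 1 - exp (- 2 * x\<^sup>2) :: real)"
  define q where "q = 2 * real m * sqrt (2 * pi) * (LBINT x:{0..}. motion_integrand m n x) +
    8 * real n * pi * (LBINT x:{0..}. bridge_integrand m n x)"
  have I: "finite I" "I \<noteq> {}" using assms(2) by (auto simp: I_def)
  have "traces X I {0..1} \<omega> = (\<Union>i\<in>{1..m}. {W i t \<omega> |t. t \<in> {0..1}}) \<union> (\<Union>j\<in>{1..n}. {B j t \<omega> |t. t \<in> {0..1}})" for \<omega>
    by (force simp: traces_def I_def X_def)
  then have L: "L = (\<lambda>\<omega>. perimeter (convex hull (traces X I {0..1} \<omega>)))" by (simp add: L_def)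
  have ind: "indep_processes M X I" unfolding X_def I_def by (rule assms(6))
  have X: "planar_process M (X p)" if "p \<in> I" for p
  proof (cases p)
    case (Inl i)
    then show ?thesis using that planar_process_motion[OF motion, of i] by (auto simp: I_def X_def)
  next
    case (Inr j)
    then show ?thesis using that planar_process_bridge[OF bridge, of j] by (auto simp: I_def X_def)
  qed
  have law: "emeasure M {\<omega>\<in>space M. \<forall>t\<in>unit_dyadics. X p t \<omega> \<bullet> dir \<theta> \<le> x} = ennreal (G p x)" if "p \<in> I" "x \<ge> 0" for p \<theta> x
  proof (cases p)
    case (Inl i)
    then show ?thesis using that emeasure_sup_motion[OF assms(1) motion that(2), of i \<theta>] by (auto simp: I_def X_def G_def)
  next
    case (Inr j)
    then show ?thesis using that emeasure_sup_bridge[OF assms(1) bridge that(2), of j \<theta>] by (auto simp: I_def X_def G_def)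
  qed
  have G: "0 \<le> G p x" if "p \<in> I" "x \<ge> 0" for p x
    using that erf_bounds[OF that(2)] by (auto simp: I_def G_def)
  have prod: "(\<Prod>p\<in>I. G p x) = max_cdf m n x" for x
    unfolding I_def by (subst prod.Plus) (auto simp: G_def max_cdf_def)
  have nondeg: "AE \<omega> in M. interior (convex hull (traces X I {0..1} \<omega>)) \<noteq> {}"
  proof -
    \<comment> \<open>The first motion alone makes the hull nondegenerate: three of its points are
      almost surely not collinear.\<close>
    have "AE \<omega> in M. cross (W 1 (1/2) \<omega> - W 1 0 \<omega>) (W 1 1 \<omega> - W 1 0 \<omega>) \<noteq> 0"
      using assms(2) by (intro motion_not_collinear[OF assms(1) motion]) auto
    then show ?thesis
    proof eventually_elim
      case (elim \<omega>)
      have "W 1 t \<omega> \<in> traces X I {0..1} \<omega>" if "t \<in> {0..1}" for t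
        unfolding traces_def using assms(2) that by (intro image_eqI[of _ _ "(Inl 1, t)"]) (auto simp: X_def I_def)
      then have "W 1 (1/2) \<omega> \<in> traces X I {0..1} \<omega>" "W 1 0 \<omega> \<in> traces X I {0..1} \<omega>" "W 1 1 \<omega> \<in> traces X I {0..1} \<omega>" by auto
      then show ?case using elim unfolding interior_convex_hull_empty_iff by blast
    qed
  qed
  have "0 \<le> (LBINT x:{0..}. motion_integrand m n x)" "0 \<le> (LBINT x:{0..}. bridge_integrand m n x)"
    unfolding set_lebesgue_integral_def using integrand_bounds
    by (auto intro!: integral_nonneg simp: indicator_def)
  then have q0: "q \<ge> 0" by (simp add: q_def)
  have "has_bochner_integral M L q" unfolding L
    using nn_integral_max_cdf[of m n] q0 unfolding q_def[symmetric]
    by (intro expected_perimeter_hull[OF I X ind law G nondeg]) (simp_all add: prod)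
  then show ?thesis unfolding has_bochner_integral_iff q_def motion_integrand_def bridge_integrand_def by simp
qed

end
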